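(* Let $n\ge2$, $1\le k\le n$, $k'=n+1-k$. The map $\Omega:\mathcal{UD}(\mathcal V(A_n^{(1)}))=\mathbb Z^{kk'}\to B^{k,\infty}$, $x=(x^{(l)}_m)\mapsto (b_{ji})$, given by $$b_{ji}:=x^{(k-j+1)}_i-x^{(k-j+1)}_{i-1}\qquad(1\le j\le k,\ j\le i\le j+k'),$$ where $x^{(l)}_m$ is understood to be $0$ if $(l,m)\notin S_1=\{(l,m):1\le l\le k<l+m\le n+1\}$, is an isomorphism of ($A_n^{(1)}$-)crystals.
   Context: $I=\{0,1,\dots,n\}$. An isomorphism of the crystals below is a bijection commuting with all $\tilde e_i$ (hence with $\tilde f_i=\tilde e_i^{-1}$) and preserving all $\mathrm{wt}_i,\varepsilon_i$ (hence $\varphi_i=\varepsilon_i+\mathrm{wt}_i$), $i\in I$. **The geometric crystal $\mathcal V(A_n^{(1)})$ in coordinates.** Let $S_1$ be as in the claim, $S_2=\{(l,m):1\le l\le k\le l+m\le n\}$. Coordinates $x=(x^{(l)}_m)_{S_1}\in(\mathbb C^\times)^{kk'}$ (the positive structure $v_1$), with $x^{(l)}_m=1$ for $(l,m)\notin S_1$. For $1\le i\le n$, $a=\max(k-i+1,1)$, $b=\min(k,n-i+1)$: $$D^{(l)}_i=\frac{x^{(l)}_i\prod_{j=l+1}^{b}(x^{(j)}_i)^2}{\prod_{j=l+1}^{b+1}x^{(j)}_{i-1}\prod_{j=l}^{b}x^{(j)}_{i+1}},\quad \gamma_i=D^{(a)}_i\frac{x^{(a)}_i}{x^{(a)}_{i-1}x^{(a-1)}_{i+1}},\quad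 \varepsilon_i=\sum_{l=a}^b\frac1{D^{(l)}_i},$$ and $e_i^c(x)=x'$ with $x'^{(l)}_m=x^{(l)}_m$ for $m\neq i$ and $x'^{(l)}_i=x^{(l)}_i\frac{\sum_{p=a}^{l-1}1/D^{(p)}_i+\sum_{p=l}^{b}c/D^{(p)}_i}{\sum_{p=a}^{l}1/D^{(p)}_i+\sum_{p=l+1}^{b}c/D^{(p)}_i}$. For $i=0$: for $(l,m)\in S_1$ let $X^{(l)}_m(x)$ be the sum over all paths in $S_1$ from $(l,m)$ to $(1,n)$, with steps $(i,j)\to(i,j+1)$ of weight $x^{(i)}_j/x^{(i)}_{j+1}$ and $(i,j)\to(i-1,j+1)$ of weight $1$, of the product of step weights; $X^{(l)}_m:=1/x^{(1)}_n$ if $l+m=k$, $X^{(k+1)}_m:=1$. Let $\Sigma:(\mathbb C^\times)^{S_1}\to(\mathbb C^\times)^{S_2}$, $\Sigma(x)^{(l)}_m=x^{(l+1)}_mX^{(l)}_m/X^{(l+1)}_m$; it is birational with positive inverse. With $y=\Sigma(x)$ (and $y^{(l)}_m=1$ outside $S_2$), $\gamma_0(x)=\frac{(y^{(k)}_0)^2}{y^{(k-1)}_1y^{(k)}_1}$, $\varepsilon_0(x)=\frac{y^{(k)}_1}{y^{(k)}_0}$, $e_0^c(x)=\Sigma^{-1}(y')$, where $y'$ is $y$ with $y^{(k)}_0$ replaced by $c\,y^{(k)}_0$. **Ultra-discretization.** For a positive rational map $f$ between algebraic tori (each component is a ratio of positive combinations of characters), $\mathcal{UD}(f)$ is the map of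 cocharacter lattices with $\langle\eta,\mathcal{UD}(f)(\xi)\rangle=\deg_c(\eta\circ f\circ\xi)(c)$ ($\deg$ of numerator minus $\deg$ of denominator); i.e. in a subtraction-free expression replace $\cdot,/,+$ by $+,-,\max$. The crystal $\mathcal{UD}(\mathcal V(A_n^{(1)}))$ is $\mathbb Z^{kk'}$ (coordinates again $x^{(l)}_m$) with $\mathrm{wt}_i=\mathcal{UD}(\gamma_i)$, $\varepsilon_i=\mathcal{UD}(\varepsilon_i)$, and $\tilde e_i^{\,d}(x)=\mathcal{UD}(e_i)(d,x)$ for $d\in\mathbb Z$, where $e_i(c,x)=e_i^c(x)$. **The crystal $B^{k,\infty}$.** $B^{k,\infty}$ is the set of integer arrays $b=(b_{ji})_{1\le j\le k,\ j\le i\le j+k'}$ with $\sum_{i=j}^{j+k'}b_{ji}=0$ for every $j$; $b_{ji}=0$ outside this range. For $1\le i\le n$: $\beta=\max(0,i-k')$, $\gamma=\min(k,i)$, $\Gamma_i(c)=\sum_{\beta<j<c}(b_{ji}-b_{j+1,i+1})$ for $\beta<c\le\gamma$; $c_0$ (resp. $c_1$) is the smallest (resp. largest) $c\in(\beta,\gamma]$ at which $\Gamma_i$ attains its minimum; $$\varepsilon_i(b)=\sum_{\beta\le j<c_0}(b_{j+1,i+1}-b_{ji}),\quad \varphi_i(b)=\sum_{c_1\le j\le\gamma}(b_{ji}-b_{j+1,i+1}),$$ $\tilde e_i(b)_{pq}=b_{pq}-\delta_{p,c_0}\delta_{q,i+1}+\delta_{p,c_0}\delta_{q,i}$, $\tilde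 f_i(b)_{pq}=b_{pq}-\delta_{p,c_1}\delta_{q,i}+\delta_{p,c_1}\delta_{q,i+1}$. For $i=0$: $C=\{(c_0,\dots,c_k)\in\mathbb N^{k+1}:1=c_0<c_1<\dots<c_k=n+1\}$ with the componentwise partial order $\preceq$; $\Delta_b(c)=\sum_{j=1}^k\sum_{c_{j-1}<i<c_j}b_{ji}$. There is a unique $c^{(e)}\in C$ with $\Delta_b(c^{(e)})\le\Delta_b(c)$ if $c^{(e)}\preceq c$ and $\Delta_b(c^{(e)})<\Delta_b(c)$ if $c^{(e)}\not\preceq c$, and a unique $c^{(f)}\in C$ with $\Delta_b(c^{(f)})\le\Delta_b(c)$ if $c\preceq c^{(f)}$ and $\Delta_b(c^{(f)})<\Delta_b(c)$ if $c\not\preceq c^{(f)}$. Then $\varepsilon_0(b)=-b_{k,n+1}-\Delta_b(c^{(e)})$, $\varphi_0(b)=-b_{11}-\Delta_b(c^{(f)})$, $\tilde e_0(b)_{ji}=b_{ji}-\delta_{i,c^{(e)}_{j-1}}+\delta_{i,c^{(e)}_j}$, $\tilde f_0(b)_{ji}=b_{ji}-\delta_{i,c^{(f)}_j}+\delta_{i,c^{(f)}_{j-1}}$. For all $i\in I$, $\mathrm{wt}_i=\varphi_i-\varepsilon_i$. *)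

theory Defs
  imports Complex_Main "HOL-Computational_Algebra.Polynomial"
begin

section \<open>Algebraic tori, positive rational maps and ultra-discretization\<close>

text \<open>For a finite index set S, the torus of dimension \<open>card S\<close> and its cocharacter lattice are
  carried by total functions that take the neutral value 1, respectively 0, outside S.\<close>

definition torus :: "'v set \<Rightarrow> ('v \<Rightarrow> complex) set" where
  "torus S = {x. \<forall>v. if v \<in> S then x v \<noteq> 0 else x v = 1}"

definition cochars :: "'v set \<Rightarrow> ('v \<Rightarrow> int) set" where
  "cochars S = {\<xi>. \<forall>v. v \<notin> S \<longrightarrow> \<xi> v = 0}"

definition character :: "'v set \<Rightarrow> ('v \<Rightarrow> int) \<Rightarrow> ('v \<Rightarrow> complex) \<Rightarrow> complex" where
  "character S \<eta> x = (\<Prod>v\<in>S. x v powi \<eta> v)"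

definition cocharacter :: "'v set \<Rightarrow> ('v \<Rightarrow> int) \<Rightarrow> complex \<Rightarrow> 'v \<Rightarrow> complex" where
  "cocharacter S \<xi> c = (\<lambda>v. if v \<in> S then c powi \<xi> v else 1)"

definition pairing :: "'v set \<Rightarrow> ('v \<Rightarrow> int) \<Rightarrow> ('v \<Rightarrow> int) \<Rightarrow> int" where
  "pairing S \<eta> \<xi> = (\<Sum>v\<in>S. \<eta> v * \<xi> v)"

definition laurent_poly :: "'v set \<Rightarrow> (('v \<Rightarrow> complex) \<Rightarrow> complex) \<Rightarrow> bool" where
  "laurent_poly S p \<longleftrightarrow>
     (\<exists>A (a :: ('v \<Rightarrow> int) \<Rightarrow> complex). finite A \<and> p = (\<lambda>x. \<Sum>\<eta>\<in>A. a \<eta> * character S \<eta> x))"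

definition positive_laurent_poly :: "'v set \<Rightarrow> (('v \<Rightarrow> complex) \<Rightarrow> complex) \<Rightarrow> bool" where
  "positive_laurent_poly S p \<longleftrightarrow>
     (\<exists>A (a :: ('v \<Rightarrow> int) \<Rightarrow> real). finite A \<and> A \<noteq> {} \<and> (\<forall>\<eta>\<in>A. a \<eta> > 0) \<and>
        p = (\<lambda>x. \<Sum>\<eta>\<in>A. of_real (a \<eta>) * character S \<eta> x))"

text \<open>Validity on a nonempty Zariski open subset of the torus. A rational map is represented by any
  total function that agrees with it generically, so the values that HOL assigns to quotients with
  zero denominator are immaterial.\<close>

definition generically :: "'v set \<Rightarrow> (('v \<Rightarrow> complex) \<Rightarrow> bool) \<Rightarrow> bool" where
  "generically S P \<longleftrightarrow>
     (\<exists>h. laurent_poly S h \<and> (\<exists>x\<in>torus S. h x \<noteq> 0) \<and> (\<forall>x\<in>torus S. h x \<noteq> 0 \<longrightarrow> P x))"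

definition positive_quotient ::
  "'v set \<Rightarrow> (('v \<Rightarrow> complex) \<Rightarrow> complex) \<Rightarrow> (('v \<Rightarrow> complex) \<Rightarrow> complex) \<Rightarrow> (('v \<Rightarrow> complex) \<Rightarrow> complex) \<Rightarrow> bool"
where
  "positive_quotient S f p q \<longleftrightarrow> positive_laurent_poly S p \<and> positive_laurent_poly S q \<and>
     generically S (\<lambda>x. f x = p x / q x)"

definition positive_map ::
  "'v set \<Rightarrow> 'w set \<Rightarrow> (('v \<Rightarrow> complex) \<Rightarrow> 'w \<Rightarrow> complex) \<Rightarrow> bool" where
  "positive_map S T f \<longleftrightarrow> generically S (\<lambda>x. f x \<in> torus T) \<and>
     (\<forall>w\<in>T. \<exists>p q. positive_quotient S (\<lambda>x. f x w) p q)"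

definition has_rational_degree :: "(complex \<Rightarrow> complex) \<Rightarrow> int \<Rightarrow> bool" where
  "has_rational_degree g d \<longleftrightarrow>
     (\<exists>p q. p \<noteq> 0 \<and> q \<noteq> 0 \<and> finite {c. g c \<noteq> poly p c / poly q c} \<and>
        d = int (degree p) - int (degree q))"

text \<open>The composite of \<open>\<eta> \<circ> f\<close> with a cocharacter is formed from a presentation of \<open>\<eta> \<circ> f\<close> as a
  quotient of positive combinations of characters: the image of the cocharacter may lie in the
  locus on which the total function f does not represent the rational map.\<close>

definition UD ::
  "'v set \<Rightarrow> 'w set \<Rightarrow> (('v \<Rightarrow> complex) \<Rightarrow> 'w \<Rightarrow> complex) \<Rightarrow> ('v \<Rightarrow> int) \<Rightarrow> 'w \<Rightarrow> int" where
  "UD S T f \<xi> = (THE \<zeta>. \<zeta> \<in> cochars T \<and>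
     (\<forall>\<eta>. \<exists>p q. positive_quotient S (\<lambda>x. character T \<eta> (f x)) p q \<and>
        has_rational_degree (\<lambda>c. p (cocharacter S \<xi> c) / q (cocharacter S \<xi> c)) (pairing T \<eta> \<zeta>)))"

definition UD_fun :: "'v set \<Rightarrow> (('v \<Rightarrow> complex) \<Rightarrow> complex) \<Rightarrow> ('v \<Rightarrow> int) \<Rightarrow> int" where
  "UD_fun S f \<xi> = UD S {()} (\<lambda>x _. f x) \<xi> ()"

text \<open>For \<open>e(c, x)\<close>, the coordinate c of the additional factor has index \<open>None\<close>.\<close>

definition UD_action ::
  "'v set \<Rightarrow> (complex \<Rightarrow> ('v \<Rightarrow> complex) \<Rightarrow> 'v \<Rightarrow> complex) \<Rightarrow> int \<Rightarrow> ('v \<Rightarrow> int) \<Rightarrow> 'v \<Rightarrow> int" where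
  "UD_action S e d x =
     UD (insert None (Some ` S)) S (\<lambda>z. e (z None) (\<lambda>v. z (Some v))) (case_option d x)"

definition positive_birational_inverse ::
  "'v set \<Rightarrow> 'w set \<Rightarrow> (('v \<Rightarrow> complex) \<Rightarrow> 'w \<Rightarrow> complex) \<Rightarrow> (('w \<Rightarrow> complex) \<Rightarrow> 'v \<Rightarrow> complex) \<Rightarrow> bool"
where
  "positive_birational_inverse S T f g \<longleftrightarrow> positive_map T S g \<and>
     generically S (\<lambda>x. g (f x) = x) \<and> generically T (\<lambda>y. f (g y) = y)"


section \<open>Crystals\<close>

record 'b crystal =
  elems :: "'b set"
  e_op :: "nat \<Rightarrow> 'b \<Rightarrow> 'b"
  f_op :: "nat \<Rightarrow> 'b \<Rightarrow> 'b"
  wt :: "nat \<Rightarrow> 'b \<Rightarrow> int"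
  eps :: "nat \<Rightarrow> 'b \<Rightarrow> int"
  phi :: "nat \<Rightarrow> 'b \<Rightarrow> int"

text \<open>The operators \<open>e_op\<close> are invertible in the crystals considered here, so the clauses on
  \<open>f_op\<close> and \<open>phi\<close> follow from the others when \<open>f_op\<close> is the inverse of \<open>e_op\<close> and
  \<open>phi = eps + wt\<close>. They are stated because the crystals below give \<open>f_op\<close> and \<open>phi\<close> by separate
  formulas.\<close>

definition crystal_iso :: "nat set \<Rightarrow> 'a crystal \<Rightarrow> 'b crystal \<Rightarrow> ('a \<Rightarrow> 'b) \<Rightarrow> bool" where
  "crystal_iso I A B h \<longleftrightarrow> bij_betw h (elems A) (elems B) \<and>
     (\<forall>i\<in>I. \<forall>x\<in>elems A.
        h (e_op A i x) = e_op B i (h x) \<and>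
        h (f_op A i x) = f_op B i (h x) \<and>
        wt B i (h x) = wt A i x \<and>
        eps B i (h x) = eps A i x \<and>
        phi B i (h x) = phi A i x)"


section \<open>The geometric crystal in coordinates\<close>

text \<open>The coordinate with upper index l and lower index m is \<open>x (l, m)\<close>.\<close>

definition S1 :: "nat \<Rightarrow> nat \<Rightarrow> (nat \<times> nat) set" where
  "S1 n k = {(l, m). 1 \<le> l \<and> l \<le> k \<and> k < l + m \<and> l + m \<le> n + 1}"

definition S2 :: "nat \<Rightarrow> nat \<Rightarrow> (nat \<times> nat) set" where
  "S2 n k = {(l, m). 1 \<le> l \<and> l \<le> k \<and> k \<le> l + m \<and> l + m \<le> n}"

definition lo :: "nat \<Rightarrow> nat \<Rightarrow> nat" where
  "lo k i = max (k + 1 - i) 1"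

definition hi :: "nat \<Rightarrow> nat \<Rightarrow> nat \<Rightarrow> nat" where
  "hi n k i = min k (n + 1 - i)"

definition D_coef :: "nat \<Rightarrow> nat \<Rightarrow> nat \<Rightarrow> nat \<Rightarrow> (nat \<times> nat \<Rightarrow> complex) \<Rightarrow> complex" where
  "D_coef n k l i x = (x (l, i) * (\<Prod>j = l + 1..hi n k i. (x (j, i))\<^sup>2)) /
     ((\<Prod>j = l + 1..hi n k i + 1. x (j, i - 1)) * (\<Prod>j = l..hi n k i. x (j, i + 1)))"

definition is_step :: "nat \<times> nat \<Rightarrow> nat \<times> nat \<Rightarrow> bool" where
  "is_step p q \<longleftrightarrow> snd q = snd p + 1 \<and> (fst q = fst p \<or> fst p = fst q + 1)"

definition paths :: "nat \<Rightarrow> nat \<Rightarrow> nat \<times> nat \<Rightarrow> (nat \<times> nat) list set" where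
  "paths n k p = {P. P \<noteq> [] \<and> hd P = p \<and> last P = (1, n) \<and> set P \<subseteq> S1 n k \<and> successively is_step P}"

definition step_weight :: "(nat \<times> nat \<Rightarrow> complex) \<Rightarrow> nat \<times> nat \<Rightarrow> nat \<times> nat \<Rightarrow> complex" where
  "step_weight x p q = (if fst q = fst p then x p / x q else 1)"

definition path_weight :: "(nat \<times> nat \<Rightarrow> complex) \<Rightarrow> (nat \<times> nat) list \<Rightarrow> complex" where
  "path_weight x P = (\<Prod>t<length P - 1. step_weight x (P ! t) (P ! Suc t))"

definition X_sum :: "nat \<Rightarrow> nat \<Rightarrow> (nat \<times> nat \<Rightarrow> complex) \<Rightarrow> nat \<Rightarrow> nat \<Rightarrow> complex" where
  "X_sum n k x l m =
     (if l = k + 1 then 1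
      else if l + m = k then 1 / x (1, n)
      else (\<Sum>P\<in>paths n k (l, m). path_weight x P))"

definition Sigma_map :: "nat \<Rightarrow> nat \<Rightarrow> (nat \<times> nat \<Rightarrow> complex) \<Rightarrow> nat \<times> nat \<Rightarrow> complex" where
  "Sigma_map n k x =
     (\<lambda>(l, m). if (l, m) \<in> S2 n k then x (l + 1, m) * X_sum n k x l m / X_sum n k x (l + 1) m else 1)"

text \<open>Two positive birational inverses agree generically, so the choice does not affect
  ultra-discretizations.\<close>

definition Sigma_inv :: "nat \<Rightarrow> nat \<Rightarrow> (nat \<times> nat \<Rightarrow> complex) \<Rightarrow> nat \<times> nat \<Rightarrow> complex" where
  "Sigma_inv n k = (SOME g. positive_birational_inverse (S1 n k) (S2 n k) (Sigma_map n k) g)"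

definition geom_gamma :: "nat \<Rightarrow> nat \<Rightarrow> nat \<Rightarrow> (nat \<times> nat \<Rightarrow> complex) \<Rightarrow> complex" where
  "geom_gamma n k i x =
     (if i = 0 then
        let y = Sigma_map n k x in (y (k, 0))\<^sup>2 / (y (k - 1, 1) * y (k, 1))
      else
        let a = lo k i in D_coef n k a i x * (x (a, i) / (x (a, i - 1) * x (a - 1, i + 1))))"

definition geom_eps :: "nat \<Rightarrow> nat \<Rightarrow> nat \<Rightarrow> (nat \<times> nat \<Rightarrow> complex) \<Rightarrow> complex" where
  "geom_eps n k i x =
     (if i = 0 then
        let y = Sigma_map n k x in y (k, 1) / y (k, 0)
      else (\<Sum>l = lo k i..hi n k i. 1 / D_coef n k l i x))"

definition geom_e ::
  "nat \<Rightarrow> nat \<Rightarrow> nat \<Rightarrow> complex \<Rightarrow> (nat \<times> nat \<Rightarrow> complex) \<Rightarrow> nat \<times> nat \<Rightarrow> complex" where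
  "geom_e n k i c x =
     (if i = 0 then
        let y = Sigma_map n k x in Sigma_inv n k (y((k, 0) := c * y (k, 0)))
      else
        let a = lo k i; b = hi n k i in
        (\<lambda>(l, m). if (l, m) \<in> S1 n k \<and> m = i
           then x (l, i) *
             (((\<Sum>p = a..<l. 1 / D_coef n k p i x) + (\<Sum>p = l..b. c / D_coef n k p i x)) /
              ((\<Sum>p = a..l. 1 / D_coef n k p i x) + (\<Sum>p = l + 1..b. c / D_coef n k p i x)))
           else x (l, m)))"

definition UD_V :: "nat \<Rightarrow> nat \<Rightarrow> (nat \<times> nat \<Rightarrow> int) crystal" where
  "UD_V n k =
     \<lparr>elems = cochars (S1 n k),
      e_op = (\<lambda>i. UD_action (S1 n k) (geom_e n k i) 1),
      f_op = (\<lambda>i. UD_action (S1 n k) (geom_e n k i) (- 1)),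
      wt = (\<lambda>i. UD_fun (S1 n k) (geom_gamma n k i)),
      eps = (\<lambda>i. UD_fun (S1 n k) (geom_eps n k i)),
      phi = (\<lambda>i x. UD_fun (S1 n k) (geom_eps n k i) x + UD_fun (S1 n k) (geom_gamma n k i) x)\<rparr>"


section \<open>The limit of perfect crystals\<close>

definition B_elems :: "nat \<Rightarrow> nat \<Rightarrow> (nat \<Rightarrow> nat \<Rightarrow> int) set" where
  "B_elems n k = (let k' = n + 1 - k in
     {b. (\<forall>j i. \<not> (1 \<le> j \<and> j \<le> k \<and> j \<le> i \<and> i \<le> j + k') \<longrightarrow> b j i = 0) \<and>
         (\<forall>j\<in>{1..k}. (\<Sum>i = j..j + k'. b j i) = 0)})"

text \<open>Truncated subtraction gives \<open>\<beta> = max 0 (i - k')\<close>.\<close>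

definition B_beta :: "nat \<Rightarrow> nat \<Rightarrow> nat \<Rightarrow> nat" where
  "B_beta n k i = i - (n + 1 - k)"

definition B_gamma :: "nat \<Rightarrow> nat \<Rightarrow> nat" where
  "B_gamma k i = min k i"

definition B_Gamma :: "nat \<Rightarrow> nat \<Rightarrow> nat \<Rightarrow> (nat \<Rightarrow> nat \<Rightarrow> int) \<Rightarrow> nat \<Rightarrow> int" where
  "B_Gamma n k i b c = (\<Sum>j\<in>{B_beta n k i<..<c}. b j i - b (j + 1) (i + 1))"

definition B_argmin :: "nat \<Rightarrow> nat \<Rightarrow> nat \<Rightarrow> (nat \<Rightarrow> nat \<Rightarrow> int) \<Rightarrow> nat set" where
  "B_argmin n k i b = {c \<in> {B_beta n k i<..B_gamma k i}.
     \<forall>c'\<in>{B_beta n k i<..B_gamma k i}. B_Gamma n k i b c \<le> B_Gamma n k i b c'}"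

text \<open>The list \<open>c\<close> represents the sequence with entries \<open>c ! 0, \<dots>, c ! k\<close>.\<close>

definition B_C :: "nat \<Rightarrow> nat \<Rightarrow> nat list set" where
  "B_C n k = {c. length c = k + 1 \<and> c ! 0 = 1 \<and> c ! k = n + 1 \<and> (\<forall>j<k. c ! j < c ! (j + 1))}"

definition C_le :: "nat list \<Rightarrow> nat list \<Rightarrow> bool" where
  "C_le c d \<longleftrightarrow> list_all2 (\<le>) c d"

definition B_Delta :: "nat \<Rightarrow> (nat \<Rightarrow> nat \<Rightarrow> int) \<Rightarrow> nat list \<Rightarrow> int" where
  "B_Delta k b c = (\<Sum>j = 1..k. \<Sum>i\<in>{c ! (j - 1)<..<c ! j}. b j i)"

definition B_ce :: "nat \<Rightarrow> nat \<Rightarrow> (nat \<Rightarrow> nat \<Rightarrow> int) \<Rightarrow> nat list" where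
  "B_ce n k b = (THE c. c \<in> B_C n k \<and> (\<forall>d\<in>B_C n k.
     (C_le c d \<longrightarrow> B_Delta k b c \<le> B_Delta k b d) \<and>
     (\<not> C_le c d \<longrightarrow> B_Delta k b c < B_Delta k b d)))"

definition B_cf :: "nat \<Rightarrow> nat \<Rightarrow> (nat \<Rightarrow> nat \<Rightarrow> int) \<Rightarrow> nat list" where
  "B_cf n k b = (THE c. c \<in> B_C n k \<and> (\<forall>d\<in>B_C n k.
     (C_le d c \<longrightarrow> B_Delta k b c \<le> B_Delta k b d) \<and>
     (\<not> C_le d c \<longrightarrow> B_Delta k b c < B_Delta k b d)))"

definition B_eps :: "nat \<Rightarrow> nat \<Rightarrow> nat \<Rightarrow> (nat \<Rightarrow> nat \<Rightarrow> int) \<Rightarrow> int" where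
  "B_eps n k i b =
     (if i = 0 then - b k (n + 1) - B_Delta k b (B_ce n k b)
      else (\<Sum>j = B_beta n k i..<Min (B_argmin n k i b). b (j + 1) (i + 1) - b j i))"

definition B_phi :: "nat \<Rightarrow> nat \<Rightarrow> nat \<Rightarrow> (nat \<Rightarrow> nat \<Rightarrow> int) \<Rightarrow> int" where
  "B_phi n k i b =
     (if i = 0 then - b 1 1 - B_Delta k b (B_cf n k b)
      else (\<Sum>j = Max (B_argmin n k i b)..B_gamma k i. b j i - b (j + 1) (i + 1)))"

definition B_e :: "nat \<Rightarrow> nat \<Rightarrow> nat \<Rightarrow> (nat \<Rightarrow> nat \<Rightarrow> int) \<Rightarrow> nat \<Rightarrow> nat \<Rightarrow> int" where
  "B_e n k i b =
     (if i = 0 then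
        let c = B_ce n k b in
        (\<lambda>p q. if 1 \<le> p \<and> p \<le> k
           then b p q - of_bool (q = c ! (p - 1)) + of_bool (q = c ! p) else b p q)
      else
        let c = Min (B_argmin n k i b) in
        (\<lambda>p q. b p q - of_bool (p = c \<and> q = i + 1) + of_bool (p = c \<and> q = i)))"

definition B_f :: "nat \<Rightarrow> nat \<Rightarrow> nat \<Rightarrow> (nat \<Rightarrow> nat \<Rightarrow> int) \<Rightarrow> nat \<Rightarrow> nat \<Rightarrow> int" where
  "B_f n k i b =
     (if i = 0 then
        let c = B_cf n k b in
        (\<lambda>p q. if 1 \<le> p \<and> p \<le> k
           then b p q - of_bool (q = c ! p) + of_bool (q = c ! (p - 1)) else b p q)
      else
        let c = Max (B_argmin n k i b) in
        (\<lambda>p q. b p q - of_bool (p = c \<and> q = i) + of_bool (p = c \<and> q = i + 1)))"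

definition B_inf :: "nat \<Rightarrow> nat \<Rightarrow> (nat \<Rightarrow> nat \<Rightarrow> int) crystal" where
  "B_inf n k =
     \<lparr>elems = B_elems n k,
      e_op = B_e n k,
      f_op = B_f n k,
      wt = (\<lambda>i b. B_phi n k i b - B_eps n k i b),
      eps = B_eps n k,
      phi = B_phi n k\<rparr>"

text \<open>Elements of \<open>cochars (S1 n k)\<close> vanish outside \<open>S1 n k\<close>, as the formula requires.\<close>

definition Omega :: "nat \<Rightarrow> nat \<Rightarrow> (nat \<times> nat \<Rightarrow> int) \<Rightarrow> nat \<Rightarrow> nat \<Rightarrow> int" where
  "Omega n k x = (let k' = n + 1 - k in
     (\<lambda>j i. if 1 \<le> j \<and> j \<le> k \<and> j \<le> i \<and> i \<le> j + k'
        then x (k + 1 - j, i) - x (k + 1 - j, i - 1) else 0))"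

end

(* For i > 0, tropicalizing the explicit formulas turns 1/D into -D, and the differences of
   consecutive tropical D's are the summands of Gamma, so the maximizers of -D correspond to the
   minimizers of Gamma under l = k + 1 - j.

   For i = 0, put V = x / X. In terms of V the map Sigma has a linear recursive inverse with positive
   coefficients, and the action of e_0 multiplies V by R / c, where R satisfies the recursion of X
   normalized to total weight 1. Hence e_0^c(x) = x R(l, m) / R(l + 1, m); this is first obtained
   for an arbitrary birational inverse of Sigma by pulling back the identity that defines it. After
   tropicalization the weights of the recursion become nonpositive reduced costs with respect to the
   potential X, the tropical R is the indicator function of the points above a greedy optimal path
   (up to sign), and the greedy paths are the extremal minimizers c^(e) and c^(f) of Delta. *)
theory Submission
  imports Defs
begin

section \<open>Laurent polynomials on tori\<close>

text \<open>The functions are total and \<open>Sigma_inv\<close> is an arbitrary choice, so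
  equalities of rational maps hold only off some unknown hypersurface, while a cocharacter may run
  inside it. The positive real points of the torus resolve this: they are Zariski dense, so generic
  identities of Laurent polynomials can be tested there, and positive Laurent polynomials never
  vanish there, so subtraction-free formulas hold there without exception. For real t > 0 a
  cocharacter consists of positive points, and its growth exponent as t tends to infinity computes
  the degree in \<open>UD\<close>; addition becomes max because positive leading coefficients cannot
  cancel. The formula for e_0 comes from y(l, m) = V(l + 1, m) X(l, m), a rewriting of y = Sigma(x).
  Only y(k, 0) is multiplied by c. So when V is multiplied by R / c, X(l, m) must be multiplied by c
  / R(l + 1, m), except at (k, 0), and x = V X by R(l, m) / R(l + 1, m).\<close>

definition preals :: "complex set" where
  "preals = complex_of_real ` {0<..}"

lemma preals_iff: "z \<in> preals \<longleftrightarrow> Re z > 0 \<and> Im z = 0"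
  by (auto simp: preals_def complex_eq_iff image_iff)

lemma preals_nonzero: "z \<in> preals \<Longrightarrow> z \<noteq> 0"
  by (auto simp: preals_def)

lemma preals_of_real [simp]: "of_real r \<in> preals \<longleftrightarrow> r > 0"
  by (auto simp: preals_iff)

lemma preals_one [simp]: "1 \<in> preals"
  by (simp add: preals_iff)

lemma preals_add [intro]: "a \<in> preals \<Longrightarrow> b \<in> preals \<Longrightarrow> a + b \<in> preals"
  by (simp add: preals_iff)

lemma preals_mult [intro]: "a \<in> preals \<Longrightarrow> b \<in> preals \<Longrightarrow> a * b \<in> preals"
  by (simp add: preals_iff)

lemma preals_divide [intro]: "a \<in> preals \<Longrightarrow> b \<in> preals \<Longrightarrow> a / b \<in> preals"
  unfolding preals_def by (auto simp flip: of_real_divide intro!: imageI)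

lemma preals_powi [intro]: "a \<in> preals \<Longrightarrow> a powi i \<in> preals"
  unfolding preals_def by (auto simp flip: of_real_power_int intro!: imageI)

lemma preals_prod: "(\<And>i. i \<in> I \<Longrightarrow> f i \<in> preals) \<Longrightarrow> prod f I \<in> preals"
  by (induction I rule: infinite_finite_induct) auto

lemma infinite_preals: "infinite preals"
  unfolding preals_def using infinite_Ioi[of "0::real"]
  by (subst finite_image_iff) (auto simp: inj_on_def)

text \<open>Serves both for arbitrary complex coefficients and for positive ones. Since the positive
  reals lack 0, only 1 is demanded, and sums are taken over nonempty index sets.\<close>

definition semiring_set :: "complex set \<Rightarrow> bool" where
  "semiring_set K \<longleftrightarrow> 1 \<in> K \<and> (\<forall>a\<in>K. \<forall>b\<in>K. a + b \<in> K \<and> a * b \<in> K)"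

lemma semiring_set_UNIV: "semiring_set UNIV"
  by (simp add: semiring_set_def)

lemma semiring_set_preals: "semiring_set preals"
  by (auto simp: semiring_set_def)

lemma semiring_set_sum:
  assumes "semiring_set K" "finite I" "I \<noteq> {}" "\<And>i. i \<in> I \<Longrightarrow> f i \<in> K"
  shows "sum f I \<in> K"
  using assms(2,3,4) assms(1) by (induction rule: finite_ne_induct) (auto simp: semiring_set_def)

text \<open>Products of characters are characters only on the torus, so Laurent polynomials are
  identified here with their restrictions to it.\<close>

definition laurent_on ::
  "complex set \<Rightarrow> 'v set \<Rightarrow> (('v \<Rightarrow> complex) \<Rightarrow> complex) \<Rightarrow> bool" where
  "laurent_on K S f \<longleftrightarrow> (\<exists>A (a :: ('v \<Rightarrow> int) \<Rightarrow> complex). finite A \<and> A \<noteq> {} \<and> (\<forall>\<eta>\<in>A. a \<eta> \<in> K) \<and>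
     (\<forall>x\<in>torus S. f x = (\<Sum>\<eta>\<in>A. a \<eta> * character S \<eta> x)))"

lemma laurent_on_mono: "laurent_on K S f \<Longrightarrow> K \<subseteq> K' \<Longrightarrow> laurent_on K' S f"
  unfolding laurent_on_def by blast

lemma laurent_on_UNIV: "laurent_on K S f \<Longrightarrow> laurent_on UNIV S f"
  by (rule laurent_on_mono) auto

text \<open>Collects the terms with equal exponents, so that sums indexed by disjoint unions and by
  products, which arise from addition and multiplication, need no injectivity.\<close>

lemma laurent_onI:
  fixes \<eta> :: "'i \<Rightarrow> 'v \<Rightarrow> int"
  assumes "semiring_set K" "finite I" "I \<noteq> {}" "\<And>i. i \<in> I \<Longrightarrow> a i \<in> K"
    and "\<And>x. x \<in> torus S \<Longrightarrow> f x = (\<Sum>i\<in>I. a i * character S (\<eta> i) x)"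
  shows "laurent_on K S f"
  unfolding laurent_on_def
proof (intro exI conjI ballI)
  let ?a = "\<lambda>\<theta>. \<Sum>i\<in>{i\<in>I. \<eta> i = \<theta>}. a i"
  show "finite (\<eta> ` I)" "\<eta> ` I \<noteq> {}" using assms by auto
  show "?a \<theta> \<in> K" if "\<theta> \<in> \<eta> ` I" for \<theta>
    using that assms by (intro semiring_set_sum) auto
  show "f x = (\<Sum>\<theta>\<in>\<eta> ` I. ?a \<theta> * character S \<theta> x)" if "x \<in> torus S" for x
    unfolding assms(5)[OF that]
    by (subst sum.image_gen[OF assms(2), of _ \<eta>]) (simp add: sum_distrib_right)
qed

lemma torus_nonzero: "x \<in> torus S \<Longrightarrow> x v \<noteq> 0"
  by (auto simp: torus_def split: if_splits dest: spec[of _ v])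

lemma character_zero: "character S (\<lambda>_. 0) x = 1"
  by (simp add: character_def)

lemma character_plus:
  "x \<in> torus S \<Longrightarrow> character S (\<lambda>v. \<eta> v + \<theta> v) x = character S \<eta> x * character S \<theta> x"
  by (simp add: character_def power_int_add torus_nonzero prod.distrib)

lemma laurent_on_const: "semiring_set K \<Longrightarrow> c \<in> K \<Longrightarrow> laurent_on K S (\<lambda>_. c)"
  by (rule laurent_onI[where I = "{()}" and a = "\<lambda>_. c" and \<eta> = "\<lambda>_ _. 0"])
     (auto simp: character_zero)

lemma laurent_on_coord:
  assumes "semiring_set K" "finite S"
  shows "laurent_on K S (\<lambda>x. x v)"
proof (rule laurent_onI[where I = "{()}" and a = "\<lambda>_. 1" and \<eta> = "\<lambda>_ w. of_bool (w = v)"])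
  show "x v = (\<Sum>i\<in>{()}. 1 * character S (\<lambda>w. of_bool (w = v)) x)" if "x \<in> torus S" for x
  proof -
    have "character S (\<lambda>w. of_bool (w = v)) x = (\<Prod>w\<in>S. if w = v then x v else 1)"
      unfolding character_def by (intro prod.cong) auto
    also have "\<dots> = x v" using assms that by (simp add: prod.delta' torus_def)
    finally show ?thesis by simp
  qed
qed (use assms in \<open>auto simp: semiring_set_def\<close>)

lemma laurent_on_add:
  assumes "semiring_set K" "laurent_on K S f" "laurent_on K S g"
  shows "laurent_on K S (\<lambda>x. f x + g x)"
proof -
  obtain A a where A: "finite A" "A \<noteq> {}" "\<forall>\<eta>\<in>A. a \<eta> \<in> K"
      "\<forall>x\<in>torus S. f x = (\<Sum>\<eta>\<in>A. a \<eta> * character S \<eta> x)"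
    using assms(2) unfolding laurent_on_def by blast
  obtain B b where B: "finite B" "B \<noteq> {}" "\<forall>\<eta>\<in>B. b \<eta> \<in> K"
      "\<forall>x\<in>torus S. g x = (\<Sum>\<eta>\<in>B. b \<eta> * character S \<eta> x)"
    using assms(3) unfolding laurent_on_def by blast
  note * = A B
  show ?thesis
  proof (rule laurent_onI[where I = "A <+> B" and a = "case_sum a b" and \<eta> = "case_sum id id"])
    show "case_sum a b i \<in> K" if "i \<in> A <+> B" for i
      using that *(3,7) by auto
    show "f x + g x = (\<Sum>i\<in>A <+> B. case_sum a b i * character S (case_sum id id i) x)"
      if "x \<in> torus S" for x
      using that * by (simp add: sum.Plus)
  qed (use assms(1) *(1,2,5,6) in auto)
qed

lemma laurent_on_mult:
  assumes "semiring_set K" "laurent_on K S f" "laurent_on K S g"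
  shows "laurent_on K S (\<lambda>x. f x * g x)"
proof -
  obtain A a where A: "finite A" "A \<noteq> {}" "\<forall>\<eta>\<in>A. a \<eta> \<in> K"
      "\<forall>x\<in>torus S. f x = (\<Sum>\<eta>\<in>A. a \<eta> * character S \<eta> x)"
    using assms(2) unfolding laurent_on_def by blast
  obtain B b where B: "finite B" "B \<noteq> {}" "\<forall>\<eta>\<in>B. b \<eta> \<in> K"
      "\<forall>x\<in>torus S. g x = (\<Sum>\<eta>\<in>B. b \<eta> * character S \<eta> x)"
    using assms(3) unfolding laurent_on_def by blast
  note * = A B
  show ?thesis
  proof (rule laurent_onI[where I = "A \<times> B" and a = "\<lambda>i. a (fst i) * b (snd i)"
          and \<eta> = "\<lambda>i v. fst i v + snd i v"])
    show "a (fst i) * b (snd i) \<in> K" if "i \<in> A \<times> B" for i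
      using that *(3,7) assms(1) by (auto simp: semiring_set_def)
    show "f x * g x = (\<Sum>i\<in>A \<times> B. a (fst i) * b (snd i) * character S (\<lambda>v. fst i v + snd i v) x)"
      if "x \<in> torus S" for x
    proof -
      have "f x * g x = (\<Sum>(\<eta>, \<theta>)\<in>A \<times> B. (a \<eta> * character S \<eta> x) * (b \<theta> * character S \<theta> x))"
        using that *(4,8) by (simp add: sum_product sum.cartesian_product)
      also have "\<dots> = (\<Sum>i\<in>A \<times> B. a (fst i) * b (snd i) * character S (\<lambda>v. fst i v + snd i v) x)"
        by (intro sum.cong refl) (simp add: character_plus[OF that] split: prod.splits)
      finally show ?thesis .
    qed
  qed (use assms(1) *(1,2,5,6) in auto)
qed

lemma laurent_on_diff:
  assumes "laurent_on UNIV S f" "laurent_on UNIV S g"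
  shows "laurent_on UNIV S (\<lambda>x. f x - g x)"
  using laurent_on_add[OF _ assms(1) laurent_on_mult[OF _ laurent_on_const[of UNIV "-1"] assms(2)]]
  by (simp add: semiring_set_UNIV)

lemma laurent_on_iff_laurent_poly:
  "laurent_on UNIV S f \<longleftrightarrow> (\<exists>p. laurent_poly S p \<and> (\<forall>x\<in>torus S. f x = p x))"
proof
  assume "laurent_on UNIV S f"
  then obtain A a where "finite A" "\<forall>x\<in>torus S. f x = (\<Sum>\<eta>\<in>A. a \<eta> * character S \<eta> x)"
    unfolding laurent_on_def by blast
  then show "\<exists>p. laurent_poly S p \<and> (\<forall>x\<in>torus S. f x = p x)"
    unfolding laurent_poly_def
    by (intro exI[of _ "\<lambda>x. \<Sum>\<eta>\<in>A. a \<eta> * character S \<eta> x"] conjI exI[of _ A] exI[of _ a]) auto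
next
  assume "\<exists>p. laurent_poly S p \<and> (\<forall>x\<in>torus S. f x = p x)"
  then obtain A a where A: "finite A" "\<forall>x\<in>torus S. f x = (\<Sum>\<eta>\<in>A. a \<eta> * character S \<eta> x)"
    unfolding laurent_poly_def by force
  \<comment> \<open>The zero polynomial may be presented by an empty sum, but
    \<open>laurent_on\<close> wants a nonempty support. So the exponent 0 is added, with coefficient
    0 if it is new.\<close>
  have "f x = (\<Sum>\<eta>\<in>insert (\<lambda>_. 0) A. (if \<eta> \<in> A then a \<eta> else 0) * character S \<eta> x)"
    if "x \<in> torus S" for x
  proof -
    have "f x = (\<Sum>\<eta>\<in>A. (if \<eta> \<in> A then a \<eta> else 0) * character S \<eta> x)"
      using A that by simp
    also have "\<dots> = (\<Sum>\<eta>\<in>insert (\<lambda>_. 0) A. (if \<eta> \<in> A then a \<eta> else 0) * character S \<eta> x)"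
      using A by (intro sum.mono_neutral_left) auto
    finally show ?thesis .
  qed
  then show "laurent_on UNIV S f"
    unfolding laurent_on_def using A(1)
    by (intro exI[of _ "insert (\<lambda>_. 0) A"] exI[of _ "\<lambda>\<eta>. if \<eta> \<in> A then a \<eta> else 0"]) simp
qed

lemma laurent_on_iff_positive_laurent_poly:
  "laurent_on preals S f \<longleftrightarrow> (\<exists>p. positive_laurent_poly S p \<and> (\<forall>x\<in>torus S. f x = p x))"
proof
  assume "laurent_on preals S f"
  then obtain A a where A: "finite A" "A \<noteq> {}" "\<forall>\<eta>\<in>A. a \<eta> \<in> preals"
      "\<forall>x\<in>torus S. f x = (\<Sum>\<eta>\<in>A. a \<eta> * character S \<eta> x)"
    unfolding laurent_on_def by blast
  have "of_real (Re (a \<eta>)) = a \<eta>" "Re (a \<eta>) > 0" if "\<eta> \<in> A" for \<eta>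
    using A(3) that by (auto simp: preals_iff complex_eq_iff)
  then show "\<exists>p. positive_laurent_poly S p \<and> (\<forall>x\<in>torus S. f x = p x)"
    unfolding positive_laurent_poly_def using A
    by (intro exI[of _ "\<lambda>x. \<Sum>\<eta>\<in>A. of_real (Re (a \<eta>)) * character S \<eta> x"] conjI exI[of _ A]
        exI[of _ "\<lambda>\<eta>. Re (a \<eta>)"]) auto
next
  assume "\<exists>p. positive_laurent_poly S p \<and> (\<forall>x\<in>torus S. f x = p x)"
  then obtain A and a :: "_ \<Rightarrow> real" where A: "finite A" "A \<noteq> {}" "\<forall>\<eta>\<in>A. a \<eta> > 0"
    "\<forall>x\<in>torus S. f x = (\<Sum>\<eta>\<in>A. of_real (a \<eta>) * character S \<eta> x)"
    unfolding positive_laurent_poly_def by force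
  then show "laurent_on preals S f"
    unfolding laurent_on_def by (intro exI[of _ A] exI[of _ "\<lambda>\<eta>. of_real (a \<eta>)"]) auto
qed

section \<open>Positive points of the torus and their Zariski density\<close>

definition ptorus :: "'v set \<Rightarrow> ('v \<Rightarrow> complex) set" where
  "ptorus S = {x \<in> torus S. \<forall>v. x v \<in> preals}"

lemma ptorus_torus: "x \<in> ptorus S \<Longrightarrow> x \<in> torus S"
  by (simp add: ptorus_def)

lemma ptorus_one: "(\<lambda>_. 1) \<in> ptorus S"
  by (simp add: ptorus_def torus_def)

lemma laurent_on_ptorus:
  assumes "laurent_on preals S f" "x \<in> ptorus S"
  shows "f x \<in> preals"
proof -
  obtain A a where A: "finite A" "A \<noteq> {}" "\<forall>\<eta>\<in>A. a \<eta> \<in> preals"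
      "\<forall>x\<in>torus S. f x = (\<Sum>\<eta>\<in>A. a \<eta> * character S \<eta> x)"
    using assms unfolding laurent_on_def by blast
  have "character S \<eta> x \<in> preals" for \<eta>
    unfolding character_def using assms(2) by (intro preals_prod) (auto simp: ptorus_def)
  then show ?thesis
    using A assms(2) by (auto simp: ptorus_torus intro!: semiring_set_sum semiring_set_preals)
qed

lemma sum_powi_eq_poly:
  fixes b :: "'i \<Rightarrow> complex"
  assumes "finite A"
  shows "\<exists>p N. \<forall>t. t \<noteq> 0 \<longrightarrow> (\<Sum>\<eta>\<in>A. b \<eta> * t powi e \<eta>) * t ^ N = poly p t"
proof -
  define N where "N = (\<Sum>\<eta>\<in>A. nat \<bar>e \<eta>\<bar>)"
  have N: "e \<eta> + int N \<ge> 0" if "\<eta> \<in> A" for \<eta>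
  proof -
    have "nat \<bar>e \<eta>\<bar> \<le> N"
      unfolding N_def using that assms by (intro member_le_sum) auto
    then show ?thesis by linarith
  qed
  have "(\<Sum>\<eta>\<in>A. b \<eta> * t powi e \<eta>) * t ^ N = poly (\<Sum>\<eta>\<in>A. monom (b \<eta>) (nat (e \<eta> + int N))) t"
    if "t \<noteq> 0" for t
    unfolding poly_sum sum_distrib_right
  proof (intro sum.cong refl)
    fix \<eta> assume "\<eta> \<in> A"
    have "t powi e \<eta> * t ^ N = t powi (e \<eta> + int N)"
      using that by (simp add: power_int_add)
    also have "\<dots> = t ^ nat (e \<eta> + int N)"
      using N[OF \<open>\<eta> \<in> A\<close>] by (simp add: power_int_def)
    finally show "b \<eta> * t powi e \<eta> * t ^ N = poly (monom (b \<eta>) (nat (e \<eta> + int N))) t"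
      by (simp add: poly_monom)
  qed
  then show ?thesis by blast
qed

lemma laurent_on_slice:
  assumes "laurent_on UNIV S f" "x \<in> torus S" "finite S" "v \<in> S"
  shows "\<exists>p N. \<forall>t. t \<noteq> 0 \<longrightarrow> f (x(v := t)) * t ^ N = poly p t"
proof -
  obtain A a where A: "finite A" "\<forall>x\<in>torus S. f x = (\<Sum>\<eta>\<in>A. a \<eta> * character S \<eta> x)"
    using assms unfolding laurent_on_def by blast
  have "f (x(v := t)) = (\<Sum>\<eta>\<in>A. (a \<eta> * character (S - {v}) \<eta> x) * t powi \<eta> v)"
    if "t \<noteq> 0" for t
  proof -
    have "x(v := t) \<in> torus S" using assms that by (auto simp: torus_def)
    moreover have "character S \<eta> (x(v := t)) = t powi \<eta> v * character (S - {v}) \<eta> x" for \<eta>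
      unfolding character_def using assms
      by (subst prod.remove[of S v]) (auto intro!: arg_cong2[of _ _ _ _ times] prod.cong)
    ultimately show ?thesis using A by (simp add: mult_ac)
  qed
  then show ?thesis
    using sum_powi_eq_poly[OF A(1), of "\<lambda>\<eta>. a \<eta> * character (S - {v}) \<eta> x" "\<lambda>\<eta>. \<eta> v"] by simp
qed

lemma cocharacter_torus: "c \<noteq> 0 \<Longrightarrow> cocharacter S \<xi> c \<in> torus S"
  by (auto simp: torus_def cocharacter_def)

lemma cocharacter_ptorus: "c \<in> preals \<Longrightarrow> cocharacter S \<xi> c \<in> ptorus S"
  by (auto simp: ptorus_def cocharacter_torus preals_nonzero) (auto simp: cocharacter_def)

lemma character_cocharacter:
  assumes "finite S" "c \<noteq> 0"
  shows "character S \<eta> (cocharacter S \<xi> c) = c powi pairing S \<eta> \<xi>"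
  using assms(1) unfolding character_def pairing_def cocharacter_def
  by (induction rule: finite_induct) (auto simp: assms(2) power_int_add mult.commute
      simp flip: power_int_mult)

lemma laurent_on_cocharacter:
  assumes "laurent_on UNIV S f" "finite S"
  shows "\<exists>p N. \<forall>t. t \<noteq> 0 \<longrightarrow> f (cocharacter S \<xi> t) * t ^ N = poly p t"
proof -
  obtain A a where A: "finite A" "\<forall>x\<in>torus S. f x = (\<Sum>\<eta>\<in>A. a \<eta> * character S \<eta> x)"
    using assms unfolding laurent_on_def by blast
  then show ?thesis
    using sum_powi_eq_poly[OF A(1), of a "\<lambda>\<eta>. pairing S \<eta> \<xi>"] assms(2)
    by (simp add: cocharacter_torus character_cocharacter)
qed

text \<open>On a coordinate line the function is, up to a power of \<open>t\<close>, a polynomial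
  that does not vanish at \<open>t = x v\<close>; hence it has finitely many roots.\<close>

lemma laurent_on_slice_zeros:
  assumes "laurent_on UNIV S f" "x \<in> torus S" "finite S" "v \<in> S" "f x \<noteq> 0"
  shows "finite {t. t \<noteq> 0 \<and> f (x(v := t)) = 0}"
proof -
  obtain p N where p: "\<And>t. t \<noteq> 0 \<Longrightarrow> f (x(v := t)) * t ^ N = poly p t"
    using laurent_on_slice[OF assms(1-4)] by blast
  have "poly p (x v) \<noteq> 0"
    using p[of "x v"] assms(5) torus_nonzero[OF assms(2), of v] by (auto simp: fun_upd_triv)
  then have "finite {t. poly p t = 0}" by (auto intro: poly_roots_finite)
  moreover have "{t. t \<noteq> 0 \<and> f (x(v := t)) = 0} \<subseteq> {t. poly p t = 0}"
    using p by force
  ultimately show ?thesis by (rule finite_subset[rotated])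
qed

text \<open>Moving the coordinates of two points one at a time to common positive values, keeping the
  two functions nonzero at every step, shows that Laurent polynomials form a domain and that the
  positive points are Zariski dense.\<close>

lemma laurent_on_common_nonzero:
  assumes f: "laurent_on UNIV S f" "x \<in> torus S" "f x \<noteq> 0"
    and g: "laurent_on UNIV S g" "y \<in> torus S" "g y \<noteq> 0" and S: "finite S"
  obtains z where "z \<in> ptorus S" "f z \<noteq> 0" "g z \<noteq> 0"
proof -
  have "\<exists>x y. x \<in> torus S \<and> y \<in> torus S \<and> f x \<noteq> 0 \<and> g y \<noteq> 0 \<and> (\<forall>v\<in>F. x v = y v \<and> x v \<in> preals)"
    if "finite F" "F \<subseteq> S" for F
    using that
  proof (induction rule: finite_induct)
    case empty
    then show ?case using f g by auto
  next
    case (insert v F)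
    then obtain x y where xy: "x \<in> torus S" "y \<in> torus S" "f x \<noteq> 0" "g y \<noteq> 0"
      "\<forall>v\<in>F. x v = y v \<and> x v \<in> preals" by auto
    have v: "v \<in> S" using insert by auto
    define Z where "Z = {t. t \<noteq> 0 \<and> f (x(v := t)) = 0} \<union> {t. t \<noteq> 0 \<and> g (y(v := t)) = 0}"
    have "finite Z"
      unfolding Z_def by (rule finite_UnI[OF laurent_on_slice_zeros[OF f(1) xy(1) S v xy(3)]
        laurent_on_slice_zeros[OF g(1) xy(2) S v xy(4)]])
    then have "\<not> preals \<subseteq> Z" using infinite_preals finite_subset by blast
    then obtain t where t: "t \<in> preals" "t \<notin> Z" by blast
    have "t \<noteq> 0" using t by (simp add: preals_nonzero)
    have "x(v := t) \<in> torus S" "y(v := t) \<in> torus S" using xy v \<open>t \<noteq> 0\<close> by (auto simp: torus_def)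
    moreover have "f (x(v := t)) \<noteq> 0" "g (y(v := t)) \<noteq> 0" using t(2) \<open>t \<noteq> 0\<close> unfolding Z_def by blast+
    moreover have "\<forall>u\<in>insert v F. (x(v := t)) u = (y(v := t)) u \<and> (x(v := t)) u \<in> preals"
      using t(1) xy(5) by (metis fun_upd_apply insert_iff)
    ultimately show ?case by (intro exI[of _ "x(v := t)"] exI[of _ "y(v := t)"] conjI)
  qed
  from this[OF S order_refl] obtain x y where xy: "x \<in> torus S" "y \<in> torus S" "f x \<noteq> 0" "g y \<noteq> 0"
      "\<forall>v\<in>S. x v = y v \<and> x v \<in> preals" by blast
  have "x v = y v" "x v \<in> preals" for v using xy by (cases "v \<in> S"; force simp: torus_def)+
  then have "x = y" "x \<in> ptorus S" using xy(1) by (auto simp: ptorus_def)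
  then show thesis using that[of x] xy by simp
qed

section \<open>Generic validity, in general and with control at positive points\<close>

lemma generically_iff:
  "generically S P \<longleftrightarrow>
     (\<exists>h. laurent_on UNIV S h \<and> (\<exists>x\<in>torus S. h x \<noteq> 0) \<and> (\<forall>x\<in>torus S. h x \<noteq> 0 \<longrightarrow> P x))"
proof
  assume "generically S P"
  then show "\<exists>h. laurent_on UNIV S h \<and> (\<exists>x\<in>torus S. h x \<noteq> 0) \<and> (\<forall>x\<in>torus S. h x \<noteq> 0 \<longrightarrow> P x)"
    unfolding generically_def laurent_on_iff_laurent_poly by blast
next
  assume "\<exists>h. laurent_on UNIV S h \<and> (\<exists>x\<in>torus S. h x \<noteq> 0) \<and> (\<forall>x\<in>torus S. h x \<noteq> 0 \<longrightarrow> P x)"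
  then obtain h p where "laurent_poly S p" "\<forall>x\<in>torus S. h x = p x" "\<exists>x\<in>torus S. h x \<noteq> 0"
    "\<forall>x\<in>torus S. h x \<noteq> 0 \<longrightarrow> P x"
    unfolding laurent_on_iff_laurent_poly by blast
  then show "generically S P" unfolding generically_def by auto
qed

lemma generically_mono:
  "generically S P \<Longrightarrow> (\<And>x. x \<in> torus S \<Longrightarrow> P x \<Longrightarrow> Q x) \<Longrightarrow> generically S Q"
  unfolding generically_def by blast

lemma generically_conj:
  assumes "finite S" "generically S P" "generically S Q"
  shows "generically S (\<lambda>x. P x \<and> Q x)"
proof -
  obtain h x g y where h: "laurent_on UNIV S h" "x \<in> torus S" "h x \<noteq> 0" "\<forall>x\<in>torus S. h x \<noteq> 0 \<longrightarrow> P x"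
    and g: "laurent_on UNIV S g" "y \<in> torus S" "g y \<noteq> 0" "\<forall>x\<in>torus S. g x \<noteq> 0 \<longrightarrow> Q x"
    using assms unfolding generically_iff by blast
  obtain z where "z \<in> ptorus S" "h z \<noteq> 0" "g z \<noteq> 0"
    using laurent_on_common_nonzero[OF h(1-3) g(1-3) assms(1)] .
  then show ?thesis
    unfolding generically_iff using laurent_on_mult[OF semiring_set_UNIV h(1) g(1)] h g
    by (intro exI[of _ "\<lambda>x. h x * g x"]) (auto intro!: bexI[of _ z] ptorus_torus)
qed

text \<open>A point with nonzero value would make \<open>f\<close> nonzero generically, and two
  generic conditions always have a common point.\<close>

lemma laurent_on_generically_zero:
  assumes "finite S" "laurent_on UNIV S f" "generically S (\<lambda>x. f x = 0)" "x \<in> torus S"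
  shows "f x = 0"
proof (rule ccontr)
  assume "f x \<noteq> 0"
  then have "generically S (\<lambda>x. f x \<noteq> 0)"
    using assms unfolding generically_iff by blast
  from generically_conj[OF assms(1) this assms(3)] show False
    by (auto simp: generically_def)
qed

text \<open>Unlike in \<open>generically\<close>, the exceptional set is the zero locus of a
  positive Laurent polynomial. Such a locus misses every positive point, so the property is
  available on all of \<open>ptorus S\<close>.\<close>

definition pgenerically :: "'v set \<Rightarrow> (('v \<Rightarrow> complex) \<Rightarrow> bool) \<Rightarrow> bool" where
  "pgenerically S P \<longleftrightarrow> (\<exists>h. laurent_on preals S h \<and> (\<forall>x\<in>torus S. h x \<noteq> 0 \<longrightarrow> P x))"

lemma pgenerically_ptorus: "pgenerically S P \<Longrightarrow> x \<in> ptorus S \<Longrightarrow> P x"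
  unfolding pgenerically_def using laurent_on_ptorus preals_nonzero ptorus_torus by metis

lemma pgenerically_generically: "pgenerically S P \<Longrightarrow> generically S P"
  unfolding pgenerically_def generically_iff
  using laurent_on_ptorus[OF _ ptorus_one] preals_nonzero ptorus_torus[OF ptorus_one] laurent_on_UNIV
  by metis

lemma pgenerically_mono:
  "pgenerically S P \<Longrightarrow> (\<And>x. x \<in> torus S \<Longrightarrow> P x \<Longrightarrow> Q x) \<Longrightarrow> pgenerically S Q"
  unfolding pgenerically_def by blast

lemma pgenerically_all: "(\<And>x. x \<in> torus S \<Longrightarrow> P x) \<Longrightarrow> pgenerically S P"
  unfolding pgenerically_def
  by (intro exI[of _ "\<lambda>_. 1"]) (simp add: laurent_on_const semiring_set_preals)

lemma pgenerically_conj: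
  assumes "pgenerically S P" "pgenerically S Q"
  shows "pgenerically S (\<lambda>x. P x \<and> Q x)"
proof -
  obtain h g where "laurent_on preals S h" "\<forall>x\<in>torus S. h x \<noteq> 0 \<longrightarrow> P x"
    "laurent_on preals S g" "\<forall>x\<in>torus S. g x \<noteq> 0 \<longrightarrow> Q x"
    using assms unfolding pgenerically_def by blast
  then show ?thesis unfolding pgenerically_def
    by (intro exI[of _ "\<lambda>x. h x * g x"]) (auto intro: laurent_on_mult semiring_set_preals)
qed

lemma pgenerically_finite_Ball:
  assumes "finite I" "\<And>i. i \<in> I \<Longrightarrow> pgenerically S (P i)"
  shows "pgenerically S (\<lambda>x. \<forall>i\<in>I. P i x)"
  using assms by (induction rule: finite_induct) (auto intro: pgenerically_conj pgenerically_all)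

lemma laurent_on_pgenerically_nonzero:
  "laurent_on preals S f \<Longrightarrow> pgenerically S (\<lambda>x. f x \<noteq> 0)"
  unfolding pgenerically_def by blast

section \<open>Positive rational functions and tropicalization\<close>

text \<open>The denominator is positive for every \<open>K\<close>. With \<open>K = UNIV\<close>
  this describes pullbacks of arbitrary Laurent polynomials along positive maps, which still can be
  evaluated at all positive points.\<close>

definition rational_on ::
  "complex set \<Rightarrow> 'v set \<Rightarrow> (('v \<Rightarrow> complex) \<Rightarrow> complex) \<Rightarrow> bool" where
  "rational_on K S f \<longleftrightarrow> (\<exists>p q. laurent_on K S p \<and> laurent_on preals S q \<and>
     pgenerically S (\<lambda>x. q x \<noteq> 0 \<and> f x = p x / q x))"

lemma rational_onI:
  assumes "laurent_on K S p" "laurent_on preals S q" "pgenerically S (\<lambda>x. q x \<noteq> 0 \<longrightarrow> f x = p x / q x)"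
  shows "rational_on K S f"
  unfolding rational_on_def
proof (intro exI conjI)
  show "pgenerically S (\<lambda>x. q x \<noteq> 0 \<and> f x = p x / q x)"
    by (rule pgenerically_mono[OF
          pgenerically_conj[OF laurent_on_pgenerically_nonzero[OF assms(2)] assms(3)]]) blast
qed (rule assms)+

lemma laurent_on_rational_on: "laurent_on K S f \<Longrightarrow> rational_on K S f"
  by (rule rational_onI[where p = f and q = "\<lambda>_. 1"])
     (auto intro: laurent_on_const semiring_set_preals pgenerically_all)

lemma rational_on_UNIV: "rational_on K S f \<Longrightarrow> rational_on UNIV S f"
  unfolding rational_on_def using laurent_on_UNIV by blast

lemma rational_on_add:
  assumes K: "semiring_set K" "preals \<subseteq> K" and "rational_on K S f" "rational_on K S g"
  shows "rational_on K S (\<lambda>x. f x + g x)"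
proof -
  obtain p q where pq: "laurent_on K S p" "laurent_on preals S q"
      "pgenerically S (\<lambda>x. q x \<noteq> 0 \<and> f x = p x / q x)"
    using assms(3) unfolding rational_on_def by blast
  obtain r s where rs: "laurent_on K S r" "laurent_on preals S s"
      "pgenerically S (\<lambda>x. s x \<noteq> 0 \<and> g x = r x / s x)"
    using assms(4) unfolding rational_on_def by blast
  note l = laurent_on_mono[OF _ K(2)]
  show ?thesis
  proof (rule rational_onI[where p = "\<lambda>x. p x * s x + r x * q x" and q = "\<lambda>x. q x * s x"])
    show "pgenerically S (\<lambda>x. q x * s x \<noteq> 0 \<longrightarrow> f x + g x = (p x * s x + r x * q x) / (q x * s x))"
      by (rule pgenerically_mono[OF pgenerically_conj[OF pq(3) rs(3)]]) (auto simp: field_simps)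
  qed (intro laurent_on_add laurent_on_mult K semiring_set_preals pq(1,2) rs(1,2) l)+
qed

lemma rational_on_mult:
  assumes K: "semiring_set K" and "rational_on K S f" "rational_on K S g"
  shows "rational_on K S (\<lambda>x. f x * g x)"
proof -
  obtain p q where pq: "laurent_on K S p" "laurent_on preals S q"
      "pgenerically S (\<lambda>x. q x \<noteq> 0 \<and> f x = p x / q x)"
    using assms(2) unfolding rational_on_def by blast
  obtain r s where rs: "laurent_on K S r" "laurent_on preals S s"
      "pgenerically S (\<lambda>x. s x \<noteq> 0 \<and> g x = r x / s x)"
    using assms(3) unfolding rational_on_def by blast
  show ?thesis
  proof (rule rational_onI[where p = "\<lambda>x. p x * r x" and q = "\<lambda>x. q x * s x"])
    show "pgenerically S (\<lambda>x. q x * s x \<noteq> 0 \<longrightarrow> f x * g x = (p x * r x) / (q x * s x))"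
      by (rule pgenerically_mono[OF pgenerically_conj[OF pq(3) rs(3)]]) (auto simp: field_simps)
  qed (intro laurent_on_mult K semiring_set_preals pq(1,2) rs(1,2))+
qed

lemma rational_on_cong:
  assumes "rational_on K S f" "pgenerically S (\<lambda>x. g x = f x)"
  shows "rational_on K S g"
proof -
  obtain p q where pq: "laurent_on K S p" "laurent_on preals S q"
      "pgenerically S (\<lambda>x. q x \<noteq> 0 \<and> f x = p x / q x)"
    using assms(1) unfolding rational_on_def by blast
  show ?thesis
    by (rule rational_onI[OF pq(1,2)])
       (rule pgenerically_mono[OF pgenerically_conj[OF pq(3) assms(2)]], auto)
qed

lemma rational_on_inverse:
  assumes "rational_on preals S f"
  shows "rational_on preals S (\<lambda>x. inverse (f x))"
proof -
  obtain p q where pq: "laurent_on preals S p" "laurent_on preals S q"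
      "pgenerically S (\<lambda>x. q x \<noteq> 0 \<and> f x = p x / q x)"
    using assms unfolding rational_on_def by blast
  show ?thesis
    by (rule rational_onI[OF pq(2,1)]) (rule pgenerically_mono[OF pq(3)], auto)
qed

lemma rational_on_divide:
  assumes "rational_on preals S f" "rational_on preals S g"
  shows "rational_on preals S (\<lambda>x. f x / g x)"
  using rational_on_mult[OF semiring_set_preals assms(1) rational_on_inverse[OF assms(2)]]
  by (simp add: divide_inverse)

lemma rational_on_const: "semiring_set K \<Longrightarrow> c \<in> K \<Longrightarrow> rational_on K S (\<lambda>_. c)"
  by (intro laurent_on_rational_on laurent_on_const)

lemma rational_on_coord: "finite S \<Longrightarrow> rational_on preals S (\<lambda>x. x v)"
  by (intro laurent_on_rational_on laurent_on_coord semiring_set_preals)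

lemma rational_on_prod:
  assumes "\<And>i. i \<in> I \<Longrightarrow> rational_on preals S (f i)"
  shows "rational_on preals S (\<lambda>x. \<Prod>i\<in>I. f i x)"
  using assms
  by (induction I rule: infinite_finite_induct)
     (auto intro: rational_on_mult rational_on_const semiring_set_preals)

lemma rational_on_sum:
  assumes "finite I" "I \<noteq> {}" "semiring_set K" "preals \<subseteq> K" "\<And>i. i \<in> I \<Longrightarrow> rational_on K S (f i)"
  shows "rational_on K S (\<lambda>x. \<Sum>i\<in>I. f i x)"
  using assms(1,2,5)
  by (induction rule: finite_ne_induct) (simp_all add: rational_on_add[OF assms(3,4)])

lemma rational_on_power:
  assumes "rational_on preals S f"
  shows "rational_on preals S (\<lambda>x. f x ^ m)"
  using rational_on_prod[OF assms, of "{..<m}"] by simp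

lemma rational_on_powi:
  assumes "rational_on preals S f"
  shows "rational_on preals S (\<lambda>x. f x powi i)"
  unfolding power_int_def power_inverse[symmetric]
  by (cases "i \<ge> 0") (simp_all add: rational_on_power rational_on_inverse assms)

lemma rational_on_pgenerically_nonzero:
  assumes "rational_on preals S f"
  shows "pgenerically S (\<lambda>x. f x \<noteq> 0)"
proof -
  obtain p q where pq: "laurent_on preals S p" "laurent_on preals S q"
      "pgenerically S (\<lambda>x. q x \<noteq> 0 \<and> f x = p x / q x)"
    using assms unfolding rational_on_def by blast
  show ?thesis
    by (rule pgenerically_mono[OF pgenerically_conj[OF pq(3) laurent_on_pgenerically_nonzero[OF pq(1)]]])
       auto
qed

text \<open>A nonvanishing Laurent polynomial on the target is nonzero at some positive point, which has
  a positive preimage; hence its pullback does not vanish identically.\<close>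

lemma generically_pullback:
  assumes fin: "finite S" "finite T"
    and P: "generically T P"
    and rat: "\<And>w. w \<in> T \<Longrightarrow> rational_on preals S (\<lambda>z. \<phi> z w)"
    and torus: "pgenerically S (\<lambda>z. \<phi> z \<in> torus T)"
    and surj: "\<And>y. y \<in> ptorus T \<Longrightarrow> \<exists>z\<in>ptorus S. \<phi> z = y"
  shows "generically S (\<lambda>z. P (\<phi> z))"
proof -
  obtain h y where h: "laurent_on UNIV T h" "y \<in> torus T" "h y \<noteq> 0" "\<And>x. x \<in> torus T \<Longrightarrow> h x \<noteq> 0 \<Longrightarrow> P x"
    using P unfolding generically_iff by blast
  obtain w where w: "w \<in> ptorus T" "h w \<noteq> 0"
    using laurent_on_common_nonzero[OF h(1-3) h(1-3) fin(2)] by metis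
  obtain z where z: "z \<in> ptorus S" "\<phi> z = w" using surj[OF w(1)] by blast
  obtain A a where A: "finite A" "A \<noteq> {}" "\<forall>x\<in>torus T. h x = (\<Sum>\<eta>\<in>A. a \<eta> * character T \<eta> x)"
    using h(1) unfolding laurent_on_def by blast
  have ch: "rational_on UNIV S (\<lambda>z. character T \<eta> (\<phi> z))" for \<eta>
    unfolding character_def by (intro rational_on_UNIV[OF rational_on_prod] rational_on_powi rat)
  have "rational_on UNIV S (\<lambda>z. \<Sum>\<eta>\<in>A. a \<eta> * character T \<eta> (\<phi> z))"
    by (intro rational_on_sum rational_on_mult rational_on_const A semiring_set_UNIV ch) auto
  then obtain p q where pq: "laurent_on UNIV S p" "laurent_on preals S q"
      "pgenerically S (\<lambda>z. q z \<noteq> 0 \<and> (\<Sum>\<eta>\<in>A. a \<eta> * character T \<eta> (\<phi> z)) = p z / q z)"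
    unfolding rational_on_def by blast
  have "p z / q z = h w"
    using pgenerically_ptorus[OF pq(3) z(1)] A w z by (auto simp: ptorus_torus)
  then have "p z \<noteq> 0" using w by auto
  then have "generically S (\<lambda>z. p z \<noteq> 0)"
    unfolding generically_iff using pq(1) z(1) ptorus_torus by blast
  moreover have "generically S (\<lambda>z. (q z \<noteq> 0 \<and> (\<Sum>\<eta>\<in>A. a \<eta> * character T \<eta> (\<phi> z)) = p z / q z)
      \<and> \<phi> z \<in> torus T)"
    by (intro pgenerically_generically pgenerically_conj pq torus)
  ultimately show ?thesis
  proof (rule generically_mono[OF generically_conj[OF fin(1)]])
    fix z
    assume "p z \<noteq> 0 \<and> (q z \<noteq> 0 \<and> (\<Sum>\<eta>\<in>A. a \<eta> * character T \<eta> (\<phi> z)) = p z / q z) \<and> \<phi> z \<in> torus T"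
    then have "\<phi> z \<in> torus T" "h (\<phi> z) \<noteq> 0" using A by auto
    then show "P (\<phi> z)" by (rule h(4))
  qed
qed

text \<open>The growth exponent along cocharacters at real arguments. The limit is required to be
  positive, not merely nonzero: this excludes cancellation of leading terms in sums.\<close>

definition tropicalizes ::
  "'v set \<Rightarrow> (('v \<Rightarrow> complex) \<Rightarrow> complex) \<Rightarrow> (('v \<Rightarrow> int) \<Rightarrow> int) \<Rightarrow> bool" where
  "tropicalizes S f \<tau> \<longleftrightarrow> (\<forall>\<xi>. \<exists>L>0.
     ((\<lambda>t. f (cocharacter S \<xi> (of_real t)) / of_real t powi \<tau> \<xi>) \<longlongrightarrow> complex_of_real L) at_top)"

lemma powi_tendsto_0:
  assumes "i < 0"
  shows "((\<lambda>t::real. complex_of_real t powi i) \<longlongrightarrow> 0) at_top"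
proof -
  define m where "m = nat (- i)"
  have m: "m > 0" "i = - int m" using assms by (auto simp: m_def)
  have "((\<lambda>t::real. complex_of_real (inverse t ^ m)) \<longlongrightarrow> of_real (0 ^ m)) at_top"
    by (intro tendsto_of_real tendsto_power tendsto_inverse_0_at_top filterlim_ident)
  then show ?thesis using m
    by (simp add: power_int_minus power_inverse zero_power)
qed

lemma tropicalizes_coord: "tropicalizes S (\<lambda>x. x v) (\<lambda>\<xi>. if v \<in> S then \<xi> v else 0)"
  unfolding tropicalizes_def
proof (intro allI exI[of _ 1] conjI)
  fix \<xi> :: "'a \<Rightarrow> int"
  have "\<forall>\<^sub>F t in at_top. (1::complex) = cocharacter S \<xi> (of_real t) v / of_real t powi (if v \<in> S then \<xi> v else 0)"
    using eventually_gt_at_top[of "0::real"]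
    by eventually_elim (auto simp: cocharacter_def)
  from tendsto_cong[THEN iffD1, OF this tendsto_const]
  show "((\<lambda>t. cocharacter S \<xi> (of_real t) v / of_real t powi (if v \<in> S then \<xi> v else 0))
      \<longlongrightarrow> complex_of_real 1) at_top" by simp
qed simp

lemma tropicalizes_const: "c > 0 \<Longrightarrow> tropicalizes S (\<lambda>_. complex_of_real c) (\<lambda>_. 0)"
  unfolding tropicalizes_def by (auto intro!: exI[of _ c])

lemma tropicalizes_one: "tropicalizes S (\<lambda>_. 1) (\<lambda>_. 0)"
  using tropicalizes_const[of 1] by simp

lemma tropicalizes_mult:
  assumes "tropicalizes S f \<tau>" "tropicalizes S g \<sigma>"
  shows "tropicalizes S (\<lambda>x. f x * g x) (\<lambda>\<xi>. \<tau> \<xi> + \<sigma> \<xi>)"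
  unfolding tropicalizes_def
proof
  fix \<xi>
  let ?x = "\<lambda>t. cocharacter S \<xi> (complex_of_real t)"
  obtain L M where LM: "L > 0" "M > 0" "((\<lambda>t. f (?x t) / of_real t powi \<tau> \<xi>) \<longlongrightarrow> of_real L) at_top"
    "((\<lambda>t. g (?x t) / of_real t powi \<sigma> \<xi>) \<longlongrightarrow> of_real M) at_top"
    using assms unfolding tropicalizes_def by meson
  have "\<forall>\<^sub>F t in at_top. (f (?x t) / of_real t powi \<tau> \<xi>) * (g (?x t) / of_real t powi \<sigma> \<xi>) =
      f (?x t) * g (?x t) / of_real t powi (\<tau> \<xi> + \<sigma> \<xi>)"
    using eventually_gt_at_top[of "0::real"]
    by eventually_elim (simp add: power_int_add)
  from tendsto_cong[THEN iffD1, OF this tendsto_mult[OF LM(3,4)]] LM(1,2)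
  show "\<exists>N>0. ((\<lambda>t. f (?x t) * g (?x t) / of_real t powi (\<tau> \<xi> + \<sigma> \<xi>)) \<longlongrightarrow> complex_of_real N) at_top"
    by (intro exI[of _ "L * M"]) simp
qed

lemma tropicalizes_inverse:
  assumes "tropicalizes S f \<tau>"
  shows "tropicalizes S (\<lambda>x. inverse (f x)) (\<lambda>\<xi>. - \<tau> \<xi>)"
  unfolding tropicalizes_def
proof
  fix \<xi>
  let ?x = "\<lambda>t. cocharacter S \<xi> (complex_of_real t)"
  obtain L where L: "L > 0" "((\<lambda>t. f (?x t) / of_real t powi \<tau> \<xi>) \<longlongrightarrow> of_real L) at_top"
    using assms unfolding tropicalizes_def by meson
  have "(\<lambda>t. inverse (f (?x t) / of_real t powi \<tau> \<xi>)) = (\<lambda>t. inverse (f (?x t)) / of_real t powi (- \<tau> \<xi>))"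
    by (simp add: power_int_minus field_simps)
  with tendsto_inverse[OF L(2)] L(1)
  show "\<exists>N>0. ((\<lambda>t. inverse (f (?x t)) / of_real t powi (- \<tau> \<xi>)) \<longlongrightarrow> complex_of_real N) at_top"
    by (intro exI[of _ "inverse L"]) simp
qed

lemma tropicalizes_divide:
  assumes "tropicalizes S f \<tau>" "tropicalizes S g \<sigma>"
  shows "tropicalizes S (\<lambda>x. f x / g x) (\<lambda>\<xi>. \<tau> \<xi> - \<sigma> \<xi>)"
  using tropicalizes_mult[OF assms(1) tropicalizes_inverse[OF assms(2)]]
  by (simp add: divide_inverse)

lemma tropicalizes_add:
  assumes "tropicalizes S f \<tau>" "tropicalizes S g \<sigma>"
  shows "tropicalizes S (\<lambda>x. f x + g x) (\<lambda>\<xi>. max (\<tau> \<xi>) (\<sigma> \<xi>))"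
  unfolding tropicalizes_def
proof
  fix \<xi>
  let ?x = "\<lambda>t. cocharacter S \<xi> (complex_of_real t)" and ?m = "max (\<tau> \<xi>) (\<sigma> \<xi>)"
  obtain L M where LM: "L > 0" "M > 0" "((\<lambda>t. f (?x t) / of_real t powi \<tau> \<xi>) \<longlongrightarrow> of_real L) at_top"
    "((\<lambda>t. g (?x t) / of_real t powi \<sigma> \<xi>) \<longlongrightarrow> of_real M) at_top"
    using assms unfolding tropicalizes_def by meson
  \<comment> \<open>Rescaling with too large an exponent gives the limit 0. At the maximum of the
    two exponents at least one of the limits stays positive, and so does their sum.\<close>
  have shift: "((\<lambda>t. u t / of_real t powi m) \<longlongrightarrow> of_real (if i = m then N else 0)) at_top"
    if "((\<lambda>t. u t / of_real t powi i) \<longlongrightarrow> complex_of_real N) at_top" "i \<le> m" for u i m N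
  proof (cases "i = m")
    case False
    have "\<forall>\<^sub>F t in at_top. (u t / of_real t powi i) * complex_of_real t powi (i - m) = u t / of_real t powi m"
      using eventually_gt_at_top[of "0::real"]
      by eventually_elim (simp add: power_int_diff)
    moreover have "((\<lambda>t. (u t / of_real t powi i) * complex_of_real t powi (i - m)) \<longlongrightarrow> of_real N * 0) at_top"
      using that False by (intro tendsto_mult powi_tendsto_0) auto
    ultimately show ?thesis using False tendsto_cong by force
  qed (use that in simp)
  have "((\<lambda>t. f (?x t) / of_real t powi ?m + g (?x t) / of_real t powi ?m) \<longlongrightarrow>
      of_real (if \<tau> \<xi> = ?m then L else 0) + of_real (if \<sigma> \<xi> = ?m then M else 0)) at_top"
    by (intro tendsto_add shift LM) auto
  then show "\<exists>N>0. ((\<lambda>t. (f (?x t) + g (?x t)) / of_real t powi ?m) \<longlongrightarrow> complex_of_real N) at_top"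
    using LM(1,2) unfolding add_divide_distrib[symmetric] of_real_add[symmetric]
    by (intro exI[of _ "(if \<tau> \<xi> = ?m then L else 0) + (if \<sigma> \<xi> = ?m then M else 0)"])
       (auto simp: max_def)
qed

lemma tropicalizes_cong:
  assumes "tropicalizes S f \<tau>" "\<And>x. x \<in> ptorus S \<Longrightarrow> f x = g x"
  shows "tropicalizes S g \<tau>"
  unfolding tropicalizes_def
proof
  fix \<xi>
  let ?x = "\<lambda>t. cocharacter S \<xi> (complex_of_real t)"
  obtain L where L: "L > 0" "((\<lambda>t. f (?x t) / of_real t powi \<tau> \<xi>) \<longlongrightarrow> of_real L) at_top"
    using assms unfolding tropicalizes_def by meson
  have "\<forall>\<^sub>F t in at_top. f (?x t) / of_real t powi \<tau> \<xi> = g (?x t) / of_real t powi \<tau> \<xi>"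
    using eventually_gt_at_top[of "0::real"]
    by eventually_elim (simp add: assms(2) cocharacter_ptorus)
  from tendsto_cong[THEN iffD1, OF this L(2)] L(1)
  show "\<exists>N>0. ((\<lambda>t. g (?x t) / of_real t powi \<tau> \<xi>) \<longlongrightarrow> complex_of_real N) at_top" by blast
qed

lemma tropicalizes_prod:
  assumes "\<And>i. i \<in> I \<Longrightarrow> tropicalizes S (f i) (\<tau> i)"
  shows "tropicalizes S (\<lambda>x. \<Prod>i\<in>I. f i x) (\<lambda>\<xi>. \<Sum>i\<in>I. \<tau> i \<xi>)"
  using assms
  by (induction I rule: infinite_finite_induct) (auto intro: tropicalizes_mult tropicalizes_one)

lemma tropicalizes_sum:
  assumes "finite I" "I \<noteq> {}" "\<And>i. i \<in> I \<Longrightarrow> tropicalizes S (f i) (\<tau> i)"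
  shows "tropicalizes S (\<lambda>x. \<Sum>i\<in>I. f i x) (\<lambda>\<xi>. Max ((\<lambda>i. \<tau> i \<xi>) ` I))"
  using assms by (induction rule: finite_ne_induct) (auto intro: tropicalizes_add)

lemma tropicalizes_power:
  assumes "tropicalizes S f \<tau>"
  shows "tropicalizes S (\<lambda>x. f x ^ m) (\<lambda>\<xi>. int m * \<tau> \<xi>)"
  using tropicalizes_prod[OF assms, of "{..<m}"] by simp

lemma tropicalizes_powi:
  assumes "tropicalizes S f \<tau>"
  shows "tropicalizes S (\<lambda>x. f x powi i) (\<lambda>\<xi>. i * \<tau> \<xi>)"
proof (cases "i \<ge> 0")
  case True
  then show ?thesis using tropicalizes_power[OF assms, of "nat i"] by (simp add: power_int_def)
next
  case False
  then show ?thesis using tropicalizes_power[OF tropicalizes_inverse[OF assms], of "nat (- i)"]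
    by (simp add: power_int_def)
qed

text \<open>Here \<open>M\<close> is any nonzero complex number, since the leading coefficients of
  the polynomials behind \<open>has_rational_degree\<close> need not be positive. Two different
  exponents would force one of the limits to be 0.\<close>

lemma tropicalizes_unique:
  assumes "tropicalizes S f \<tau>"
    and "((\<lambda>t. f (cocharacter S \<xi> (of_real t)) / of_real t powi d) \<longlongrightarrow> M) at_top" "M \<noteq> 0"
  shows "d = \<tau> \<xi>"
proof -
  let ?x = "\<lambda>t. cocharacter S \<xi> (complex_of_real t)"
  obtain L where L: "L > 0" "((\<lambda>t. f (?x t) / of_real t powi \<tau> \<xi>) \<longlongrightarrow> of_real L) at_top"
    using assms unfolding tropicalizes_def by meson
  have *: False if "i < j" "A \<noteq> 0" "((\<lambda>t. u t / of_real t powi i) \<longlongrightarrow> A) at_top" 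
    "((\<lambda>t. u t / of_real t powi j) \<longlongrightarrow> B) at_top" "B \<noteq> 0" for u i j and A B :: complex
  proof -
    have "\<forall>\<^sub>F t in at_top. (u t / of_real t powi i) * complex_of_real t powi (i - j) = u t / of_real t powi j"
      using eventually_gt_at_top[of "0::real"]
      by eventually_elim (simp add: power_int_diff)
    moreover have "((\<lambda>t. (u t / of_real t powi i) * complex_of_real t powi (i - j)) \<longlongrightarrow> A * 0) at_top"
      using that by (intro tendsto_mult powi_tendsto_0) auto
    ultimately have "((\<lambda>t. u t / of_real t powi j) \<longlongrightarrow> 0) at_top"
      using tendsto_cong by force
    from tendsto_unique[OF _ this that(4)] that(5) show False by simp
  qed
  show ?thesis
    using *[OF _ _ L(2) assms(2,3)] *[OF _ assms(3,2) L(2)] L(1) by (cases d "\<tau> \<xi>" rule: linorder_cases) auto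
qed

section \<open>Rational degrees as growth exponents, and the evaluation of \<open>UD\<close>\<close>

lemma poly_leading_limit:
  fixes p :: "complex poly"
  shows "((\<lambda>t. poly p (of_real t) / of_real t ^ degree p) \<longlongrightarrow> lead_coeff p) at_top"
proof -
  have inv: "((\<lambda>t. complex_of_real (inverse t)) \<longlongrightarrow> of_real 0) at_top"
    by (intro tendsto_of_real tendsto_inverse_0_at_top filterlim_ident)
  have "\<forall>\<^sub>F t in at_top. poly (reflect_poly p) (complex_of_real (inverse t)) =
      poly p (of_real t) / of_real t ^ degree p"
    using eventually_gt_at_top[of "0::real"]
    by eventually_elim (simp add: poly_reflect_poly_nz field_simps)
  moreover have "((\<lambda>t. poly (reflect_poly p) (complex_of_real (inverse t))) \<longlongrightarrow>
      poly (reflect_poly p) (of_real 0)) at_top"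
    by (rule tendsto_poly[OF inv])
  ultimately show ?thesis
    using tendsto_cong by force
qed

lemma has_rational_degree_limit:
  assumes "has_rational_degree g d"
  shows "\<exists>M. M \<noteq> 0 \<and> ((\<lambda>t. g (of_real t) / of_real t powi d) \<longlongrightarrow> M) at_top"
proof -
  obtain p q where pq: "p \<noteq> 0" "q \<noteq> 0" "finite {c. g c \<noteq> poly p c / poly q c}"
    "d = int (degree p) - int (degree q)"
    using assms unfolding has_rational_degree_def by blast
  let ?F = "{c. g c \<noteq> poly p c / poly q c}"
  have "\<forall>\<^sub>F t in at_top. (poly p (of_real t) / of_real t ^ degree p) / (poly q (of_real t) / of_real t ^ degree q)
      = g (of_real t) / of_real t powi d"
    \<comment> \<open>Beyond the real parts of all points of the finite exceptional set,
      \<open>g\<close> is the quotient of the two polynomials; the 0 guarantees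
      \<open>t > 0\<close>.\<close>
    using eventually_gt_at_top[of "Max (insert 0 (Re ` ?F))"]
  proof eventually_elim
    case (elim t)
    then have "t > 0" "\<forall>c\<in>?F. t > Re c" using pq(3) by auto
    then have "of_real t \<notin> ?F" by (metis Re_complex_of_real less_irrefl)
    then show ?case using \<open>t > 0\<close> by (simp add: pq(4) power_int_diff)
  qed
  moreover have "((\<lambda>t. (poly p (of_real t) / of_real t ^ degree p) / (poly q (of_real t) / of_real t ^ degree q))
      \<longlongrightarrow> lead_coeff p / lead_coeff q) at_top"
    using pq by (intro tendsto_divide poly_leading_limit) auto
  ultimately show ?thesis using pq(1,2) tendsto_cong
    by (intro exI[of _ "lead_coeff p / lead_coeff q"]) force
qed

lemma laurent_on_has_rational_degree:
  assumes "laurent_on preals S p" "laurent_on preals S q" "finite S"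
  shows "\<exists>d. has_rational_degree (\<lambda>c. p (cocharacter S \<xi> c) / q (cocharacter S \<xi> c)) d"
proof -
  obtain P N where P: "\<And>t. t \<noteq> 0 \<Longrightarrow> p (cocharacter S \<xi> t) * t ^ N = poly P t"
    using laurent_on_cocharacter[OF laurent_on_UNIV[OF assms(1)] assms(3)] by blast
  obtain Q M where Q: "\<And>t. t \<noteq> 0 \<Longrightarrow> q (cocharacter S \<xi> t) * t ^ M = poly Q t"
    using laurent_on_cocharacter[OF laurent_on_UNIV[OF assms(2)] assms(3)] by blast
  have "p (cocharacter S \<xi> 1) \<in> preals" "q (cocharacter S \<xi> 1) \<in> preals"
    using laurent_on_ptorus[OF assms(1) cocharacter_ptorus[OF preals_one]]
      laurent_on_ptorus[OF assms(2) cocharacter_ptorus[OF preals_one]] by simp_all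
  then have "p (cocharacter S \<xi> 1) \<noteq> 0" "q (cocharacter S \<xi> 1) \<noteq> 0"
    by (blast dest: preals_nonzero)+
  then have "poly P 1 \<noteq> 0" "poly Q 1 \<noteq> 0"
    using P[of 1] Q[of 1] by simp_all
  then have "P \<noteq> 0" "Q \<noteq> 0" by (metis poly_0)+
  then have nz: "P * monom 1 M \<noteq> 0" "Q * monom 1 N \<noteq> 0" by simp_all
  have "p (cocharacter S \<xi> c) / q (cocharacter S \<xi> c) = poly (P * monom 1 M) c / poly (Q * monom 1 N) c"
    if "c \<noteq> 0" for c
    using that by (simp add: poly_monom flip: P Q)
  then have "{c. p (cocharacter S \<xi> c) / q (cocharacter S \<xi> c)
      \<noteq> poly (P * monom 1 M) c / poly (Q * monom 1 N) c} \<subseteq> {0}"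
    by blast
  then have "finite {c. p (cocharacter S \<xi> c) / q (cocharacter S \<xi> c)
      \<noteq> poly (P * monom 1 M) c / poly (Q * monom 1 N) c}"
    by (rule finite_subset) simp
  then show ?thesis unfolding has_rational_degree_def using nz by blast
qed

text \<open>\<open>f\<close> is the given total function, \<open>F\<close> a subtraction-free
  representative of the same rational map. The definite description is resolved by showing that
  every positive presentation of a character of \<open>f\<close> has the degree predicted by
  \<open>\<tau>\<close>.\<close>

lemma UD_eqI:
  assumes fin: "finite S" "finite T"
    and gen: "generically S (\<lambda>x. \<forall>w\<in>T. f x w = F x w)"
    and rat: "\<And>w. w \<in> T \<Longrightarrow> rational_on preals S (\<lambda>x. F x w)"
    and trop: "\<And>w. w \<in> T \<Longrightarrow> tropicalizes S (\<lambda>x. F x w) (\<tau> w)"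
  shows "UD S T f \<xi> = (\<lambda>w. if w \<in> T then \<tau> w \<xi> else 0)"
proof -
  define d where "d \<eta> = (\<Sum>w\<in>T. \<eta> w * \<tau> w \<xi>)" for \<eta>
  have ratc: "rational_on preals S (\<lambda>x. character T \<eta> (F x))" for \<eta>
    unfolding character_def by (intro rational_on_prod rational_on_powi rat)
  have tropc: "tropicalizes S (\<lambda>x. character T \<eta> (F x)) (\<lambda>\<xi>. \<Sum>w\<in>T. \<eta> w * \<tau> w \<xi>)" for \<eta>
    unfolding character_def by (intro tropicalizes_prod tropicalizes_powi trop)
  have genc: "generically S (\<lambda>x. character T \<eta> (f x) = character T \<eta> (F x))" for \<eta>
    by (rule generically_mono[OF gen]) (simp add: character_def)
  have uniq: "e = d \<eta>" if pq: "positive_quotient S (\<lambda>x. character T \<eta> (f x)) p q"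
      "has_rational_degree (\<lambda>c. p (cocharacter S \<xi> c) / q (cocharacter S \<xi> c)) e" for p q e \<eta>
  proof -
    have lpq: "laurent_on preals S p" "laurent_on preals S q"
      "generically S (\<lambda>x. character T \<eta> (f x) = p x / q x)"
      using pq(1) unfolding positive_quotient_def laurent_on_iff_positive_laurent_poly by auto
    obtain p0 q0 where pq0: "laurent_on preals S p0" "laurent_on preals S q0"
      "pgenerically S (\<lambda>x. q0 x \<noteq> 0 \<and> character T \<eta> (F x) = p0 x / q0 x)"
      using ratc[of \<eta>] unfolding rational_on_def by blast
    \<comment> \<open>Cross-multiplied, the generic equality of two presentations becomes an
      equality of Laurent polynomials and so holds on the whole torus. At positive points the
      denominators can be divided out again.\<close>
    have zero: "p x * q0 x - p0 x * q x = 0" if "x \<in> torus S" for x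
    proof (rule laurent_on_generically_zero[OF fin(1) _ _ that])
      show "laurent_on UNIV S (\<lambda>x. p x * q0 x - p0 x * q x)"
        by (intro laurent_on_diff laurent_on_mult semiring_set_UNIV laurent_on_UNIV[OF lpq(1)]
            laurent_on_UNIV[OF lpq(2)] laurent_on_UNIV[OF pq0(1)] laurent_on_UNIV[OF pq0(2)])
      have "generically S (\<lambda>x. (character T \<eta> (f x) = p x / q x \<and> character T \<eta> (f x) = character T \<eta> (F x)) \<and>
          q x \<noteq> 0 \<and> (q0 x \<noteq> 0 \<and> character T \<eta> (F x) = p0 x / q0 x))"
        by (intro generically_conj fin lpq genc pgenerically_generically[OF pq0(3)]
            pgenerically_generically[OF laurent_on_pgenerically_nonzero[OF lpq(2)]])
      then show "generically S (\<lambda>x. p x * q0 x - p0 x * q x = 0)"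
        by (rule generically_mono) (metis (no_types, opaque_lifting) eq_iff_diff_eq_0 frac_eq_eq)
    qed
    have trop_pq: "tropicalizes S (\<lambda>x. p x / q x) (\<lambda>\<xi>. \<Sum>w\<in>T. \<eta> w * \<tau> w \<xi>)"
    proof (rule tropicalizes_cong[OF tropc])
      fix x assume x: "x \<in> ptorus S"
      have "q x \<noteq> 0" "q0 x \<noteq> 0" "character T \<eta> (F x) = p0 x / q0 x"
        using laurent_on_ptorus[OF lpq(2) x] pgenerically_ptorus[OF pq0(3) x]
        by (auto dest: preals_nonzero)
      then show "character T \<eta> (F x) = p x / q x"
        using zero[OF ptorus_torus[OF x]] by (simp add: frac_eq_eq)
    qed
    obtain M where M: "M \<noteq> 0"
      "((\<lambda>t. p (cocharacter S \<xi> (of_real t)) / q (cocharacter S \<xi> (of_real t)) / of_real t powi e) \<longlongrightarrow> M) at_top"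
      using has_rational_degree_limit[OF pq(2)] by blast
    show ?thesis unfolding d_def by (rule tropicalizes_unique[OF trop_pq M(2,1)])
  qed
  have ex: "\<exists>p q. positive_quotient S (\<lambda>x. character T \<eta> (f x)) p q \<and>
        has_rational_degree (\<lambda>c. p (cocharacter S \<xi> c) / q (cocharacter S \<xi> c)) (d \<eta>)" for \<eta>
  proof -
    obtain p0 q0 where pq0: "laurent_on preals S p0" "laurent_on preals S q0"
      "pgenerically S (\<lambda>x. q0 x \<noteq> 0 \<and> character T \<eta> (F x) = p0 x / q0 x)"
      using ratc[of \<eta>] unfolding rational_on_def by blast
    obtain p where p: "positive_laurent_poly S p" "\<forall>x\<in>torus S. p0 x = p x"
      using pq0(1) unfolding laurent_on_iff_positive_laurent_poly by blast
    obtain q where q: "positive_laurent_poly S q" "\<forall>x\<in>torus S. q0 x = q x"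
      using pq0(2) unfolding laurent_on_iff_positive_laurent_poly by blast
    have "generically S (\<lambda>x. character T \<eta> (f x) = p x / q x)"
      by (rule generically_mono[OF generically_conj[OF fin(1) genc[of \<eta>] pgenerically_generically[OF pq0(3)]]])
         (use p q in auto)
    then have quot: "positive_quotient S (\<lambda>x. character T \<eta> (f x)) p q"
      using p q by (simp add: positive_quotient_def)
    have "laurent_on preals S p" "laurent_on preals S q"
      using p q unfolding laurent_on_iff_positive_laurent_poly by auto
    from laurent_on_has_rational_degree[OF this fin(1)] obtain e where
      e: "has_rational_degree (\<lambda>c. p (cocharacter S \<xi> c) / q (cocharacter S \<xi> c)) e" by blast
    show ?thesis using quot e uniq[OF quot e] by blast
  qed
  show ?thesis
    unfolding UD_def
  proof (rule the_equality)
    let ?\<zeta> = "\<lambda>w. if w \<in> T then \<tau> w \<xi> else 0"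
    have "pairing T \<eta> ?\<zeta> = d \<eta>" for \<eta>
      unfolding pairing_def d_def by (intro sum.cong) auto
    then show "?\<zeta> \<in> cochars T \<and> (\<forall>\<eta>. \<exists>p q. positive_quotient S (\<lambda>x. character T \<eta> (f x)) p q \<and>
        has_rational_degree (\<lambda>c. p (cocharacter S \<xi> c) / q (cocharacter S \<xi> c)) (pairing T \<eta> ?\<zeta>))"
      using ex by (simp add: cochars_def)
  next
    fix \<zeta> assume \<zeta>: "\<zeta> \<in> cochars T \<and> (\<forall>\<eta>. \<exists>p q. positive_quotient S (\<lambda>x. character T \<eta> (f x)) p q \<and>
        has_rational_degree (\<lambda>c. p (cocharacter S \<xi> c) / q (cocharacter S \<xi> c)) (pairing T \<eta> \<zeta>))"
    show "\<zeta> = (\<lambda>w. if w \<in> T then \<tau> w \<xi> else 0)"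
    proof
      fix w
      show "\<zeta> w = (if w \<in> T then \<tau> w \<xi> else 0)"
      proof (cases "w \<in> T")
        case True
        \<comment> \<open>Pairing with the coordinate characters recovers the cocharacter.\<close>
        let ?\<eta> = "\<lambda>v. if v = w then 1 else 0 :: int"
        have "pairing T ?\<eta> \<zeta> = d ?\<eta>" using \<zeta> uniq by blast
        moreover have "pairing T ?\<eta> \<zeta> = \<zeta> w"
          unfolding pairing_def using True fin(2)
          by (simp add: if_distrib[of "\<lambda>c. c * _"] sum.delta cong: if_cong)
        moreover have "d ?\<eta> = \<tau> w \<xi>"
          unfolding d_def using True fin(2)
          by (simp add: if_distrib[of "\<lambda>c. c * _"] sum.delta cong: if_cong)
        ultimately show ?thesis using True by simp
      qed (use \<zeta> in \<open>auto simp: cochars_def\<close>)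
    qed
  qed
qed

lemma UD_fun_eqI:
  assumes "finite S" "rational_on preals S f" "tropicalizes S f \<tau>"
  shows "UD_fun S f \<xi> = \<tau> \<xi>"
  unfolding UD_fun_def
  by (subst UD_eqI[where F = "\<lambda>x _. f x" and \<tau> = "\<lambda>_. \<tau>"])
     (use assms in \<open>auto intro: pgenerically_generically pgenerically_all\<close>)

lemma UD_action_eqI:
  assumes "finite S"
    and "generically (insert None (Some ` S)) (\<lambda>z. \<forall>w\<in>S. e (z None) (\<lambda>v. z (Some v)) w = F z w)"
    and "\<And>w. w \<in> S \<Longrightarrow> rational_on preals (insert None (Some ` S)) (\<lambda>z. F z w)"
    and "\<And>w. w \<in> S \<Longrightarrow> tropicalizes (insert None (Some ` S)) (\<lambda>z. F z w) (\<tau> w)"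
  shows "UD_action S e d x = (\<lambda>w. if w \<in> S then \<tau> w (case_option d x) else 0)"
  unfolding UD_action_def by (rule UD_eqI) (use assms in auto)

section \<open>The birational map \<open>\<Sigma>\<close>\<close>

lemma finite_S1 [simp]: "finite (S1 n k)"
  by (rule finite_subset[of _ "{..n + k} \<times> {..n + k}"]) (auto simp: S1_def)

lemma finite_S2 [simp]: "finite (S2 n k)"
  by (rule finite_subset[of _ "{..n + k} \<times> {..n + k}"]) (auto simp: S2_def)

section \<open>Path sums: recursion, boundary values and tropical form\<close>

lemma paths_not_S1: "p \<notin> S1 n k \<Longrightarrow> paths n k p = {}"
  using hd_in_set by (fastforce simp: paths_def)

lemma paths_end: "(1, n) \<in> S1 n k \<Longrightarrow> paths n k (1, n) = {[(1, n)]}"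
proof (intro equalityI subsetI)
  fix P assume S: "(1, n) \<in> S1 n k" and P: "P \<in> paths n k (1, n)"
  then obtain Q where Q: "P = (1, n) # Q" by (cases P) (auto simp: paths_def)
  have "Q = []"
  proof (cases Q)
    case (Cons q R)
    then have "is_step (1, n) q" "q \<in> S1 n k" using P Q by (auto simp: paths_def)
    then show ?thesis by (cases q) (auto simp: is_step_def S1_def)
  qed simp
  then show "P \<in> {[(1, n)]}" using Q by simp
qed (auto simp: paths_def)

lemma paths_step:
  assumes "(l, m) \<in> S1 n k" "(l, m) \<noteq> (1, n)"
  shows "paths n k (l, m) = Cons (l, m) ` (paths n k (l, m + 1) \<union> paths n k (l - 1, m + 1))"
proof (intro equalityI subsetI)
  fix P assume P: "P \<in> paths n k (l, m)"
  then obtain Q where Q: "P = (l, m) # Q" by (cases P) (auto simp: paths_def)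
  with P assms(2) obtain q R where R: "Q = q # R" by (cases Q) (auto simp: paths_def)
  have "is_step (l, m) q" "q \<in> S1 n k" using P Q R by (auto simp: paths_def)
  then have "q = (l, m + 1) \<or> q = (l - 1, m + 1)" by (cases q) (auto simp: is_step_def)
  then have "Q \<in> paths n k (l, m + 1) \<union> paths n k (l - 1, m + 1)"
    using P Q R by (auto simp: paths_def)
  then show "P \<in> Cons (l, m) ` (paths n k (l, m + 1) \<union> paths n k (l - 1, m + 1))"
    using Q by blast
next
  fix P assume "P \<in> Cons (l, m) ` (paths n k (l, m + 1) \<union> paths n k (l - 1, m + 1))"
  then obtain Q where Q: "P = (l, m) # Q" "Q \<in> paths n k (l, m + 1) \<or> Q \<in> paths n k (l - 1, m + 1)"
    by blast
  then obtain q R where R: "Q = q # R" by (cases Q) (auto simp: paths_def)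
  have "is_step (l, m) q"
    using Q(2) R assms(1) by (auto simp: paths_def is_step_def S1_def)
  then show "P \<in> paths n k (l, m)"
    using Q R assms by (auto simp: paths_def)
qed

lemma finite_paths: "finite (paths n k (l, m))"
proof (induction "n + 1 - m" arbitrary: l m rule: less_induct)
  case less
  show ?case
  proof (cases "(l, m) \<in> S1 n k \<and> (l, m) \<noteq> (1, n)")
    case True
    then have "m \<le> n" by (auto simp: S1_def)
    then show ?thesis using True by (simp add: paths_step less)
  next
    case False
    then show ?thesis by (cases "(l, m) \<in> S1 n k") (use paths_end[of n k] in \<open>auto simp: paths_not_S1\<close>)
  qed
qed

lemma path_weight_Cons:
  assumes "P \<in> paths n k q"
  shows "path_weight x (p # P) = step_weight x p q * path_weight x P"
proof -
  obtain Q where P: "P = q # Q" using assms by (cases P) (auto simp: paths_def)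
  show ?thesis unfolding path_weight_def P
    by (simp add: prod.lessThan_Suc_shift del: prod.lessThan_Suc)
qed

lemma sum_paths_step:
  assumes "(l, m) \<in> S1 n k" "(l, m) \<noteq> (1, n)"
  shows "(\<Sum>P\<in>paths n k (l, m). path_weight x P) =
    x (l, m) / x (l, m + 1) * (\<Sum>P\<in>paths n k (l, m + 1). path_weight x P) +
    (\<Sum>P\<in>paths n k (l - 1, m + 1). path_weight x P)"
proof -
  have "l \<ge> 1" using assms by (auto simp: S1_def)
  have "(\<Sum>P\<in>paths n k (l, m). path_weight x P) =
      (\<Sum>P\<in>paths n k (l, m + 1) \<union> paths n k (l - 1, m + 1). path_weight x ((l, m) # P))"
    unfolding paths_step[OF assms] by (subst sum.reindex) (auto simp: inj_on_def)
  also have "\<dots> = (\<Sum>P\<in>paths n k (l, m + 1). path_weight x ((l, m) # P)) +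
      (\<Sum>P\<in>paths n k (l - 1, m + 1). path_weight x ((l, m) # P))"
    using \<open>l \<ge> 1\<close> by (intro sum.union_disjoint finite_paths) (auto simp: paths_def)
  also have "(\<Sum>P\<in>paths n k (l, m + 1). path_weight x ((l, m) # P)) =
      x (l, m) / x (l, m + 1) * (\<Sum>P\<in>paths n k (l, m + 1). path_weight x P)"
    unfolding sum_distrib_left
    by (intro sum.cong refl) (subst path_weight_Cons, assumption, simp add: step_weight_def)
  also have "(\<Sum>P\<in>paths n k (l - 1, m + 1). path_weight x ((l, m) # P)) =
      (\<Sum>P\<in>paths n k (l - 1, m + 1). path_weight x P)"
  proof (intro sum.cong refl)
    fix P assume "P \<in> paths n k (l - 1, m + 1)"
    moreover have "l - 1 \<noteq> l" using \<open>l \<ge> 1\<close> by simp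
    ultimately show "path_weight x ((l, m) # P) = path_weight x P"
      by (simp add: path_weight_Cons step_weight_def)
  qed
  finally show ?thesis .
qed

lemma X_sum_top: "X_sum n k x (k + 1) m = 1"
  by (simp add: X_sum_def)

lemma X_sum_bottom: "l \<le> k \<Longrightarrow> l + m = k \<Longrightarrow> X_sum n k x l m = 1 / x (1, n)"
  by (simp add: X_sum_def)

lemma X_sum_S1: "(l, m) \<in> S1 n k \<Longrightarrow> X_sum n k x l m = (\<Sum>P\<in>paths n k (l, m). path_weight x P)"
  by (auto simp: X_sum_def S1_def)

text \<open>A step that keeps \<open>l\<close> would leave \<open>S1\<close> here, so the only path
  lowers \<open>l\<close> each time, and such steps have weight 1.\<close>

lemma X_sum_diag:
  assumes "(l, m) \<in> S1 n k" "l + m = n + 1"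
  shows "X_sum n k x l m = 1"
  using assms
proof (induction l arbitrary: m)
  case 0
  then show ?case by (simp add: S1_def)
next
  case (Suc l)
  show ?case
  proof (cases "l = 0")
    case True
    then show ?thesis using Suc.prems paths_end[of n k] by (simp add: X_sum_S1 path_weight_def)
  next
    case False
    then have "(l, m + 1) \<in> S1 n k" "(Suc l, m + 1) \<notin> S1 n k"
      using Suc.prems by (auto simp: S1_def)
    then show ?thesis using Suc.IH[of "m + 1"] Suc.prems False
      by (simp add: X_sum_S1 sum_paths_step[of "Suc l"] paths_not_S1)
  qed
qed

lemma X_sum_rec:
  assumes "(l, m) \<in> S1 n k" "l + m \<le> n"
  shows "X_sum n k x l m = x (l, m) / x (l, m + 1) * X_sum n k x l (m + 1) +
    (if 2 \<le> l then X_sum n k x (l - 1) (m + 1) else 0)"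
proof -
  have "(l, m + 1) \<in> S1 n k" using assms by (auto simp: S1_def)
  moreover have "(l - 1, m + 1) \<in> S1 n k \<longleftrightarrow> 2 \<le> l" using assms by (auto simp: S1_def)
  moreover have "(l, m) \<noteq> (1, n)" using assms by auto
  ultimately show ?thesis
    using sum_paths_step[OF assms(1), of x] assms(1)
    by (cases "2 \<le> l") (simp_all add: X_sum_S1 paths_not_S1)
qed

text \<open>In the row \<open>l = 1\<close> the only path keeps \<open>l\<close>, and its weights
  telescope.\<close>

lemma X_sum_one:
  assumes "(1, m) \<in> S1 n k" "x \<in> torus (S1 n k)"
  shows "X_sum n k x 1 m = x (1, m) / x (1, n)"
  using assms(1)
proof (induction "n - m" arbitrary: m)
  case 0
  then have "m = n" by (auto simp: S1_def)
  then show ?case using 0 assms(2) by (simp add: X_sum_diag torus_nonzero)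
next
  case (Suc d)
  then have "(1, m + 1) \<in> S1 n k" "d = n - (m + 1)" "1 + m \<le> n" by (auto simp: S1_def)
  then show ?case using Suc.hyps(1)[of "m + 1"] X_sum_rec[OF Suc.prems, of x] assms(2)
    by (simp add: torus_nonzero)
qed

text \<open>The maximal weight of a path, in recursive form. The row \<open>l = 1\<close> is a
  separate case because max on the integers has no neutral element; the value 0 for
  \<open>n < l + m\<close> matches \<open>X_sum_diag\<close>.\<close>

function X_trop :: "nat \<Rightarrow> (nat \<times> nat \<Rightarrow> int) \<Rightarrow> nat \<Rightarrow> nat \<Rightarrow> int" where
  "X_trop n x l m =
     (if n < l + m then 0
      else if 2 \<le> l then
        max (x (l, m) - x (l, m + 1) + X_trop n x l (m + 1)) (X_trop n x (l - 1) (m + 1))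
      else x (l, m) - x (l, m + 1) + X_trop n x l (m + 1))"
  by pat_completeness auto
termination by (relation "measure (\<lambda>(n, x, l, m). n + 1 - m)") auto

declare X_trop.simps [simp del]

text \<open>Stated for a family \<open>u\<close> so that it applies both on the torus of
  \<open>x\<close> and on the torus with the additional coordinate \<open>c\<close>.\<close>

lemma X_sum_rational_tropical:
  assumes "\<And>v. rational_on preals S (\<lambda>z. u z v)" "\<And>v. tropicalizes S (\<lambda>z. u z v) (\<lambda>\<xi>. t \<xi> v)"
    and "(l, m) \<in> S1 n k"
  shows "rational_on preals S (\<lambda>z. X_sum n k (u z) l m) \<and>
    tropicalizes S (\<lambda>z. X_sum n k (u z) l m) (\<lambda>\<xi>. X_trop n (t \<xi>) l m)"
  using assms(3)
proof (induction "n + 1 - m" arbitrary: l m rule: less_induct)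
  case less
  show ?case
  proof (cases "l + m \<le> n")
    case False
    then have "l + m = n + 1" using less.prems by (auto simp: S1_def)
    then show ?thesis using less.prems
      by (simp add: X_sum_diag X_trop.simps[of n _ l m] rational_on_const semiring_set_preals tropicalizes_one)
  next
    case True
    have 1: "rational_on preals S (\<lambda>z. X_sum n k (u z) l (m + 1))"
      "tropicalizes S (\<lambda>z. X_sum n k (u z) l (m + 1)) (\<lambda>\<xi>. X_trop n (t \<xi>) l (m + 1))"
      using less.hyps[of "m + 1" l] less.prems True by (auto simp: S1_def)
    note 1 = 1 rational_on_mult[OF semiring_set_preals rational_on_divide[OF assms(1,1)] 1(1)]
      tropicalizes_mult[OF tropicalizes_divide[OF assms(2,2)] 1(2)]
    show ?thesis
    proof (cases "2 \<le> l")
      case l: True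
      have 2: "rational_on preals S (\<lambda>z. X_sum n k (u z) (l - 1) (m + 1))"
        "tropicalizes S (\<lambda>z. X_sum n k (u z) (l - 1) (m + 1)) (\<lambda>\<xi>. X_trop n (t \<xi>) (l - 1) (m + 1))"
      proof -
        have "(l - 1, m + 1) \<in> S1 n k" "n + 1 - (m + 1) < n + 1 - m"
          using less.prems True l by (auto simp: S1_def)
        then show "rational_on preals S (\<lambda>z. X_sum n k (u z) (l - 1) (m + 1))"
          "tropicalizes S (\<lambda>z. X_sum n k (u z) (l - 1) (m + 1)) (\<lambda>\<xi>. X_trop n (t \<xi>) (l - 1) (m + 1))"
          using less.hyps by blast+
      qed
      show ?thesis
        using True l rational_on_add[OF semiring_set_preals order_refl 1(3) 2(1)]
          tropicalizes_add[OF 1(4) 2(2)]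
        by (simp add: X_sum_rec[OF less.prems True] X_trop.simps[of n _ l m])
    next
      case False
      then show ?thesis using True 1(3,4)
        by (simp add: X_sum_rec[OF less.prems True] X_trop.simps[of n _ l m])
    qed
  qed
qed

text \<open>With \<open>V = x / X\<close> the equation \<open>y = \<Sigma>(x)\<close> becomes linear with positive coefficients.\<close>

primrec V_sum :: "nat \<Rightarrow> (nat \<times> nat \<Rightarrow> complex) \<Rightarrow> nat \<Rightarrow> nat \<Rightarrow> complex" where
  "V_sum k y 0 l = 1"
| "V_sum k y (Suc m) l =
     (if k < l then 1
      else if l + m \<le> k then y (l - 1, m + 1) / y (k, 0)
      else V_sum k y m l + (if 2 \<le> l then y (l - 1, m + 1) / y (l, m) * V_sum k y m (l + 1) else 0))"

text \<open>Solving y(l, m) = V(l + 1, m) X(l, m) for X and inserting the result into x = V X gives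
  this expression. On the diagonal \<open>l + m = n + 1\<close>, where X = 1, only V
  remains.\<close>

definition Sigma_inverse :: "nat \<Rightarrow> nat \<Rightarrow> (nat \<times> nat \<Rightarrow> complex) \<Rightarrow> nat \<times> nat \<Rightarrow> complex" where
  "Sigma_inverse n k y = (\<lambda>(l, m). if (l, m) \<in> S1 n k
     then if l + m \<le> n then V_sum k y m l * y (l, m) / V_sum k y m (l + 1) else V_sum k y m l
     else 1)"

section \<open>Rationality of the inverse of \<open>Sigma_map\<close>, and the two inverse
  identities\<close>

lemma V_sum_top: "V_sum k y m (k + 1) = 1"
  by (cases m) auto

lemma V_sum_rational:
  "rational_on preals (S2 n k) (\<lambda>y. V_sum k y m l)"
proof (induction m arbitrary: l)
  case 0
  then show ?case by (simp add: rational_on_const semiring_set_preals)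
next
  case (Suc m)
  note r = rational_on_coord[OF finite_S2]
  consider "k < l" | "l \<le> k" "l + m \<le> k" | "l \<le> k" "k < l + m" "2 \<le> l" | "l \<le> k" "k < l + m" "l < 2"
    by linarith
  then show ?case
  proof cases
    case 3
    then show ?thesis
      using rational_on_add[OF semiring_set_preals order_refl Suc[of l]
        rational_on_mult[OF semiring_set_preals rational_on_divide[OF r r] Suc[of "l + 1"]]]
      by simp
  qed (use Suc in \<open>simp_all add: rational_on_const semiring_set_preals rational_on_divide[OF r r]\<close>)
qed

lemma Sigma_inverse_rational:
  "rational_on preals (S2 n k) (\<lambda>y. Sigma_inverse n k y v)"
proof (cases v)
  case (Pair l m)
  note r = rational_on_coord[OF finite_S2] V_sum_rational[of n k]
  consider "(l, m) \<notin> S1 n k" | "(l, m) \<in> S1 n k" "l + m \<le> n" | "(l, m) \<in> S1 n k" "n < l + m"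
    by linarith
  then show ?thesis
  proof cases
    case 2
    then show ?thesis unfolding Pair Sigma_inverse_def
      using rational_on_divide[OF rational_on_mult[OF semiring_set_preals r(2,1)] r(2)] by simp
  qed (use r(2) in \<open>simp_all add: Pair Sigma_inverse_def rational_on_const semiring_set_preals\<close>)
qed

lemma X_sum_nonzero_pgenerically:
  "pgenerically (S1 n k) (\<lambda>x. \<forall>(l, m)\<in>S1 n k. X_sum n k x l m \<noteq> 0)"
proof -
  have "rational_on preals (S1 n k) (\<lambda>x. X_sum n k x l m)" if "(l, m) \<in> S1 n k" for l m
    using X_sum_rational_tropical[where u = "\<lambda>z. z", OF rational_on_coord[OF finite_S1] tropicalizes_coord that]
    by blast
  then show ?thesis
    by (intro pgenerically_finite_Ball) (auto intro: rational_on_pgenerically_nonzero)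
qed

text \<open>For l \<ge> 2, multiplying the recursion of X by V(l, m + 1) gives X(l, m) V(l, m + 1) =
  x(l, m) + y(l - 1, m + 1). Dividing by X(l, m) = y(l, m) / V(l + 1, m) yields the recursion of
  \<open>V_sum\<close>, which therefore reproduces x / X.\<close>

lemma Sigma_inverse_Sigma:
  assumes x: "x \<in> torus (S1 n k)" and X: "\<forall>(l, m)\<in>S1 n k. X_sum n k x l m \<noteq> 0"
    and nk: "1 \<le> k" "k \<le> n"
  shows "Sigma_inverse n k (Sigma_map n k x) = x"
proof -
  let ?X = "X_sum n k x"
  define y where "y = Sigma_map n k x"
  have y: "y (l, m) = x (l + 1, m) * ?X l m / ?X (l + 1) m" if "(l, m) \<in> S2 n k" for l m
    using that by (simp add: y_def Sigma_map_def)
  have y0: "y v = 1" if "v \<notin> S2 n k" for v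
    using that by (cases v) (simp add: y_def Sigma_map_def)
  have xtop: "x (k + 1, m) = 1" for m
    using x by (auto simp: torus_def S1_def)
  note nz = torus_nonzero[OF x]
  have Xnz: "?X l m \<noteq> 0" if "(l, m) \<in> S1 n k" for l m using X that by blast
  have yk: "y (k, 0) = 1 / x (1, n)"
    using nk xtop[of 0] y[of k 0] X_sum_top[of n k x 0] X_sum_bottom[of k k 0 n x] by (simp add: S2_def)
  have V: "V_sum k y m l = x (l, m) / ?X l m" if "(l, m) \<in> S1 n k \<or> l = k + 1" for l m
    using that
  proof (induction m arbitrary: l)
    case 0
    then show ?case using xtop[of 0] X_sum_top[of n k x 0] by (auto simp: S1_def)
  next
    case (Suc m)
    show ?case
    proof (cases "l = k + 1")
      case True
      then show ?thesis using xtop X_sum_top[of n k x] by simp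
    next
      case False
      then have S: "(l, Suc m) \<in> S1 n k" using Suc.prems by simp
      show ?thesis
      proof (cases "l + m \<le> k")
        case True
        then have lm: "l + m = k" "l \<ge> 1" "l \<le> k" using S by (auto simp: S1_def)
        have Vlm: "V_sum k y (Suc m) l = y (l - 1, m + 1) / y (k, 0)" using lm by simp
        show ?thesis
        proof (cases "l = 1")
          case True
          \<comment> \<open>The index \<open>(0, m + 1)\<close> lies outside \<open>S2\<close>. The
            default value 1 there produces \<open>V = 1 / y (k, 0) = x (1, n)\<close>, the constant
            value of x / X in row 1.\<close>
          then have "y (l - 1, m + 1) = 1" by (intro y0) (simp add: S2_def)
          then show ?thesis
            unfolding Vlm using True S X_sum_one[of "Suc m" n k x] x nz by (simp add: yk)
        next
          case False
          then have "(l - 1, m + 1) \<in> S2 n k" "l - 1 + 1 = l" "l - 1 \<le> k" "l - 1 + (m + 1) = k"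
            using lm nk by (auto simp: S2_def)
          then have "y (l - 1, m + 1) = x (l, m + 1) * (1 / x (1, n)) / ?X l (m + 1)"
            using y[of "l - 1" "m + 1"] X_sum_bottom[of "l - 1" k "m + 1" n x] by metis
          then show ?thesis unfolding Vlm using nz by (simp add: yk)
        qed
      next
        case False
        then have lm: "(l, m) \<in> S1 n k" "l + m \<le> n" "(l, m) \<in> S2 n k" "1 \<le> l" "l \<le> k" "k < l + m"
          "(l + 1, m) \<in> S1 n k \<or> l + 1 = k + 1"
          using S by (auto simp: S1_def S2_def)
        have V1: "V_sum k y m l = x (l, m) / ?X l m" "V_sum k y m (l + 1) = x (l + 1, m) / ?X (l + 1) m"
          using Suc.IH lm by blast+
        have nz1: "?X l m \<noteq> 0" "?X (l + 1) m \<noteq> 0" "?X l (m + 1) \<noteq> 0"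
          using Xnz lm S X_sum_top[of n k x m] by (auto simp: Xnz)
        have rec: "V_sum k y (Suc m) l = V_sum k y m l +
            (if 2 \<le> l then y (l - 1, m + 1) / y (l, m) * V_sum k y m (l + 1) else 0)"
          using lm by simp
        show ?thesis
        proof (cases "2 \<le> l")
          case True
          then have "(l - 1, m + 1) \<in> S2 n k" "l - 1 + 1 = l" using lm by (auto simp: S2_def)
          then have y1: "y (l - 1, m + 1) = x (l, m + 1) * ?X (l - 1) (m + 1) / ?X l (m + 1)"
            using y[of "l - 1" "m + 1"] by metis
          have "x (l, m) * ?X l (m + 1) + x (l, m + 1) * ?X (l - 1) (m + 1) = x (l, m + 1) * ?X l m"
            using True X_sum_rec[OF lm(1,2), of x] nz by (simp add: field_simps)
          moreover have "V_sum k y (Suc m) l =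
              (x (l, m) * ?X l (m + 1) + x (l, m + 1) * ?X (l - 1) (m + 1)) / (?X l m * ?X l (m + 1))"
            unfolding rec V1 y1 y[OF lm(3)] using True nz1 nz by (simp add: field_simps)
          ultimately show ?thesis using nz1 by simp
        next
          case False
          then show ?thesis
            unfolding rec V1 using X_sum_rec[OF lm(1,2), of x] nz1 nz by (simp add: field_simps)
        qed
      qed
    qed
  qed
  show ?thesis
  proof
    fix v :: "nat \<times> nat"
    obtain l m where v: "v = (l, m)" by (cases v)
    show "Sigma_inverse n k (Sigma_map n k x) v = x v"
    proof (cases "(l, m) \<in> S1 n k")
      case False
      then show ?thesis using x by (simp add: v Sigma_inverse_def torus_def)
    next
      case S: True
      show ?thesis
      proof (cases "l + m \<le> n")
        case True
        then have lm: "(l, m) \<in> S2 n k" "(l + 1, m) \<in> S1 n k \<or> l + 1 = k + 1"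
          using S by (auto simp: S1_def S2_def)
        have "?X (l + 1) m \<noteq> 0" using lm(2) Xnz X_sum_top[of n k x m] by auto
        then show ?thesis using S True V[of l m] V[OF lm(2)] y[OF lm(1)] nz Xnz[OF S]
          unfolding y_def[symmetric] by (simp add: v Sigma_inverse_def)
      next
        case False
        then have "l + m = n + 1" using S by (auto simp: S1_def)
        then show ?thesis using S False V[of l m] X_sum_diag[OF S]
          unfolding y_def[symmetric] by (simp add: v Sigma_inverse_def)
      qed
    qed
  qed
qed

text \<open>The same relations in reverse. \<open>V_sum\<close> is built up with increasing
  \<open>m\<close>, whereas \<open>X_sum\<close> refers to larger \<open>m\<close>, so X(l, m) =
  y(l, m) / V(l + 1, m) is proved by downward induction on \<open>m\<close>.\<close>

lemma Sigma_Sigma_inverse: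
  assumes y: "y \<in> torus (S2 n k)" and V: "\<forall>(l, m)\<in>S1 n k. V_sum k y m l \<noteq> 0"
    and nk: "1 \<le> k" "k \<le> n"
  shows "Sigma_inverse n k y \<in> torus (S1 n k)" "Sigma_map n k (Sigma_inverse n k y) = y"
proof -
  let ?V = "V_sum k y"
  define x where "x = Sigma_inverse n k y"
  let ?X = "X_sum n k x"
  note nz = torus_nonzero[OF y]
  have Vnz: "?V m l \<noteq> 0" if "(l, m) \<in> S1 n k \<or> l = k + 1" for l m
    using V that V_sum_top[of k y m] by auto
  have x1: "x (l, m) = ?V m l * y (l, m) / ?V m (l + 1)" if "(l, m) \<in> S1 n k" "l + m \<le> n" for l m
    using that by (simp add: x_def Sigma_inverse_def)
  have x2: "x (l, m) = ?V m l" if "(l, m) \<in> S1 n k" "l + m = n + 1" for l m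
    using that by (simp add: x_def Sigma_inverse_def)
  have x0: "x v = 1" if "v \<notin> S1 n k" for v
    using that by (cases v) (simp add: x_def Sigma_inverse_def)
  have next_S1: "(l + 1, m) \<in> S1 n k \<or> l + 1 = k + 1" if "(l, m) \<in> S1 n k" "l + m \<le> n" for l m
    using that by (auto simp: S1_def)
  show xt: "Sigma_inverse n k y \<in> torus (S1 n k)"
    unfolding x_def[symmetric] torus_def
  proof (intro CollectI allI)
    fix v :: "nat \<times> nat"
    obtain l m where v: "v = (l, m)" by (cases v)
    show "if v \<in> S1 n k then x v \<noteq> 0 else x v = 1"
    proof (cases "v \<in> S1 n k")
      case True
      then consider "l + m \<le> n" | "l + m = n + 1" by (force simp: v S1_def)
      then show ?thesis
        using True Vnz[of l m] Vnz[OF next_S1[of l m]] nz x1[of l m] x2[of l m] by cases (auto simp: v)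
    qed (simp add: x0)
  qed
  have X: "?X l m = (if l + m \<le> n then y (l, m) / ?V m (l + 1) else 1)" if "(l, m) \<in> S1 n k" for l m
    using that
  proof (induction "n + 1 - m" arbitrary: l m rule: less_induct)
    case less
    show ?case
    proof (cases "l + m \<le> n")
      case False
      then have "l + m = n + 1" using less.prems by (auto simp: S1_def)
      then show ?thesis using less.prems by (simp add: X_sum_diag)
    next
      case True
      have S: "(l, m + 1) \<in> S1 n k" "n + 1 - (m + 1) < n + 1 - m" "1 \<le> l" "l \<le> k" "k < l + m"
        using less.prems True by (auto simp: S1_def)
      have Vn: "?V m l \<noteq> 0" "?V m (l + 1) \<noteq> 0" "?V (m + 1) l \<noteq> 0"
        using Vnz less.prems S(1) next_S1[OF less.prems True] by blast+
      have q: "?X l (m + 1) / x (l, m + 1) = 1 / ?V (m + 1) l"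
      proof (cases "l + (m + 1) \<le> n")
        case True
        then show ?thesis
          using less.hyps[OF S(2,1)] x1[OF S(1)] nz Vn Vnz[OF next_S1[OF S(1)]] by simp
      next
        case False
        then have "l + (m + 1) = n + 1" using True by simp
        then show ?thesis using X_sum_diag[OF S(1)] x2[OF S(1)] by simp
      qed
      have "?X l m = x (l, m) * (?X l (m + 1) / x (l, m + 1)) +
          (if 2 \<le> l then ?X (l - 1) (m + 1) else 0)"
        using X_sum_rec[OF less.prems True, of x] by simp
      also have "(if 2 \<le> l then ?X (l - 1) (m + 1) else 0) =
          (if 2 \<le> l then y (l - 1, m + 1) else 0) / ?V (m + 1) l"
      proof (cases "2 \<le> l")
        case l: True
        then have "(l - 1, m + 1) \<in> S1 n k" using less.prems True by (auto simp: S1_def)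
        from less.hyps[OF S(2) this] show ?thesis using True l by simp
      qed simp
      finally have "?X l m * ?V (m + 1) l =
          ?V m l * y (l, m) / ?V m (l + 1) + (if 2 \<le> l then y (l - 1, m + 1) else 0)"
        unfolding q x1[OF less.prems True] using Vn by (simp add: field_simps)
      moreover have "?V (m + 1) l = ?V m l +
          (if 2 \<le> l then y (l - 1, m + 1) / y (l, m) * ?V m (l + 1) else 0)"
        using S by simp
      then have "?V (m + 1) l * (y (l, m) / ?V m (l + 1)) =
          ?V m l * y (l, m) / ?V m (l + 1) + (if 2 \<le> l then y (l - 1, m + 1) else 0)"
        using Vn nz by (simp add: field_simps)
      ultimately show ?thesis using Vn True
        by (metis mult.commute mult_right_cancel)
    qed
  qed
  \<comment> \<open>In row 1 the recursion adds nothing to the entry value, which in turn uses the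
    default value 1 of \<open>y\<close> in row 0. This identifies \<open>x (1, n)\<close> with
    \<open>1 / y (k, 0)\<close>.\<close>
  have V1: "?V (Suc m) 1 = 1 / y (k, 0)" for m
  proof (induction m)
    case 0
    have "y (0, Suc 0) = 1" using y by (auto simp: torus_def S2_def)
    then show ?case using nk by simp
  next
    case (Suc m)
    have "y (0, Suc (Suc m)) = 1" using y by (auto simp: torus_def S2_def)
    then show ?case using nk Suc by simp
  qed
  have n1: "(1, n) \<in> S1 n k" using nk by (auto simp: S1_def)
  have xn: "x (1, n) = 1 / y (k, 0)"
    using x2[OF n1] V1[of "n - 1"] nk by simp
  show "Sigma_map n k (Sigma_inverse n k y) = y"
    unfolding x_def[symmetric]
  proof
    fix v :: "nat \<times> nat"
    obtain l m where v: "v = (l, m)" by (cases v)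
    show "Sigma_map n k x v = y v"
    proof (cases "(l, m) \<in> S2 n k")
      case False
      then show ?thesis using y by (simp add: v Sigma_map_def torus_def)
    next
      case S: True
      have S1: "(l + 1, m) \<in> S1 n k \<or> l + 1 = k + 1" using S by (auto simp: S1_def S2_def)
      have q: "x (l + 1, m) / ?X (l + 1) m = ?V m (l + 1)"
      proof (cases "l = k")
        case True
        then show ?thesis using x0[of "(k + 1, m)"] X_sum_top[of n k x m] V_sum_top[of k y m]
          by (simp add: S1_def)
      next
        case False
        then have S1: "(l + 1, m) \<in> S1 n k" using S1 by simp
        show ?thesis
        proof (cases "l + 1 + m \<le> n")
          case True
          then show ?thesis using X[OF S1] x1[OF S1] nz Vnz[OF next_S1[OF S1]] by simp
        next
          case False
          then have "l + 1 + m = n + 1" using S by (auto simp: S2_def)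
          then show ?thesis using X[OF S1] x2[OF S1] by simp
        qed
      qed
      have "Sigma_map n k x v = ?V m (l + 1) * ?X l m"
        using S unfolding q[symmetric] by (simp add: v Sigma_map_def)
      also have "\<dots> = y v"
      proof (cases "l + m = k")
        case True
        then have "?X l m = y (k, 0)" using S X_sum_bottom[of l k m n x] xn by (simp add: S2_def)
        moreover have "?V m (l + 1) = y (l, m) / y (k, 0)"
        proof (cases m)
          case 0
          then show ?thesis using True nz by simp
        next
          case (Suc m')
          then show ?thesis using True by simp
        qed
        ultimately show ?thesis using nz by (simp add: v)
      next
        case False
        then have "(l, m) \<in> S1 n k" "l + m \<le> n" using S by (auto simp: S1_def S2_def)
        then show ?thesis using X[of l m] Vnz[OF S1] by (simp add: v)
      qed
      finally show ?thesis .
    qed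
  qed
qed

text \<open>\<open>Sigma_inverse\<close> is the witness for the choice in \<open>Sigma_inv\<close>.
  The two need not coincide as total functions; only the inverse property, which is generic, carries
  over.\<close>

lemma Sigma_inv_inverse:
  assumes "1 \<le> k" "k \<le> n"
  shows "positive_birational_inverse (S1 n k) (S2 n k) (Sigma_map n k) (Sigma_inv n k)"
proof -
  have V: "pgenerically (S2 n k) (\<lambda>y. \<forall>(l, m)\<in>S1 n k. V_sum k y m l \<noteq> 0)"
    by (intro pgenerically_finite_Ball)
       (auto intro: rational_on_pgenerically_nonzero V_sum_rational)
  have "positive_birational_inverse (S1 n k) (S2 n k) (Sigma_map n k) (Sigma_inverse n k)"
    unfolding positive_birational_inverse_def positive_map_def
  proof (intro conjI ballI)
    show "generically (S2 n k) (\<lambda>y. Sigma_inverse n k y \<in> torus (S1 n k))"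
      by (rule pgenerically_generically, rule pgenerically_mono[OF V])
         (rule Sigma_Sigma_inverse(1)[OF _ _ assms])
    show "generically (S2 n k) (\<lambda>y. Sigma_map n k (Sigma_inverse n k y) = y)"
      by (rule pgenerically_generically, rule pgenerically_mono[OF V])
         (rule Sigma_Sigma_inverse(2)[OF _ _ assms])
    show "generically (S1 n k) (\<lambda>x. Sigma_inverse n k (Sigma_map n k x) = x)"
      by (rule pgenerically_generically, rule pgenerically_mono[OF X_sum_nonzero_pgenerically])
         (rule Sigma_inverse_Sigma[OF _ _ assms])
    fix v assume "v \<in> S1 n k"
    obtain p q where pq: "laurent_on preals (S2 n k) p" "laurent_on preals (S2 n k) q"
      "pgenerically (S2 n k) (\<lambda>y. q y \<noteq> 0 \<and> Sigma_inverse n k y v = p y / q y)"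
      using Sigma_inverse_rational[of n k v] unfolding rational_on_def by blast
    obtain p' where p': "positive_laurent_poly (S2 n k) p'" "\<forall>y\<in>torus (S2 n k). p y = p' y"
      using pq(1) unfolding laurent_on_iff_positive_laurent_poly by blast
    obtain q' where q': "positive_laurent_poly (S2 n k) q'" "\<forall>y\<in>torus (S2 n k). q y = q' y"
      using pq(2) unfolding laurent_on_iff_positive_laurent_poly by blast
    have "generically (S2 n k) (\<lambda>y. Sigma_inverse n k y v = p' y / q' y)"
      by (rule generically_mono[OF pgenerically_generically[OF pq(3)]]) (use p' q' in auto)
    then show "\<exists>p q. positive_quotient (S2 n k) (\<lambda>y. Sigma_inverse n k y v) p q"
      unfolding positive_quotient_def using p' q' by blast
  qed
  then show ?thesis
    unfolding Sigma_inv_def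
    by (rule someI[of "positive_birational_inverse (S1 n k) (S2 n k) (Sigma_map n k)"])
qed

section \<open>The action of \<open>e_0\<close>\<close>

text \<open>Along the action of \<open>e_0\<close> the coordinates change by the ratios of \<open>R\<close>, where \<open>R / c\<close> is the
  factor by which \<open>V = x / X\<close> changes. The recursion divides by \<open>X\<close>, its weights adding up to 1 by the
  recursion for \<open>X\<close>.\<close>

primrec R_sum :: "nat \<Rightarrow> nat \<Rightarrow> complex \<Rightarrow> (nat \<times> nat \<Rightarrow> complex) \<Rightarrow> nat \<Rightarrow> nat \<Rightarrow> complex" where
  "R_sum n k c x 0 l = (if k < l then c else 1)"
| "R_sum n k c x (Suc m) l =
     (if k < l \<or> n < l + m then c
      else if l + m \<le> k then 1
      else (x (l, m) / x (l, m + 1) * X_sum n k x l (m + 1) * R_sum n k c x m l +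
            (if 2 \<le> l then X_sum n k x (l - 1) (m + 1) * R_sum n k c x m (l + 1) else 0)) /
           X_sum n k x l m)"

primrec R_trop :: "nat \<Rightarrow> nat \<Rightarrow> int \<Rightarrow> (nat \<times> nat \<Rightarrow> int) \<Rightarrow> nat \<Rightarrow> nat \<Rightarrow> int" where
  "R_trop n k d x 0 l = (if k < l then d else 0)"
| "R_trop n k d x (Suc m) l =
     (if k < l \<or> n < l + m then d
      else if l + m \<le> k then 0
      else (let s = x (l, m) - x (l, m + 1) + X_trop n x l (m + 1) + R_trop n k d x m l in
            if 2 \<le> l then max s (X_trop n x (l - 1) (m + 1) + R_trop n k d x m (l + 1)) else s) -
           X_trop n x l m)"

text \<open>The factors R(l, m) / c of V and c / R(l + 1, m) of X are multiplied, and c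
  cancels.\<close>

definition e0_explicit :: "nat \<Rightarrow> nat \<Rightarrow> complex \<Rightarrow> (nat \<times> nat \<Rightarrow> complex) \<Rightarrow> nat \<times> nat \<Rightarrow> complex" where
  "e0_explicit n k c x = (\<lambda>(l, m). if (l, m) \<in> S1 n k
     then x (l, m) * R_sum n k c x m l / R_sum n k c x m (l + 1) else 1)"

lemma R_sum_rational_tropical:
  assumes rat: "\<And>v. rational_on preals S (\<lambda>z. u z v)" "rational_on preals S c"
    and trop: "\<And>v. tropicalizes S (\<lambda>z. u z v) (\<lambda>\<xi>. t \<xi> v)" "tropicalizes S c d"
    and "1 \<le> l"
  shows "rational_on preals S (\<lambda>z. R_sum n k (c z) (u z) m l) \<and>
    tropicalizes S (\<lambda>z. R_sum n k (c z) (u z) m l) (\<lambda>\<xi>. R_trop n k (d \<xi>) (t \<xi>) m l)"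
  using assms(5)
proof (induction m arbitrary: l)
  case 0
  then show ?case
    using assms by (cases "k < l") (simp_all add: rational_on_const semiring_set_preals tropicalizes_one)
next
  case (Suc m)
  consider "k < l \<or> n < l + m" | "l \<le> k" "l + m \<le> n" "l + m \<le> k" | "l \<le> k" "l + m \<le> n" "k < l + m"
    by linarith
  then show ?case
  proof cases
    case 3
    have S: "(l, m) \<in> S1 n k" "(l, m + 1) \<in> S1 n k" using 3 Suc.prems by (auto simp: S1_def)
    note X = X_sum_rational_tropical[OF rat(1) trop(1)]
    note X0 = X[OF S(1), THEN conjunct1] X[OF S(1), THEN conjunct2]
    note X1 = X[OF S(2), THEN conjunct1] X[OF S(2), THEN conjunct2]
    note IH = Suc.IH[OF Suc.prems, THEN conjunct1] Suc.IH[OF Suc.prems, THEN conjunct2]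
    note s = rational_on_mult[OF semiring_set_preals rational_on_mult[OF semiring_set_preals
          rational_on_divide[OF rat(1,1)] X1(1)] IH(1)]
      tropicalizes_mult[OF tropicalizes_mult[OF tropicalizes_divide[OF trop(1,1)] X1(2)] IH(2)]
    show ?thesis
    proof (cases "2 \<le> l")
      case True
      then have S2: "(l - 1, m + 1) \<in> S1 n k" using 3 by (auto simp: S1_def)
      have l: "1 \<le> l + 1" by simp
      note X2 = X[OF S2, THEN conjunct1] X[OF S2, THEN conjunct2]
      note IH2 = Suc.IH[OF l, THEN conjunct1] Suc.IH[OF l, THEN conjunct2]
      have "rational_on preals S (\<lambda>z. (u z (l, m) / u z (l, m + 1) * X_sum n k (u z) l (m + 1) *
            R_sum n k (c z) (u z) m l + X_sum n k (u z) (l - 1) (m + 1) * R_sum n k (c z) (u z) m (l + 1)) /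
            X_sum n k (u z) l m)"
        by (intro rational_on_divide[OF rational_on_add[OF semiring_set_preals order_refl s(1)
              rational_on_mult[OF semiring_set_preals X2(1) IH2(1)]] X0(1)])
      moreover have "tropicalizes S (\<lambda>z. (u z (l, m) / u z (l, m + 1) * X_sum n k (u z) l (m + 1) *
            R_sum n k (c z) (u z) m l + X_sum n k (u z) (l - 1) (m + 1) * R_sum n k (c z) (u z) m (l + 1)) /
            X_sum n k (u z) l m)
          (\<lambda>\<xi>. max (t \<xi> (l, m) - t \<xi> (l, m + 1) + X_trop n (t \<xi>) l (m + 1) + R_trop n k (d \<xi>) (t \<xi>) m l)
            (X_trop n (t \<xi>) (l - 1) (m + 1) + R_trop n k (d \<xi>) (t \<xi>) m (l + 1)) - X_trop n (t \<xi>) l m)"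
        by (intro tropicalizes_divide[OF tropicalizes_add[OF s(2)
              tropicalizes_mult[OF X2(2) IH2(2)]] X0(2)])
      ultimately show ?thesis using 3 True by (simp add: Let_def)
    next
      case False
      then show ?thesis
        using 3 rational_on_divide[OF s(1) X0(1)] tropicalizes_divide[OF s(2) X0(2)] by (simp add: Let_def)
    qed
  qed (use assms in \<open>auto simp: rational_on_const semiring_set_preals tropicalizes_one\<close>)
qed

text \<open>For \<open>c = 1\<close> all boundary values are 1, and the recursion takes weighted
  means of them. Consequently \<open>e0_explicit\<close> is the identity at
  \<open>c = 1\<close>.\<close>

lemma R_sum_one:
  assumes x: "x \<in> torus (S1 n k)" and X: "\<forall>(l, m)\<in>S1 n k. X_sum n k x l m \<noteq> 0" and "1 \<le> l"
  shows "R_sum n k 1 x m l = 1"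
  using assms(3)
proof (induction m arbitrary: l)
  case (Suc m)
  show ?case
  proof (cases "l \<le> k \<and> l + m \<le> n \<and> k < l + m")
    case True
    then have S: "(l, m) \<in> S1 n k" "l + m \<le> n" using Suc.prems by (auto simp: S1_def)
    have "X_sum n k x l m \<noteq> 0" using X S by blast
    then show ?thesis
      using True Suc.IH[OF Suc.prems] Suc.IH[of "l + 1"] X_sum_rec[OF S, of x] by simp
  next
    case False
    then show ?thesis by auto
  qed
qed simp

text \<open>Checks the defining property of e_0 for the explicit candidate without using any inverse
  of Sigma. Once the path sums of the new point are known, Sigma can be evaluated coordinate by
  coordinate.\<close>

lemma Sigma_e0_explicit:
  assumes x: "x \<in> torus (S1 n k)" and X: "\<forall>(l, m)\<in>S1 n k. X_sum n k x l m \<noteq> 0"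
    and R: "\<forall>(l, m)\<in>S1 n k. R_sum n k c x m l \<noteq> 0" and c: "c \<noteq> 0"
    and nk: "1 \<le> k" "k \<le> n"
  shows "e0_explicit n k c x \<in> torus (S1 n k)"
    and "Sigma_map n k (e0_explicit n k c x) =
      (Sigma_map n k x)((k, 0) := c * Sigma_map n k x (k, 0))"
proof -
  let ?X = "X_sum n k x" and ?R = "R_sum n k c x"
  define x' where "x' = e0_explicit n k c x"
  let ?X' = "X_sum n k x'"
  note nz = torus_nonzero[OF x]
  have Xnz: "?X l m \<noteq> 0" if "(l, m) \<in> S1 n k" for l m using X that by blast
  \<comment> \<open>The value \<open>c\<close> beyond the diagonal \<open>l + m = n + 1\<close>
    makes \<open>x\<close> change by R / c on it, as needed because X stays 1 there.\<close>
  have Rc: "?R m l = c" if "1 \<le> m" "k < l \<or> n + 1 < l + m" for l m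
    using that by (cases m) auto
  have Rnz: "?R m l \<noteq> 0" if "(l, m) \<in> S1 n k" for l m using R that by blast
  have Rnz': "?R m (l + 1) \<noteq> 0" if "(l, m) \<in> S1 n k" for l m
  proof (cases "(l + 1, m) \<in> S1 n k")
    case False
    then have "?R m (l + 1) = c" using that by (intro Rc) (auto simp: S1_def)
    then show ?thesis using c by simp
  qed (rule Rnz)
  have x1: "x' (l, m) = x (l, m) * ?R m l / ?R m (l + 1)" if "(l, m) \<in> S1 n k" for l m
    using that by (simp add: x'_def e0_explicit_def)
  have x0: "x' v = 1" if "v \<notin> S1 n k" for v
    using that by (cases v) (simp add: x'_def e0_explicit_def)
  have xt: "x' \<in> torus (S1 n k)"
    unfolding torus_def using x0 x1 nz Rnz Rnz' by force
  then show "e0_explicit n k c x \<in> torus (S1 n k)" by (simp add: x'_def)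
  note nz' = torus_nonzero[OF xt]
  have X': "?X' l m = c * ?X l m / ?R m (l + 1)" if "(l, m) \<in> S1 n k" for l m
    using that
  proof (induction "n + 1 - m" arbitrary: l m rule: less_induct)
    case less
    show ?case
    proof (cases "l + m \<le> n")
      case False
      then have "l + m = n + 1" "1 \<le> m" using less.prems by (auto simp: S1_def)
      then show ?thesis using less.prems Rc[of m "l + 1"] c by (simp add: X_sum_diag)
    next
      case True
      have S: "(l, m + 1) \<in> S1 n k" "n + 1 - (m + 1) < n + 1 - m" "1 \<le> l" "l \<le> k" "k < l + m"
        using less.prems True by (auto simp: S1_def)
      note nzs = Rnz[OF less.prems] Rnz'[OF less.prems] Rnz[OF S(1)] Rnz'[OF S(1)] Xnz[OF less.prems] nz c
      define D where "D = (if 2 \<le> l then ?X (l - 1) (m + 1) else 0)"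
      have D': "(if 2 \<le> l then ?X' (l - 1) (m + 1) else 0) = c * D / ?R (m + 1) l"
      proof (cases "2 \<le> l")
        case l: True
        then have "(l - 1, m + 1) \<in> S1 n k" using less.prems True by (auto simp: S1_def)
        from less.hyps[OF S(2) this] show ?thesis using l by (simp add: D_def)
      qed (simp add: D_def)
      have "?X' l m = x' (l, m) / x' (l, m + 1) * ?X' l (m + 1) + c * D / ?R (m + 1) l"
        using X_sum_rec[OF less.prems True, of x'] by (simp only: D')
      also have "\<dots> = c * (x (l, m) / x (l, m + 1) * ?X l (m + 1) * ?R m l + D * ?R m (l + 1)) /
          (?R (m + 1) l * ?R m (l + 1))"
        unfolding less.hyps[OF S(2,1)] x1[OF less.prems] x1[OF S(1)]
        using nzs by (simp add: field_simps del: R_sum.simps)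
      \<comment> \<open>The numerator is the recursion of \<open>R_sum\<close>, cleared of its
        denominator X.\<close>
      also have "x (l, m) / x (l, m + 1) * ?X l (m + 1) * ?R m l + D * ?R m (l + 1) = ?R (m + 1) l * ?X l m"
        using S True nzs by (simp add: D_def)
      finally show ?thesis using nzs by (simp del: R_sum.simps)
    qed
  qed
  \<comment> \<open>Row 1 has no contribution from \<open>l - 1\<close>, so \<open>R\<close> keeps
    its initial value 1. Thus \<open>x (1, n)\<close> is divided by \<open>c\<close>, which is how
    \<open>y (k, 0)\<close> acquires the factor \<open>c\<close>.\<close>
  have R1: "?R m 1 = 1" if "(1, m) \<in> S1 n k" for m
    using that
  proof (induction m)
    case (Suc m)
    show ?case
    proof (cases "1 + m \<le> k")
      case True
      then show ?thesis using Suc.prems nk by (simp add: S1_def)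
    next
      case False
      then have S: "(1, m) \<in> S1 n k" "1 + m \<le> n" using Suc.prems by (auto simp: S1_def)
      show ?thesis
        using False Suc.IH[OF S(1)] X_sum_rec[OF S, of x] Xnz[OF S(1)] S nk by simp
    qed
  qed (use nk in simp)
  have "(1, n) \<in> S1 n k" using nk by (auto simp: S1_def)
  then have xn: "x' (1, n) = x (1, n) / c"
    using x1[of 1 n] R1[of n] Rc[of n 2] nk by (simp add: numeral_2_eq_2)
  have q: "x' (l + 1, m) / ?X' (l + 1) m = x (l + 1, m) / ?X (l + 1) m * (if l = k then 1 else ?R m (l + 1) / c)"
    if "(l, m) \<in> S2 n k" for l m
  proof (cases "l = k")
    case True
    have "x' (k + 1, m) = 1" "x (k + 1, m) = 1" using x xt by (auto simp: torus_def S1_def)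
    then show ?thesis using True X_sum_top[of n k x m] X_sum_top[of n k x' m] by simp
  next
    case False
    then have S: "(l + 1, m) \<in> S1 n k" using that by (auto simp: S1_def S2_def)
    show ?thesis unfolding X'[OF S] x1[OF S] using Rnz'[OF S] False by simp
  qed
  show "Sigma_map n k (e0_explicit n k c x) = (Sigma_map n k x)((k, 0) := c * Sigma_map n k x (k, 0))"
    unfolding x'_def[symmetric]
  proof
    fix v :: "nat \<times> nat"
    obtain l m where v: "v = (l, m)" by (cases v)
    show "Sigma_map n k x' v = ((Sigma_map n k x)((k, 0) := c * Sigma_map n k x (k, 0))) v"
    proof (cases "(l, m) \<in> S2 n k")
      case False
      then have "(l, m) \<noteq> (k, 0)" using nk by (auto simp: S2_def)
      then show ?thesis using False by (auto simp: v Sigma_map_def)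
    next
      case S: True
      have "Sigma_map n k x' v = x' (l + 1, m) / ?X' (l + 1) m * ?X' l m"
        using S by (simp add: v Sigma_map_def)
      also have "\<dots> = x (l + 1, m) / ?X (l + 1) m * ((if l = k then 1 else ?R m (l + 1) / c) * ?X' l m)"
        unfolding q[OF S] by simp
      also have "(if l = k then 1 else ?R m (l + 1) / c) * ?X' l m = (if (l, m) = (k, 0) then c else 1) * ?X l m"
      proof (cases "l + m = k")
        case True
        then have X0: "?X' l m = c / x (1, n)" "?X l m = 1 / x (1, n)"
          using S X_sum_bottom[of l k m n] xn by (auto simp: S2_def)
        show ?thesis
        proof (cases m)
          case 0
          then show ?thesis using True X0 by simp
        next
          case (Suc m')
          then have "?R m (l + 1) = 1" using True nk by simp
          then show ?thesis using True X0 Suc c by simp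
        qed
      next
        case False
        then have S1: "(l, m) \<in> S1 n k" "m \<noteq> 0" using S by (auto simp: S1_def S2_def)
        \<comment> \<open>For \<open>m > 0\<close> the boundary value of \<open>R\<close> at
          \<open>k + 1\<close> is \<open>c\<close>, so \<open>l = k\<close> is no exception; only
          \<open>(k, 0)\<close> is.\<close>
        have "?R m (k + 1) = c" using S1(2) by (intro Rc) auto
        then show ?thesis
          unfolding X'[OF S1(1)] using S1(2) Rnz'[OF S1(1)] c by simp
      qed
      finally show ?thesis using S by (auto simp: v Sigma_map_def)
    qed
  qed
qed

section \<open>The torus with the additional coordinate \<open>c\<close>, and the generic form of
  e_0\<close>

lemma finite_action_index [simp]: "finite (insert None (Some ` S1 n k))"
  by simp

abbreviation "S1c n k \<equiv> insert None (Some ` S1 n k)"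

lemma coord_Some_rational: "rational_on preals (S1c n k) (\<lambda>z. z (Some v))"
  by (rule rational_on_coord) simp

lemma coord_Some_tropical:
  "tropicalizes (S1c n k) (\<lambda>z. z (Some v)) (\<lambda>\<xi>. if v \<in> S1 n k then \<xi> (Some v) else 0)"
  using tropicalizes_coord[of "S1c n k" "Some v"] by (simp add: image_iff)

lemma coord_None_rational: "rational_on preals (S1c n k) (\<lambda>z. z None)"
  by (rule rational_on_coord) simp

lemma coord_None_tropical: "tropicalizes (S1c n k) (\<lambda>z. z None) (\<lambda>\<xi>. \<xi> None)"
  using tropicalizes_coord[of "S1c n k" None] by simp

lemma torus_Some: "z \<in> torus (S1c n k) \<Longrightarrow> (\<lambda>v. z (Some v)) \<in> torus (S1 n k)"
  by (auto simp: torus_def image_iff dest!: spec[of _ "Some _"] split: if_splits)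

text \<open>\<open>Sigma_inv\<close> undoes \<open>Sigma_map\<close> only generically in
  \<open>x\<close>, whereas the identity is needed at the moved point, in the variables c and x. So
  the moved points must not all lie in the exceptional hypersurface. They do not, since they include
  every positive \<open>x\<close>, attained at \<open>c = 1\<close>.\<close>

lemma e0_generically_explicit:
  assumes nk: "1 \<le> k" "k \<le> n"
  shows "generically (S1c n k) (\<lambda>z. \<forall>w\<in>S1 n k.
    geom_e n k 0 (z None) (\<lambda>v. z (Some v)) w = e0_explicit n k (z None) (\<lambda>v. z (Some v)) w)"
proof -
  let ?E = "\<lambda>z. e0_explicit n k (z None) (\<lambda>v. z (Some v))"
  note X = X_sum_rational_tropical[where u = "\<lambda>z v. z (Some v)" and n = n and k = k,
      OF coord_Some_rational[of n k] coord_Some_tropical[of n k], THEN conjunct1]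
  note R = R_sum_rational_tropical[where u = "\<lambda>z v. z (Some v)" and c = "\<lambda>z. z None" and n = n and k = k,
      OF coord_Some_rational[of n k] coord_None_rational[of n k] coord_Some_tropical[of n k]
        coord_None_tropical[of n k], THEN conjunct1]
  have "pgenerically (S1c n k) (\<lambda>z. \<forall>(l, m)\<in>S1 n k. X_sum n k (\<lambda>v. z (Some v)) l m \<noteq> 0)"
    using rational_on_pgenerically_nonzero[OF X] by (intro pgenerically_finite_Ball) auto
  moreover have "pgenerically (S1c n k) (\<lambda>z. \<forall>(l, m)\<in>S1 n k. R_sum n k (z None) (\<lambda>v. z (Some v)) m l \<noteq> 0)"
    proof (intro pgenerically_finite_Ball finite_S1)
    fix v :: "nat \<times> nat" assume "v \<in> S1 n k"
    then have "1 \<le> fst v" by (auto simp: S1_def)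
    from rational_on_pgenerically_nonzero[OF R[OF this]]
    show "pgenerically (S1c n k) (\<lambda>z. case v of (l, m) \<Rightarrow> R_sum n k (z None) (\<lambda>v. z (Some v)) m l \<noteq> 0)"
      by (simp add: case_prod_unfold)
  qed
  ultimately have gen: "pgenerically (S1c n k) (\<lambda>z. z \<in> torus (S1c n k) \<and>
      (\<forall>(l, m)\<in>S1 n k. X_sum n k (\<lambda>v. z (Some v)) l m \<noteq> 0) \<and>
      (\<forall>(l, m)\<in>S1 n k. R_sum n k (z None) (\<lambda>v. z (Some v)) m l \<noteq> 0))"
    by (intro pgenerically_conj) (auto intro: pgenerically_all)
  have E: "pgenerically (S1c n k) (\<lambda>z. ?E z \<in> torus (S1 n k) \<and> Sigma_map n k (?E z) =
      (Sigma_map n k (\<lambda>v. z (Some v)))((k, 0) := z None * Sigma_map n k (\<lambda>v. z (Some v)) (k, 0)))"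
  proof (rule pgenerically_mono[OF gen], elim conjE)
    fix z
    assume z: "z \<in> torus (S1c n k)"
      and X: "\<forall>(l, m)\<in>S1 n k. X_sum n k (\<lambda>v. z (Some v)) l m \<noteq> 0"
      and R: "\<forall>(l, m)\<in>S1 n k. R_sum n k (z None) (\<lambda>v. z (Some v)) m l \<noteq> 0"
    show "?E z \<in> torus (S1 n k) \<and> Sigma_map n k (?E z) =
      (Sigma_map n k (\<lambda>v. z (Some v)))((k, 0) := z None * Sigma_map n k (\<lambda>v. z (Some v)) (k, 0))"
      using Sigma_e0_explicit[OF torus_Some[OF z] X R torus_nonzero[OF z] nk] by (intro conjI)
  qed
  have "generically (S1c n k) (\<lambda>z. Sigma_inv n k (Sigma_map n k (?E z)) = ?E z)"
  proof (rule generically_pullback[OF finite_action_index finite_S1[of n k]])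
    show "generically (S1 n k) (\<lambda>x. Sigma_inv n k (Sigma_map n k x) = x)"
      using Sigma_inv_inverse[OF nk] by (simp add: positive_birational_inverse_def)
    show "rational_on preals (S1c n k) (\<lambda>z. ?E z w)" if "w \<in> S1 n k" for w
    proof -
      obtain l m where w: "w = (l, m)" by (cases w)
      then have "1 \<le> l" "(l, m) \<in> S1 n k" using that by (auto simp: S1_def)
      note w = w this
      show ?thesis unfolding w e0_explicit_def
        using w rational_on_divide[OF rational_on_mult[OF semiring_set_preals coord_Some_rational[of n k w] R[of l m]]
            R[of "l + 1" m]] by simp
    qed
    show "pgenerically (S1c n k) (\<lambda>z. ?E z \<in> torus (S1 n k))"
      by (rule pgenerically_mono[OF E]) blast
    fix x assume x: "x \<in> ptorus (S1 n k)"
    have "?E (case_option 1 x) = x"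
    proof
      fix v :: "nat \<times> nat"
      obtain l m where v: "v = (l, m)" by (cases v)
      have X: "\<forall>(l, m)\<in>S1 n k. X_sum n k x l m \<noteq> 0"
        using pgenerically_ptorus[OF X_sum_nonzero_pgenerically x] .
      show "?E (case_option 1 x) v = x v"
      proof (cases "v \<in> S1 n k")
        case True
        then have "1 \<le> l" by (auto simp: v S1_def)
        then show ?thesis using True R_sum_one[OF ptorus_torus[OF x] X]
          by (simp add: v e0_explicit_def)
      qed (use x in \<open>auto simp: v e0_explicit_def ptorus_def torus_def\<close>)
    qed
    moreover have "case_option 1 x \<in> ptorus (S1c n k)"
      using x by (auto simp: ptorus_def torus_def image_iff split: option.splits)
    ultimately show "\<exists>z\<in>ptorus (S1c n k). ?E z = x" by blast
  qed
  from generically_conj[OF finite_action_index this pgenerically_generically[OF E]] show ?thesis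
  proof (rule generically_mono, elim conjE)
    fix z
    assume "Sigma_inv n k (Sigma_map n k (?E z)) = ?E z"
      and "Sigma_map n k (?E z) =
        (Sigma_map n k (\<lambda>v. z (Some v)))((k, 0) := z None * Sigma_map n k (\<lambda>v. z (Some v)) (k, 0))"
    then show "\<forall>w\<in>S1 n k. geom_e n k 0 (z None) (\<lambda>v. z (Some v)) w = ?E z w"
      by (simp add: geom_e_def Let_def del: fun_upd_apply)
  qed
qed

lemma UD_action_e0:
  assumes nk: "1 \<le> k" "k \<le> n" and x: "x \<in> cochars (S1 n k)"
  shows "UD_action (S1 n k) (geom_e n k 0) d x = (\<lambda>(l, m). if (l, m) \<in> S1 n k
    then x (l, m) + R_trop n k d x m l - R_trop n k d x m (l + 1) else 0)"
proof -
  let ?t = "\<lambda>\<xi> v. if v \<in> S1 n k then \<xi> (Some v) else (0 :: int)"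
  note R = R_sum_rational_tropical[where u = "\<lambda>z v. z (Some v)" and c = "\<lambda>z. z None" and t = ?t
        and n = n and k = k, OF coord_Some_rational[of n k] coord_None_rational[of n k]
        coord_Some_tropical[of n k] coord_None_tropical[of n k]]
  have "rational_on preals (S1c n k) (\<lambda>z. e0_explicit n k (z None) (\<lambda>v. z (Some v)) w) \<and>
      tropicalizes (S1c n k) (\<lambda>z. e0_explicit n k (z None) (\<lambda>v. z (Some v)) w)
        ((\<lambda>(l, m) \<xi>. ?t \<xi> (l, m) + R_trop n k (\<xi> None) (?t \<xi>) m l - R_trop n k (\<xi> None) (?t \<xi>) m (l + 1)) w)"
    if "w \<in> S1 n k" for w
  proof -
    obtain l m where w: "w = (l, m)" by (cases w)
    then have "1 \<le> l" "(l, m) \<in> S1 n k" using that by (auto simp: S1_def)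
    note w = w this
    note R1 = R[OF w(2), of m, THEN conjunct1] R[OF w(2), of m, THEN conjunct2]
    have l: "1 \<le> l + 1" by simp
    note R2 = R[OF l, of m, THEN conjunct1] R[OF l, of m, THEN conjunct2]
    show ?thesis
      using w rational_on_divide[OF rational_on_mult[OF semiring_set_preals coord_Some_rational[of n k w] R1(1)] R2(1)]
        tropicalizes_divide[OF tropicalizes_mult[OF coord_Some_tropical[of n k w] R1(2)] R2(2)]
      by (simp add: e0_explicit_def del: One_nat_def)
  qed
  then have "UD_action (S1 n k) (geom_e n k 0) d x = (\<lambda>w. if w \<in> S1 n k then
      (\<lambda>(l, m) \<xi>. ?t \<xi> (l, m) + R_trop n k (\<xi> None) (?t \<xi>) m l - R_trop n k (\<xi> None) (?t \<xi>) m (l + 1)) w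
        (case_option d x) else 0)"
    by (intro UD_action_eqI[OF finite_S1 e0_generically_explicit[OF nk]]) auto
  moreover have "(\<lambda>v. if v \<in> S1 n k then x v else 0) = x" using x by (auto simp: cochars_def)
  ultimately show ?thesis by (simp add: case_prod_unfold cong: if_cong)
qed

section \<open>The crystal structure for nonzero indices\<close>

text \<open>X enters \<open>y (k, 1)\<close> and \<open>y (k - 1, 1)\<close> with opposite powers
  and cancels from the weight. For \<open>k = n\<close> or \<open>k = 1\<close> one of these
  coordinates lies outside \<open>S2\<close>, and its default value 1 fits the same
  formulas.\<close>

lemma geom_0:
  assumes x: "x \<in> torus (S1 n k)" and X: "\<forall>(l, m)\<in>S1 n k. X_sum n k x l m \<noteq> 0"
    and nk: "1 \<le> k" "k \<le> n"
  shows "geom_gamma n k 0 x = 1 / (x (1, n) * x (k, 1))"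
    and "geom_eps n k 0 x = X_sum n k x k 1 * x (1, n)"
proof -
  let ?X = "X_sum n k x" and ?y = "Sigma_map n k x"
  note nz = torus_nonzero[OF x]
  have xtop: "x (k + 1, m) = 1" for m using x by (auto simp: torus_def S1_def)
  have S: "(k, 1) \<in> S1 n k" using nk by (simp add: S1_def)
  then have Xnz: "?X k 1 \<noteq> 0" using X by blast
  have y0: "?y (k, 0) = 1 / x (1, n)"
    using nk xtop[of 0] X_sum_top[of n k x 0] X_sum_bottom[of k k 0 n x] by (simp add: Sigma_map_def S2_def)
  have y1: "?y (k, 1) = ?X k 1"
  proof (cases "k = n")
    case True
    then show ?thesis using X_sum_diag[OF S, of x] by (simp add: Sigma_map_def S2_def)
  next
    case False
    then have "(k, 1) \<in> S2 n k" using nk by (simp add: S2_def)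
    then show ?thesis using xtop[of 1] X_sum_top[of n k x 1] by (simp add: Sigma_map_def)
  qed
  have y2: "?y (k - 1, 1) = x (k, 1) / x (1, n) / ?X k 1"
  proof (cases "k = 1")
    case True
    then show ?thesis using X_sum_one[of 1 n k x] x S nz by (simp add: Sigma_map_def S2_def)
  next
    case False
    then have "(k - 1, 1) \<in> S2 n k" "k - 1 + 1 = k" "k - 1 \<le> k" using nk by (auto simp: S2_def)
    then have "?y (k - 1, 1) = x (k, 1) * ?X (k - 1) 1 / ?X k 1" "?X (k - 1) 1 = 1 / x (1, n)"
      using X_sum_bottom[of "k - 1" k 1 n x] by (simp_all add: Sigma_map_def)
    then show ?thesis by simp
  qed
  show "geom_gamma n k 0 x = 1 / (x (1, n) * x (k, 1))"
    using nz Xnz unfolding geom_gamma_def Let_def y0 y1 y2 by (simp add: field_simps power2_eq_square)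
  show "geom_eps n k 0 x = X_sum n k x k 1 * x (1, n)"
    using nz unfolding geom_eps_def Let_def y0 y1 by simp
qed

lemma coord_cochars:
  "x \<in> cochars S \<Longrightarrow> (\<lambda>v. if v \<in> S then x v else 0) = x"
  unfolding cochars_def by (rule ext) (simp del: split_paired_All)

lemma UD_fun_0:
  assumes nk: "1 \<le> k" "k \<le> n" and x: "x \<in> cochars (S1 n k)"
  shows "UD_fun (S1 n k) (geom_gamma n k 0) x = - x (1, n) - x (k, 1)"
    and "UD_fun (S1 n k) (geom_eps n k 0) x = X_trop n x k 1 + x (1, n)"
proof -
  let ?S = "S1 n k"
  let ?t = "\<lambda>\<xi> v. if v \<in> ?S then \<xi> v else (0 :: int)"
  have gen: "pgenerically ?S (\<lambda>x. geom_gamma n k 0 x = 1 / (x (1, n) * x (k, 1)) \<and>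
      geom_eps n k 0 x = X_sum n k x k 1 * x (1, n))"
    by (rule pgenerically_mono[OF X_sum_nonzero_pgenerically]) (intro conjI geom_0 nk)
  note r = rational_on_coord[OF finite_S1]
  have "rational_on preals ?S (\<lambda>x. 1 / (x (1, n) * x (k, 1)))"
    by (intro rational_on_divide[OF rational_on_const] rational_on_mult semiring_set_preals preals_one r)
  then have "rational_on preals ?S (geom_gamma n k 0)"
    by (rule rational_on_cong) (rule pgenerically_mono[OF gen], blast)
  moreover have "tropicalizes ?S (\<lambda>x. 1 / (x (1, n) * x (k, 1))) (\<lambda>\<xi>. 0 - (?t \<xi> (1, n) + ?t \<xi> (k, 1)))"
    by (intro tropicalizes_divide[OF tropicalizes_one tropicalizes_mult[OF tropicalizes_coord tropicalizes_coord]])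
  then have "tropicalizes ?S (geom_gamma n k 0) (\<lambda>\<xi>. 0 - (?t \<xi> (1, n) + ?t \<xi> (k, 1)))"
    by (rule tropicalizes_cong) (use pgenerically_ptorus[OF gen] in simp)
  ultimately have "UD_fun ?S (geom_gamma n k 0) x = 0 - (?t x (1, n) + ?t x (k, 1))"
    by (rule UD_fun_eqI[OF finite_S1])
  then show "UD_fun ?S (geom_gamma n k 0) x = - x (1, n) - x (k, 1)"
    using x by (auto simp: cochars_def)
  have S: "(k, 1) \<in> S1 n k" using nk by (simp add: S1_def)
  note X = X_sum_rational_tropical[where u = "\<lambda>z. z" and t = ?t and S = ?S, OF r tropicalizes_coord S]
  have "rational_on preals ?S (geom_eps n k 0)"
    by (rule rational_on_cong[OF rational_on_mult[OF semiring_set_preals X[THEN conjunct1] r]])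
       (rule pgenerically_mono[OF gen], blast)
  moreover have "tropicalizes ?S (geom_eps n k 0) (\<lambda>\<xi>. X_trop n (?t \<xi>) k 1 + ?t \<xi> (1, n))"
    by (rule tropicalizes_cong[OF tropicalizes_mult[OF X[THEN conjunct2] tropicalizes_coord]])
       (use pgenerically_ptorus[OF gen] in simp)
  ultimately have "UD_fun ?S (geom_eps n k 0) x = X_trop n (?t x) k 1 + ?t x (1, n)"
    by (rule UD_fun_eqI[OF finite_S1])
  then show "UD_fun ?S (geom_eps n k 0) x = X_trop n x k 1 + x (1, n)"
    unfolding coord_cochars[OF x] using x by (auto simp: cochars_def)
qed

section \<open>Ultra-discretization of the structure for \<open>i > 0\<close>\<close>

definition D_trop :: "nat \<Rightarrow> nat \<Rightarrow> nat \<Rightarrow> nat \<Rightarrow> (nat \<times> nat \<Rightarrow> int) \<Rightarrow> int" where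
  "D_trop n k l i x = x (l, i) + (\<Sum>j = l + 1..hi n k i. 2 * x (j, i)) -
     ((\<Sum>j = l + 1..hi n k i + 1. x (j, i - 1)) + (\<Sum>j = l..hi n k i. x (j, i + 1)))"

lemma D_coef_rational:
  assumes "\<And>v. rational_on preals S (\<lambda>z. u z v)"
  shows "rational_on preals S (\<lambda>z. D_coef n k l i (u z))"
  unfolding D_coef_def
  by (intro rational_on_divide rational_on_mult semiring_set_preals rational_on_prod rational_on_power assms)

lemma D_coef_tropical:
  assumes "\<And>v. tropicalizes S (\<lambda>z. u z v) (\<lambda>\<xi>. t \<xi> v)"
  shows "tropicalizes S (\<lambda>z. D_coef n k l i (u z)) (\<lambda>\<xi>. D_trop n k l i (t \<xi>))"
proof -
  have "tropicalizes S (\<lambda>z. (u z v)\<^sup>2) (\<lambda>\<xi>. 2 * t \<xi> v)" for v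
    using tropicalizes_power[OF assms, of v 2] by simp
  then show ?thesis
    unfolding D_coef_def D_trop_def
    by (intro tropicalizes_divide tropicalizes_mult tropicalizes_prod assms)
qed

lemma lo_le_hi: "1 \<le> i \<Longrightarrow> i \<le> n \<Longrightarrow> 1 \<le> k \<Longrightarrow> k \<le> n \<Longrightarrow> lo k i \<le> hi n k i"
  by (auto simp: lo_def hi_def)

lemma UD_fun_pos:
  assumes i: "1 \<le> i" "i \<le> n" and nk: "1 \<le> k" "k \<le> n" and x: "x \<in> cochars (S1 n k)"
  shows "UD_fun (S1 n k) (geom_gamma n k i) x =
      D_trop n k (lo k i) i x + x (lo k i, i) - x (lo k i, i - 1) - x (lo k i - 1, i + 1)"
    and "UD_fun (S1 n k) (geom_eps n k i) x = Max ((\<lambda>l. - D_trop n k l i x) ` {lo k i..hi n k i})"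
proof -
  let ?S = "S1 n k" and ?a = "lo k i"
  let ?t = "\<lambda>\<xi> v. if v \<in> ?S then \<xi> v else (0 :: int)"
  note r = rational_on_coord[OF finite_S1[of n k]] and t = tropicalizes_coord[of ?S]
  note D = D_coef_rational[where u = "\<lambda>z. z" and S = ?S, OF r]
    D_coef_tropical[where u = "\<lambda>z. z" and S = ?S and t = ?t, OF t]
  have "rational_on preals ?S (\<lambda>x. D_coef n k ?a i x * (x (?a, i) / (x (?a, i - 1) * x (?a - 1, i + 1))))"
    by (intro rational_on_divide rational_on_mult semiring_set_preals D r)
  moreover have "tropicalizes ?S (\<lambda>x. D_coef n k ?a i x * (x (?a, i) / (x (?a, i - 1) * x (?a - 1, i + 1))))
      (\<lambda>\<xi>. D_trop n k ?a i (?t \<xi>) + (?t \<xi> (?a, i) - (?t \<xi> (?a, i - 1) + ?t \<xi> (?a - 1, i + 1))))"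
    by (intro tropicalizes_divide tropicalizes_mult D t)
  ultimately have "UD_fun ?S (\<lambda>x. D_coef n k ?a i x * (x (?a, i) / (x (?a, i - 1) * x (?a - 1, i + 1)))) x =
      D_trop n k ?a i (?t x) + (?t x (?a, i) - (?t x (?a, i - 1) + ?t x (?a - 1, i + 1)))"
    by (rule UD_fun_eqI[OF finite_S1])
  moreover have "geom_gamma n k i = (\<lambda>x. D_coef n k ?a i x * (x (?a, i) / (x (?a, i - 1) * x (?a - 1, i + 1))))"
    using i by (auto simp: geom_gamma_def Let_def)
  moreover have "?t x v = x v" for v using fun_cong[OF coord_cochars[OF x], of v] .
  ultimately have "UD_fun ?S (geom_gamma n k i) x =
      D_trop n k ?a i x + (x (?a, i) - (x (?a, i - 1) + x (?a - 1, i + 1)))"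
    by (simp only:)
  then show "UD_fun ?S (geom_gamma n k i) x =
      D_trop n k ?a i x + x (?a, i) - x (?a, i - 1) - x (?a - 1, i + 1)"
    by simp
  have ne: "{?a..hi n k i} \<noteq> {}" using lo_le_hi[OF i nk] by simp
  have "rational_on preals ?S (\<lambda>x. \<Sum>l\<in>{?a..hi n k i}. 1 / D_coef n k l i x)"
    by (intro rational_on_sum rational_on_divide rational_on_const semiring_set_preals preals_one
        order_refl D ne finite_atLeastAtMost)
  moreover have "tropicalizes ?S (\<lambda>x. \<Sum>l\<in>{?a..hi n k i}. 1 / D_coef n k l i x)
      (\<lambda>\<xi>. Max ((\<lambda>l. 0 - D_trop n k l i (?t \<xi>)) ` {?a..hi n k i}))"
    by (rule tropicalizes_sum[OF finite_atLeastAtMost ne tropicalizes_divide[OF tropicalizes_one D(2)]])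
  ultimately have "UD_fun ?S (\<lambda>x. \<Sum>l\<in>{?a..hi n k i}. 1 / D_coef n k l i x) x =
      Max ((\<lambda>l. 0 - D_trop n k l i (?t x)) ` {?a..hi n k i})"
    by (rule UD_fun_eqI[OF finite_S1])
  moreover have "geom_eps n k i = (\<lambda>x. \<Sum>l\<in>{?a..hi n k i}. 1 / D_coef n k l i x)"
    using i by (auto simp: geom_eps_def)
  ultimately show "UD_fun ?S (geom_eps n k i) x = Max ((\<lambda>l. - D_trop n k l i x) ` {?a..hi n k i})"
    using coord_cochars[OF x] by simp
qed

text \<open>Numerator and denominator of the geometric action are the same sum, in which the
  coefficient switches from 1 to \<open>c\<close> at \<open>l\<close> and at \<open>l + 1\<close>.
  So one family of maxima, indexed by the switching point, suffices.\<close>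

lemma UD_action_pos:
  assumes i: "1 \<le> i" "i \<le> n" and nk: "1 \<le> k" "k \<le> n" and x: "x \<in> cochars (S1 n k)"
  shows "UD_action (S1 n k) (geom_e n k i) d x = (\<lambda>(l, m). if (l, m) \<in> S1 n k \<and> m = i
    then x (l, m) + (Max ((\<lambda>p. (if p < l then 0 else d) - D_trop n k p i x) ` {lo k i..hi n k i}) -
      Max ((\<lambda>p. (if p < l + 1 then 0 else d) - D_trop n k p i x) ` {lo k i..hi n k i})) else x (l, m))"
proof -
  let ?S = "S1c n k" and ?I = "{lo k i..hi n k i}"
  let ?t = "\<lambda>\<xi> v. if v \<in> S1 n k then \<xi> (Some v) else (0 :: int)"
  note r = coord_Some_rational[of n k] coord_None_rational[of n k]
  note t = coord_Some_tropical[of n k] coord_None_tropical[of n k]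
  note D = D_coef_rational[where u = "\<lambda>z v. z (Some v)" and S = ?S, OF r(1)]
    D_coef_tropical[where u = "\<lambda>z v. z (Some v)" and S = ?S and t = ?t, OF t(1)]
  define F where "F l z = (\<Sum>p\<in>?I. (if p < l then 1 else z None) / D_coef n k p i (\<lambda>v. z (Some v)))"
    for l and z :: "(nat \<times> nat) option \<Rightarrow> complex"
  define G where "G l \<xi> = Max ((\<lambda>p. (if p < l then 0 else \<xi> None) - D_trop n k p i (?t \<xi>)) ` ?I)" for l \<xi>
  have ne: "?I \<noteq> {}" using lo_le_hi[OF i nk] by simp
  have split: "(\<Sum>p = lo k i..<l. f p) + (\<Sum>p = l..hi n k i. g p) = (\<Sum>p\<in>?I. if p < l then f p else g p)"
    if "lo k i \<le> l" "l \<le> hi n k i + 1" for l and f g :: "nat \<Rightarrow> complex"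
  proof -
    have "(\<Sum>p = lo k i..<l. f p) + (\<Sum>p = l..hi n k i. g p) =
        (\<Sum>p = lo k i..<l. if p < l then f p else g p) + (\<Sum>p = l..hi n k i. if p < l then f p else g p)"
      by (intro arg_cong2[of _ _ _ _ "(+)"] sum.cong) auto
    also have "\<dots> = (\<Sum>p\<in>{lo k i..<l} \<union> {l..hi n k i}. if p < l then f p else g p)"
      by (rule sum.union_disjoint[symmetric]) auto
    also have "{lo k i..<l} \<union> {l..hi n k i} = ?I" using that by auto
    finally show ?thesis .
  qed
  have cr: "rational_on preals ?S (\<lambda>z. (if p < l then 1 else z None))" for p l :: nat
    using r(2) by (cases "p < l") (simp_all add: rational_on_const semiring_set_preals)
  have ct: "tropicalizes ?S (\<lambda>z. (if p < l then 1 else z None)) (\<lambda>\<xi>. if p < l then 0 else \<xi> None)" for p l :: nat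
    using t(2) by (cases "p < l") (simp_all add: tropicalizes_one)
  have Fr: "rational_on preals ?S (F l)" for l
    unfolding F_def
    by (intro rational_on_sum rational_on_divide semiring_set_preals order_refl D(1) ne cr
        finite_atLeastAtMost)
  have Ft: "tropicalizes ?S (F l) (G l)" for l
    unfolding F_def G_def
    by (rule tropicalizes_sum[OF finite_atLeastAtMost ne tropicalizes_divide[OF ct D(2)]])
  have e: "geom_e n k i c y (l, m) = (if (l, m) \<in> S1 n k \<and> m = i
      then y (l, i) * (F l (case_option c y) / F (l + 1) (case_option c y)) else y (l, m))" for c y l m
  proof (cases "(l, m) \<in> S1 n k \<and> m = i")
    case True
    then have "lo k i \<le> l" "l \<le> hi n k i" using i by (auto simp: S1_def lo_def hi_def)
    then show ?thesis
      using True i split[of l "\<lambda>p. 1 / D_coef n k p i y" "\<lambda>p. c / D_coef n k p i y"]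
        split[of "l + 1" "\<lambda>p. 1 / D_coef n k p i y" "\<lambda>p. c / D_coef n k p i y"]
      by (simp add: geom_e_def Let_def F_def if_distribR if_distrib[of "\<lambda>u. u / _"] atLeastLessThanSuc_atLeastAtMost
          cong: if_cong)
  next
    case False
    then show ?thesis using i by (auto simp: geom_e_def Let_def)
  qed
  have z: "case_option (z None) (\<lambda>v. z (Some v)) = z" for z :: "(nat \<times> nat) option \<Rightarrow> complex"
    by (auto simp: fun_eq_iff split: option.splits)
  define E where "E z = (\<lambda>(l, m). if m = i then z (Some (l, m)) * (F l z / F (l + 1) z) else z (Some (l, m)))" for z
  define \<tau> where "\<tau> = (\<lambda>(l, m) \<xi>. if m = i then ?t \<xi> (l, m) + (G l \<xi> - G (l + 1) \<xi>) else ?t \<xi> (l, m))"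
  have "UD_action (S1 n k) (geom_e n k i) d x = (\<lambda>w. if w \<in> S1 n k then \<tau> w (case_option d x) else 0)"
  proof (rule UD_action_eqI[OF finite_S1])
    show "generically ?S (\<lambda>z. \<forall>w\<in>S1 n k. geom_e n k i (z None) (\<lambda>v. z (Some v)) w = E z w)"
      by (intro pgenerically_generically pgenerically_all) (auto simp: e z E_def)
    show "rational_on preals ?S (\<lambda>z. E z w)" for w
      using rational_on_mult[OF semiring_set_preals r(1) rational_on_divide[OF Fr Fr]] r(1)
      by (cases w; cases "snd w = i") (simp_all add: E_def)
    show "tropicalizes ?S (\<lambda>z. E z w) (\<tau> w)" for w
    proof (cases w)
      case (Pair l m)
      show ?thesis
      proof (cases "m = i")
        case True
        show ?thesis
          using tropicalizes_mult[OF t(1)[of "(l, i)"] tropicalizes_divide[OF Ft[of l] Ft[of "l + 1"]]]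
          unfolding Pair \<tau>_def E_def True by simp
      next
        case False
        then show ?thesis using t(1)[of "(l, m)"] unfolding Pair \<tau>_def E_def by simp
      qed
    qed
  qed
  moreover have "G l (case_option d x) =
      Max ((\<lambda>p. (if p < l then 0 else d) - D_trop n k p i x) ` {lo k i..hi n k i})" for l
    unfolding G_def by (simp add: coord_cochars[OF x] cong: if_cong)
  moreover have "x w = 0" if "w \<notin> S1 n k" for w using that x unfolding cochars_def by blast
  ultimately show ?thesis
    by (auto simp: fun_eq_iff \<tau>_def)
qed

section \<open>Comparison with \<open>B_inf\<close> for \<open>i > 0\<close>\<close>

lemma Omega_cochars:
  assumes "x \<in> cochars (S1 n k)" "1 \<le> j" "j \<le> k" "j \<le> i" "i \<le> j + (n + 1 - k)"
  shows "Omega n k x j i = x (k + 1 - j, i) - x (k + 1 - j, i - 1)"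
  using assms by (simp add: Omega_def)

lemma Omega_outside:
  "\<not> (1 \<le> j \<and> j \<le> k \<and> j \<le> i \<and> i \<le> j + (n + 1 - k)) \<Longrightarrow> Omega n k x j i = 0"
  unfolding Omega_def Let_def by auto

context
  fixes n k i :: nat and x :: "nat \<times> nat \<Rightarrow> int" and D :: "nat \<Rightarrow> int" and b a b'
  assumes i: "1 \<le> i" "i \<le> n" and nk: "1 \<le> k" "k \<le> n" and x: "x \<in> cochars (S1 n k)"
  defines "D \<equiv> \<lambda>l. D_trop n k l i x" and "b \<equiv> Omega n k x"
    and "a \<equiv> lo k i" and "b' \<equiv> hi n k i"
begin

lemma x_outside: "v \<notin> S1 n k \<Longrightarrow> x v = 0"
  using x unfolding cochars_def by blast

lemma beta_hi: "B_beta n k i = k - b'" "b' \<le> k" "1 \<le> b'"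
  using i nk by (auto simp: B_beta_def b'_def hi_def)

lemma gamma_lo: "B_gamma k i = k + 1 - a" "1 \<le> a" "a \<le> k"
  using i nk by (auto simp: B_gamma_def a_def lo_def)

lemma a_le_b': "a \<le> b'"
  unfolding a_def b'_def by (rule lo_le_hi[OF i nk])

lemma D_diff:
  assumes "B_beta n k i < j" "j < B_gamma k i"
  shows "b j i - b (j + 1) (i + 1) = D (k - j) - D (k + 1 - j)"
proof -
  define l where "l = k - j"
  have l: "l \<ge> 1" "l < b'" "a \<le> l" "k + 1 - j = l + 1" "k + 1 - (j + 1) = l"
    using assms beta_hi gamma_lo by (auto simp: l_def)
  have "b j i = x (l + 1, i) - x (l + 1, i - 1)"
    unfolding b_def l(4)[symmetric] using assms i nk
    by (intro Omega_cochars x) (auto simp: B_beta_def B_gamma_def)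
  moreover have "b (j + 1) (i + 1) = x (l, i + 1) - x (l, i)"
    using Omega_cochars[OF x, of "j + 1" "i + 1"] assms i nk unfolding b_def l(5)
    by (auto simp: B_beta_def B_gamma_def)
  \<comment> \<open>Moving the lower bounds of the sums by one affects only the terms at
    \<open>l\<close> and \<open>l + 1\<close>.\<close>
  moreover have "D l = D (l + 1) + x (l, i) + x (l + 1, i) - x (l + 1, i - 1) - x (l, i + 1)"
  proof -
    have I: "{l + 1..b'} = insert (l + 1) {l + 2..b'}" "{l + 1..b' + 1} = insert (l + 1) {l + 2..b' + 1}"
      "{l..b'} = insert l {l + 1..b'}"
      using l by auto
    have s: "(\<Sum>j = l + 1..b'. 2 * x (j, i)) = 2 * x (l + 1, i) + (\<Sum>j = l + 2..b'. 2 * x (j, i))"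
      "(\<Sum>j = l + 1..b' + 1. x (j, i - 1)) = x (l + 1, i - 1) + (\<Sum>j = l + 2..b' + 1. x (j, i - 1))"
      "(\<Sum>j = l..b'. x (j, i + 1)) = x (l, i + 1) + (\<Sum>j = l + 1..b'. x (j, i + 1))"
      unfolding I by (subst sum.insert; simp)+
    show ?thesis
      unfolding D_def D_trop_def b'_def[symmetric] s by (simp add: add.assoc)
  qed
  ultimately show ?thesis unfolding l(4) l_def[symmetric] by simp
qed

text \<open>The telescoping starts at \<open>c = B_beta n k i + 1\<close>, which corresponds to
  \<open>l = b'\<close>. The sum is empty there, which fixes the additive constant.\<close>

lemma Gamma_D:
  assumes "B_beta n k i < c" "c \<le> B_gamma k i"
  shows "B_Gamma n k i b c = D (k + 1 - c) - D b'"
  using assms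
proof (induction c)
  case (Suc c)
  show ?case
  proof (cases "B_beta n k i < c")
    case True
    then have "{B_beta n k i<..<Suc c} = insert c {B_beta n k i<..<c}" by auto
    then have "B_Gamma n k i b (Suc c) = B_Gamma n k i b c + (b c i - b (c + 1) (i + 1))"
      unfolding B_Gamma_def by simp
    then show ?thesis using Suc True D_diff[of c] by simp
  next
    case False
    then have "{B_beta n k i<..<Suc c} = {}" "Suc c = k - b' + 1" using Suc.prems beta_hi by auto
    then show ?thesis using beta_hi by (simp add: B_Gamma_def)
  qed
qed simp

lemma argmin_iff:
  "c \<in> B_argmin n k i b \<longleftrightarrow> k - b' < c \<and> c \<le> k + 1 - a \<and> (\<forall>p\<in>{a..b'}. D (k + 1 - c) \<le> D p)"
proof (cases "k - b' < c \<and> c \<le> k + 1 - a")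
  case True
  have "(\<forall>c'\<in>{B_beta n k i<..B_gamma k i}. B_Gamma n k i b c \<le> B_Gamma n k i b c') \<longleftrightarrow>
      (\<forall>c'\<in>{k - b'<..k + 1 - a}. D (k + 1 - c) \<le> D (k + 1 - c'))"
    unfolding beta_hi(1)[symmetric] gamma_lo(1)[symmetric]
    using True Gamma_D by (auto simp: beta_hi(1) gamma_lo(1))
  also have "\<dots> \<longleftrightarrow> (\<forall>p\<in>(\<lambda>c'. k + 1 - c') ` {k - b'<..k + 1 - a}. D (k + 1 - c) \<le> D p)"
    by auto
  also have "(\<lambda>c'. k + 1 - c') ` {k - b'<..k + 1 - a} = {a..b'}"
  proof (intro equalityI subsetI)
    fix p assume "p \<in> {a..b'}"
    then show "p \<in> (\<lambda>c'. k + 1 - c') ` {k - b'<..k + 1 - a}"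
      using beta_hi gamma_lo by (intro image_eqI[of _ _ "k + 1 - p"]) auto
  qed (use beta_hi gamma_lo in auto)
  finally show ?thesis using True by (simp add: B_argmin_def beta_hi(1) gamma_lo(1))
qed (auto simp: B_argmin_def beta_hi gamma_lo)

lemma finite_argmin: "finite (B_argmin n k i b)"
  by (simp add: B_argmin_def)

lemma argmin_nonempty: "B_argmin n k i b \<noteq> {}"
proof -
  have "{a..b'} \<noteq> {}" using a_le_b' by simp
  then have "Min (D ` {a..b'}) \<in> D ` {a..b'}" by (intro Min_in) auto
  then obtain l where l: "l \<in> {a..b'}" "Min (D ` {a..b'}) = D l" by blast
  have "D l \<le> D p" if "p \<in> {a..b'}" for p
    using that unfolding l(2)[symmetric] by (intro Min_le) auto
  then have "k + 1 - l \<in> B_argmin n k i b"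
    using l(1) beta_hi gamma_lo unfolding argmin_iff by auto
  then show ?thesis by blast
qed

text \<open>The correspondence \<open>l = k + 1 - c\<close> reverses the order, so the smallest
  minimizing \<open>c\<close> belongs to the largest minimizer of \<open>D\<close>; hence the strict
  inequality for \<open>p > l\<close>.\<close>

lemma Min_argmin:
  obtains l where "Min (B_argmin n k i b) = k + 1 - l" "a \<le> l" "l \<le> b'"
    "\<And>p. p \<in> {a..b'} \<Longrightarrow> D l \<le> D p" "\<And>p. p \<in> {a..b'} \<Longrightarrow> l < p \<Longrightarrow> D l < D p"
proof
  let ?c = "Min (B_argmin n k i b)" and ?l = "k + 1 - Min (B_argmin n k i b)"
  have c: "?c \<in> B_argmin n k i b" using finite_argmin argmin_nonempty by (rule Min_in)
  then have c': "k - b' < ?c" "?c \<le> k + 1 - a" "\<forall>p\<in>{a..b'}. D ?l \<le> D p"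
    unfolding argmin_iff by auto
  show "?c = k + 1 - ?l" "a \<le> ?l" "?l \<le> b'" using c' beta_hi gamma_lo by auto
  show le: "D ?l \<le> D p" if "p \<in> {a..b'}" for p using c' that by blast
  show "D ?l < D p" if "p \<in> {a..b'}" "?l < p" for p
  proof (rule ccontr)
    assume "\<not> D ?l < D p"
    then have "D p = D ?l" using le[OF that(1)] by simp
    then have "k + 1 - p \<in> B_argmin n k i b"
      using that beta_hi gamma_lo le unfolding argmin_iff by auto
    then have "?c \<le> k + 1 - p" using finite_argmin by (intro Min_le)
    then show False using that beta_hi c' by auto
  qed
qed

lemma Max_argmin:
  obtains l where "Max (B_argmin n k i b) = k + 1 - l" "a \<le> l" "l \<le> b'"
    "\<And>p. p \<in> {a..b'} \<Longrightarrow> D l \<le> D p" "\<And>p. p \<in> {a..b'} \<Longrightarrow> p < l \<Longrightarrow> D l < D p"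
proof
  let ?c = "Max (B_argmin n k i b)" and ?l = "k + 1 - Max (B_argmin n k i b)"
  have c: "?c \<in> B_argmin n k i b" using finite_argmin argmin_nonempty by (rule Max_in)
  then have c': "k - b' < ?c" "?c \<le> k + 1 - a" "\<forall>p\<in>{a..b'}. D ?l \<le> D p"
    unfolding argmin_iff by auto
  show "?c = k + 1 - ?l" "a \<le> ?l" "?l \<le> b'" using c' beta_hi gamma_lo by auto
  show le: "D ?l \<le> D p" if "p \<in> {a..b'}" for p using c' that by blast
  show "D ?l < D p" if "p \<in> {a..b'}" "p < ?l" for p
  proof (rule ccontr)
    assume "\<not> D ?l < D p"
    then have "D p = D ?l" using le[OF that(1)] by simp
    then have "k + 1 - p \<in> B_argmin n k i b"
      using that beta_hi gamma_lo le unfolding argmin_iff by auto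
    then have "k + 1 - p \<le> ?c" using finite_argmin by (intro Max_ge)
    then show False using that beta_hi c' by auto
  qed
qed

text \<open>The sum in \<open>B_eps\<close> starts one index before those in \<open>B_Gamma\<close>.
  This extra term compensates the constant \<open>D b'\<close> in \<open>Gamma_D\<close>.\<close>

lemma D_hi: "b (B_beta n k i + 1) (i + 1) - b (B_beta n k i) i = - D b'"
proof -
  have "b (B_beta n k i + 1) (i + 1) = x (b', i + 1) - x (b', i)"
    unfolding b_def using i nk x beta_hi
    by (subst Omega_cochars) (auto simp: B_beta_def)
  moreover have "b (B_beta n k i) i = - x (b' + 1, i - 1)"
  proof (cases "B_beta n k i = 0")
    case True
    then have "b' = k" using beta_hi by simp
    then show ?thesis using True x_outside[of "(k + 1, i - 1)"] by (simp add: b_def Omega_def S1_def)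
  next
    case False
    then have \<beta>: "1 \<le> B_beta n k i" "i = B_beta n k i + (n + 1 - k)" "B_beta n k i \<le> k"
      by (auto simp: B_beta_def) (use i in linarith)
    have l: "k + 1 - B_beta n k i = b' + 1" using beta_hi by simp
    \<comment> \<open>Here \<open>i\<close> is the last position of row \<open>B_beta n k i\<close>,
      which lies one step beyond \<open>S1\<close>.\<close>
    have "x (b' + 1, i) = 0"
      using \<beta> beta_hi nk by (intro x_outside) (auto simp: S1_def)
    moreover have "b (B_beta n k i) i = x (b' + 1, i) - x (b' + 1, i - 1)"
      unfolding b_def l[symmetric] using \<beta> x nk by (intro Omega_cochars) auto
    ultimately show ?thesis by simp
  qed
  moreover have "D b' = x (b', i) - (x (b' + 1, i - 1) + x (b', i + 1))"
    unfolding D_def D_trop_def b'_def[symmetric] by simp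
  ultimately show ?thesis by simp
qed

lemma eps_pos: "B_eps n k i b = UD_fun (S1 n k) (geom_eps n k i) x"
proof -
  obtain l where l: "Min (B_argmin n k i b) = k + 1 - l" "a \<le> l" "l \<le> b'"
    "\<And>p. p \<in> {a..b'} \<Longrightarrow> D l \<le> D p" "\<And>p. p \<in> {a..b'} \<Longrightarrow> l < p \<Longrightarrow> D l < D p"
    using Min_argmin by blast
  have c: "B_beta n k i < k + 1 - l" "k + 1 - l \<le> B_gamma k i" "k + 1 - (k + 1 - l) = l"
    using l beta_hi gamma_lo by auto
  have I: "{B_beta n k i..<k + 1 - l} = insert (B_beta n k i) {B_beta n k i<..<k + 1 - l}"
    using c by auto
  have "B_eps n k i b = (b (B_beta n k i + 1) (i + 1) - b (B_beta n k i) i) - B_Gamma n k i b (k + 1 - l)"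
    using i unfolding B_eps_def l(1) I B_Gamma_def by (simp add: sum_subtractf)
  also have "\<dots> = - D l" unfolding D_hi using Gamma_D[OF c(1,2)] c(3) by simp
  also have "\<dots> = Max ((\<lambda>l. - D l) ` {a..b'})"
    using l by (intro Max_eqI[symmetric]) auto
  finally show ?thesis using UD_fun_pos(2)[OF i nk x] by (simp add: D_def a_def b'_def)
qed

text \<open>The terms with \<open>j < B_gamma k i\<close> telescope to \<open>D a - D l\<close>. The
  last term supplies the coordinates by which the weight differs from \<open>D a\<close>.\<close>

lemma phi_pos:
  "B_phi n k i b = UD_fun (S1 n k) (geom_eps n k i) x + UD_fun (S1 n k) (geom_gamma n k i) x"
proof -
  obtain l where l: "Max (B_argmin n k i b) = k + 1 - l" "a \<le> l" "l \<le> b'"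
    "\<And>p. p \<in> {a..b'} \<Longrightarrow> D l \<le> D p" "\<And>p. p \<in> {a..b'} \<Longrightarrow> p < l \<Longrightarrow> D l < D p"
    using Max_argmin by blast
  let ?g = "B_gamma k i" and ?f = "\<lambda>j. b j i - b (j + 1) (i + 1)"
  have c: "B_beta n k i < k + 1 - l" "k + 1 - l \<le> ?g" "k + 1 - (k + 1 - l) = l" "B_beta n k i < ?g"
    using l beta_hi gamma_lo by auto
  have g: "k + 1 - ?g = a" using gamma_lo by simp
  have "{B_beta n k i<..<?g} = {B_beta n k i<..<k + 1 - l} \<union> {k + 1 - l..<?g}"
    using c by auto
  then have "B_Gamma n k i b ?g = B_Gamma n k i b (k + 1 - l) + sum ?f {k + 1 - l..<?g}"
    unfolding B_Gamma_def by (metis (no_types, lifting) finite_atLeastLessThan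
        finite_greaterThanLessThan greaterThanLessThan_iff atLeastLessThan_iff disjoint_iff leD
        sum.union_disjoint)
  then have s: "sum ?f {k + 1 - l..<?g} = D a - D l"
    using Gamma_D[OF c(1,2)] Gamma_D[OF c(4)] c(3) g by simp
  have I: "{k + 1 - l..?g} = insert ?g {k + 1 - l..<?g}" using c by auto
  have "B_phi n k i b = (b ?g i - b (?g + 1) (i + 1)) + (D a - D l)"
    using i unfolding B_phi_def l(1) I s[symmetric] by simp
  also have "b ?g i = x (a, i) - x (a, i - 1)"
    unfolding b_def g[symmetric] using i nk x by (intro Omega_cochars) (auto simp: B_gamma_def)
  \<comment> \<open>For \<open>i < k\<close> the row after \<open>B_gamma k i\<close> begins exactly
    at \<open>i + 1\<close>. Otherwise that row does not exist, and both sides are 0.\<close>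
  also have "b (?g + 1) (i + 1) = x (a - 1, i + 1)"
  proof (cases "i < k")
    case True
    then have a': "k + 1 - (?g + 1) = a - 1" "a = k + 1 - i" "?g = i" by (auto simp: B_gamma_def a_def lo_def)
    have "x (a - 1, i) = 0" using True a' by (intro x_outside) (auto simp: S1_def)
    moreover have "b (?g + 1) (i + 1) = x (a - 1, i + 1) - x (a - 1, i + 1 - 1)"
      unfolding b_def a'(1)[symmetric] using True i nk x a' by (intro Omega_cochars) auto
    ultimately show ?thesis by simp
  next
    case False
    then have "a = 1" "?g = k" by (auto simp: B_gamma_def a_def lo_def)
    then show ?thesis using x_outside[of "(0, i + 1)"] by (simp add: b_def Omega_def S1_def)
  qed
  finally have "B_phi n k i b = x (a, i) - x (a, i - 1) - x (a - 1, i + 1) + (D a - D l)" .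
  moreover have "- D l = Max ((\<lambda>l. - D l) ` {a..b'})"
    using l by (intro Max_eqI[symmetric]) auto
  ultimately show ?thesis
    using UD_fun_pos[OF i nk x] by (simp add: D_def a_def b'_def)
qed

lemma l_S1: "a \<le> l \<Longrightarrow> l \<le> b' \<Longrightarrow> (l, i) \<in> S1 n k"
  using i nk by (auto simp: a_def b'_def lo_def hi_def S1_def)

lemma e_pos: "Omega n k (UD_action (S1 n k) (geom_e n k i) 1 x) = B_e n k i b"
proof -
  obtain l0 where l: "Min (B_argmin n k i b) = k + 1 - l0" "a \<le> l0" "l0 \<le> b'"
    "\<And>p. p \<in> {a..b'} \<Longrightarrow> D l0 \<le> D p" "\<And>p. p \<in> {a..b'} \<Longrightarrow> l0 < p \<Longrightarrow> D l0 < D p"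
    using Min_argmin by blast
  \<comment> \<open>Raising the terms with \<open>p \<ge> l\<close> by 1 raises the maximum exactly
    if some minimizer of \<open>D\<close> is at least \<open>l\<close>, that is, if the largest one
    is. The difference between \<open>l\<close> and \<open>l + 1\<close> then singles out
    \<open>l = l0\<close>.\<close>
  have M: "Max ((\<lambda>p. (if p < l then 0 else 1) - D p) ` {a..b'}) = - D l0 + of_bool (l \<le> l0)" for l
  proof (rule Max_eqI)
    show "- D l0 + of_bool (l \<le> l0) \<in> (\<lambda>p. (if p < l then 0 else 1) - D p) ` {a..b'}"
      using l by (intro image_eqI[of _ _ l0]) auto
    fix y assume "y \<in> (\<lambda>p. (if p < l then 0 else 1) - D p) ` {a..b'}"
    then obtain p where p: "y = (if p < l then 0 else 1) - D p" "p \<in> {a..b'}" by blast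
    show "y \<le> - D l0 + of_bool (l \<le> l0)"
      using p(1) l(4)[OF p(2)] l(5)[OF p(2)] by (cases "l \<le> l0") (auto split: if_splits)
  qed simp
  have "UD_action (S1 n k) (geom_e n k i) 1 x = (\<lambda>v. x v + of_bool (v = (l0, i)))"
  proof
    fix v :: "nat \<times> nat"
    obtain p q where v: "v = (p, q)" by (cases v)
    show "UD_action (S1 n k) (geom_e n k i) 1 x v = x v + of_bool (v = (l0, i))"
      using l_S1[OF l(2,3)] unfolding UD_action_pos[OF i nk x] v
      by (auto simp: M[unfolded D_def] a_def[symmetric] b'_def[symmetric])
  qed
  moreover have "\<And>p q. Omega n k (\<lambda>v. x v + of_bool (v = (l0, i))) p q = B_e n k i b p q"
  proof -
    fix p q
    let ?c = "k + 1 - l0"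
    have l0: "1 \<le> l0" "l0 \<le> k" "k < l0 + i" "l0 + i \<le> n + 1" using l_S1[OF l(2,3)] by (auto simp: S1_def)
    have "B_e n k i b p q = b p q - of_bool (p = ?c \<and> q = i + 1) + of_bool (p = ?c \<and> q = i)"
      using i unfolding B_e_def l(1) by (simp add: Let_def)
    also have "\<dots> = Omega n k (\<lambda>v. x v + of_bool (v = (l0, i))) p q"
    proof (cases "1 \<le> p \<and> p \<le> k \<and> p \<le> q \<and> q \<le> p + (n + 1 - k)")
      case True
      then have "(k + 1 - p = l0) = (p = ?c)" "(q - 1 = i) = (q = i + 1)" using l0 i by auto
      then show ?thesis unfolding b_def Omega_def Let_def using True by simp
    next
      case False
      then have "\<not> (p = ?c \<and> q = i + 1)" "\<not> (p = ?c \<and> q = i)" using l0 i nk by auto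
      then show ?thesis using False Omega_outside[OF False] unfolding b_def by simp
    qed
    finally show "Omega n k (\<lambda>v. x v + of_bool (v = (l0, i))) p q = B_e n k i b p q" by simp
  qed
  ultimately show ?thesis by (simp only:) (intro ext)
qed

lemma f_pos: "Omega n k (UD_action (S1 n k) (geom_e n k i) (- 1) x) = B_f n k i b"
proof -
  obtain l0 where l: "Max (B_argmin n k i b) = k + 1 - l0" "a \<le> l0" "l0 \<le> b'"
    "\<And>p. p \<in> {a..b'} \<Longrightarrow> D l0 \<le> D p" "\<And>p. p \<in> {a..b'} \<Longrightarrow> p < l0 \<Longrightarrow> D l0 < D p"
    using Max_argmin by blast
  \<comment> \<open>Lowering the terms with \<open>p \<ge> l\<close> lowers the maximum exactly if
    all minimizers of \<open>D\<close> are at least \<open>l\<close>, so now the smallest one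
    counts.\<close>
  have M: "Max ((\<lambda>p. (if p < l then 0 else - 1) - D p) ` {a..b'}) = - D l0 - of_bool (l \<le> l0)" for l
  proof (rule Max_eqI)
    show "- D l0 - of_bool (l \<le> l0) \<in> (\<lambda>p. (if p < l then 0 else - 1) - D p) ` {a..b'}"
      using l by (intro image_eqI[of _ _ l0]) auto
    fix y assume "y \<in> (\<lambda>p. (if p < l then 0 else - 1) - D p) ` {a..b'}"
    then obtain p where p: "y = (if p < l then 0 else - 1) - D p" "p \<in> {a..b'}" by blast
    show "y \<le> - D l0 - of_bool (l \<le> l0)"
      using p(1) l(4)[OF p(2)] l(5)[OF p(2)] by (cases "l \<le> l0") (auto split: if_splits)
  qed simp
  have "UD_action (S1 n k) (geom_e n k i) (- 1) x = (\<lambda>v. x v - of_bool (v = (l0, i)))"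
  proof
    fix v :: "nat \<times> nat"
    obtain p q where v: "v = (p, q)" by (cases v)
    show "UD_action (S1 n k) (geom_e n k i) (- 1) x v = x v - of_bool (v = (l0, i))"
      using l_S1[OF l(2,3)] unfolding UD_action_pos[OF i nk x] v
      by (auto simp: M[unfolded D_def] a_def[symmetric] b'_def[symmetric])
  qed
  moreover have "\<And>p q. Omega n k (\<lambda>v. x v - of_bool (v = (l0, i))) p q = B_f n k i b p q"
  proof -
    fix p q
    let ?c = "k + 1 - l0"
    have l0: "1 \<le> l0" "l0 \<le> k" "k < l0 + i" "l0 + i \<le> n + 1" using l_S1[OF l(2,3)] by (auto simp: S1_def)
    have "B_f n k i b p q = b p q - of_bool (p = ?c \<and> q = i) + of_bool (p = ?c \<and> q = i + 1)"
      using i unfolding B_f_def l(1) by (simp add: Let_def)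
    also have "\<dots> = Omega n k (\<lambda>v. x v - of_bool (v = (l0, i))) p q"
    proof (cases "1 \<le> p \<and> p \<le> k \<and> p \<le> q \<and> q \<le> p + (n + 1 - k)")
      case True
      then have "(k + 1 - p = l0) = (p = ?c)" "(q - 1 = i) = (q = i + 1)" using l0 i by auto
      then show ?thesis unfolding b_def Omega_def Let_def using True by simp
    next
      case False
      then have "\<not> (p = ?c \<and> q = i + 1)" "\<not> (p = ?c \<and> q = i)" using l0 i nk by auto
      then show ?thesis using False Omega_outside[OF False] unfolding b_def by simp
    qed
    finally show "Omega n k (\<lambda>v. x v - of_bool (v = (l0, i))) p q = B_f n k i b p q" by simp
  qed
  ultimately show ?thesis by (simp only:) (intro ext)
qed

end

section \<open>The crystal structure for index 0\<close>

text \<open>An element \<open>c\<close> of \<open>C\<close> is encoded by the monotone lattice path whose value at \<open>m\<close> is the number of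
  entries of \<open>c\<close> that are at most \<open>m\<close>; on \<open>[c ! (j - 1), c ! j)\<close> the path has the value \<open>j\<close>.\<close>

definition lattice_path :: "nat \<Rightarrow> nat \<Rightarrow> (nat \<Rightarrow> nat) \<Rightarrow> bool" where
  "lattice_path n k J \<longleftrightarrow> J 0 = 0 \<and> J 1 = 1 \<and> J n = k \<and> J (n + 1) = k + 1 \<and>
     (\<forall>m\<le>n. J (m + 1) = J m \<or> J (m + 1) = J m + 1)"

definition path_of :: "nat \<Rightarrow> nat list \<Rightarrow> nat \<Rightarrow> nat" where
  "path_of k c m = card {j. j \<le> k \<and> c ! j \<le> m}"

text \<open>The inverse encoding: as \<open>J\<close> is monotone, the count is the first
  \<open>m\<close> with \<open>J m > j\<close>, so entry \<open>j\<close> is the place where the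
  path reaches \<open>j + 1\<close>.\<close>

definition list_of_path :: "nat \<Rightarrow> nat \<Rightarrow> (nat \<Rightarrow> nat) \<Rightarrow> nat list" where
  "list_of_path n k J = map (\<lambda>j. card {m. m \<le> n \<and> J m \<le> j}) [0..<k + 1]"

section \<open>The set C, its order and the function Delta in terms of lattice paths\<close>

lemma down_closed_eq_lessThan_card:
  fixes A :: "nat set"
  assumes "finite A" "\<And>i j. j \<in> A \<Longrightarrow> i < j \<Longrightarrow> i \<in> A"
  shows "A = {..<card A}"
proof -
  have "A = {..<Suc (Max A)}" if "A \<noteq> {}"
  proof (intro set_eqI iffI)
    fix i assume "i \<in> {..<Suc (Max A)}"
    then have "i = Max A \<or> i < Max A" by auto
    then show "i \<in> A" using Max_in[OF assms(1) that] assms(2) by blast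
  next
    fix i assume "i \<in> A"
    then show "i \<in> {..<Suc (Max A)}" using Max_ge[OF assms(1)] by (simp add: less_Suc_eq_le)
  qed
  then show ?thesis by (cases "A = {}") (simp, metis card_lessThan)
qed

lemma lattice_path_mono:
  assumes "lattice_path n k J" "i \<le> m" "m \<le> n + 1"
  shows "J i \<le> J m"
  using assms(2,3)
proof (induction m rule: dec_induct)
  case (step m)
  then have "J (m + 1) = J m \<or> J (m + 1) = J m + 1" using assms(1) by (simp add: lattice_path_def)
  then show ?case using step by auto
qed simp

lemma lattice_path_add:
  assumes "lattice_path n k J" "i \<le> m" "m \<le> n + 1"
  shows "J m \<le> J i + (m - i)"
  using assms(2,3)
proof (induction m rule: dec_induct)
  case (step m)
  then have "J (m + 1) = J m \<or> J (m + 1) = J m + 1" using assms(1) by (simp add: lattice_path_def)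
  then show ?case using step by auto
qed simp

text \<open>A path rises by at most 1 per step, so \<open>J m \<le> m\<close> and
  \<open>k \<le> J m + (n - m)\<close>. These bounds are the two diagonal conditions of
  \<open>S1\<close>.\<close>

lemma lattice_path_S1:
  assumes J: "lattice_path n k J" and m: "1 \<le> m" "m \<le> n"
  shows "1 \<le> J m" "J m \<le> k" "(k + 1 - J m, m) \<in> S1 n k"
proof -
  have *: "J 0 = 0" "J 1 = 1" "J n = k" using J by (auto simp: lattice_path_def)
  show 1: "1 \<le> J m" "J m \<le> k"
    using lattice_path_mono[OF J, of 1 m] lattice_path_mono[OF J, of m n] m * by auto
  have "J m \<le> m" "k \<le> J m + (n - m)"
    using lattice_path_add[OF J, of 0 m] lattice_path_add[OF J, of m n] m * by auto
  then show "(k + 1 - J m, m) \<in> S1 n k" using 1 m by (auto simp: S1_def)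
qed

lemma B_C_less:
  assumes c: "c \<in> B_C n k" and "i < j" "j \<le> k"
  shows "c ! i < c ! j"
  using assms(2,3)
proof (induction j)
  case (Suc j)
  then have "c ! j < c ! Suc j" using c by (auto simp: B_C_def)
  then show ?case using Suc by (cases "i = j") auto
qed simp

text \<open>The entries increase, so those that are at most \<open>m\<close> form an initial
  segment. This adjunction between list and path underlies the translations below.\<close>

lemma path_of_less:
  assumes c: "c \<in> B_C n k" and "j \<le> k"
  shows "c ! j \<le> m \<longleftrightarrow> j < path_of k c m"
proof -
  have "(j \<in> {j. j \<le> k \<and> c ! j \<le> m}) = (j \<in> {..<path_of k c m})"
    unfolding path_of_def
  proof (rule arg_cong[where f = "\<lambda>A. j \<in> A"], rule down_closed_eq_lessThan_card)
    fix i j assume "j \<in> {j. j \<le> k \<and> c ! j \<le> m}" "i < j"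
    then show "i \<in> {j. j \<le> k \<and> c ! j \<le> m}" using B_C_less[OF c, of i j] by auto
  qed simp
  then show ?thesis using assms(2) by simp
qed

lemma path_of_le: "path_of k c m \<le> k + 1"
  unfolding path_of_def using card_mono[of "{..k}" "{j. j \<le> k \<and> c ! j \<le> m}"] by auto

text \<open>By strict increase at most one entry of \<open>c\<close> equals \<open>m + 1\<close>,
  whence the steps have height at most 1.\<close>

lemma lattice_path_path_of:
  assumes c: "c \<in> B_C n k" and k: "1 \<le> k"
  shows "lattice_path n k (path_of k c)"
proof -
  let ?J = "path_of k c"
  have c0: "c ! 0 = 1" "c ! k = n + 1" using c by (auto simp: B_C_def)
  note less = path_of_less[OF c] and le = path_of_le[of k c]
  have "?J 0 = 0" using less[of 0 0] c0 by simp
  moreover have "?J 1 = 1"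
  proof -
    have "c ! 1 > 1" using B_C_less[OF c, of 0 1] k c0 by simp
    then show ?thesis using less[of 0 1] less[of 1 1] k c0 by simp
  qed
  moreover have "?J n = k"
  proof -
    have "c ! (k - 1) < n + 1" using B_C_less[OF c, of "k - 1" k] k c0 by simp
    then show ?thesis using less[of "k - 1" n] less[of k n] k c0 by simp
  qed
  moreover have "?J (n + 1) = k + 1"
    using less[of k "n + 1"] le[of "n + 1"] c0 by simp
  moreover have "?J (m + 1) = ?J m \<or> ?J (m + 1) = ?J m + 1" for m
  proof (cases "?J m \<le> k")
    case True
    let ?j = "?J m"
    have "\<not> c ! ?j \<le> m" using less[OF True, of m] by simp
    then have "?J (m + 1) \<le> ?j + 1"
    proof (cases "?j + 1 \<le> k")
      case True
      then have "c ! (?j + 1) > m + 1"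
        using \<open>\<not> c ! ?j \<le> m\<close> B_C_less[OF c, of ?j "?j + 1"] by simp
      then show ?thesis using less[OF True, of "m + 1"] by simp
    next
      case False
      then show ?thesis using le[of "m + 1"] by simp
    qed
    moreover have "?j \<le> ?J (m + 1)"
    proof (cases "?j = 0")
      case False
      then have "?j - 1 \<le> k" "?j - 1 < ?j" using True by auto
      then have "c ! (?j - 1) \<le> m + 1" using less[of "?j - 1" m] by simp
      then show ?thesis using less[of "?j - 1" "m + 1"] \<open>?j - 1 \<le> k\<close> by simp
    qed simp
    ultimately show ?thesis by linarith
  next
    case False
    then have "?J m = k + 1" using le[of m] by simp
    then have "c ! k \<le> m + 1" using less[of k m] by simp
    then show ?thesis using less[of k "m + 1"] le[of "m + 1"] \<open>?J m = k + 1\<close> by simp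
  qed
  ultimately show ?thesis unfolding lattice_path_def by blast
qed

lemma list_of_path_nth:
  assumes J: "lattice_path n k J" and "j \<le> k" "m \<le> n"
  shows "m < list_of_path n k J ! j \<longleftrightarrow> J m \<le> j"
proof -
  have "list_of_path n k J ! j = card {m. m \<le> n \<and> J m \<le> j}"
    using assms(2) by (simp add: list_of_path_def del: upt_Suc)
  moreover have "(m \<in> {m. m \<le> n \<and> J m \<le> j}) = (m \<in> {..<card {m. m \<le> n \<and> J m \<le> j}})"
  proof (rule arg_cong[where f = "\<lambda>A. m \<in> A"], rule down_closed_eq_lessThan_card)
    fix i m assume "m \<in> {m. m \<le> n \<and> J m \<le> j}" "i < m"
    then show "i \<in> {m. m \<le> n \<and> J m \<le> j}" using lattice_path_mono[OF J, of i m] by auto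
  qed simp
  ultimately show ?thesis using assms(3) by simp
qed

lemma list_of_path_le: "j \<le> k \<Longrightarrow> list_of_path n k J ! j \<le> n + 1"
  unfolding list_of_path_def using card_mono[of "{..n}" "{m. m \<le> n \<and> J m \<le> j}"]
  by (auto simp del: upt_Suc)

lemma list_of_path_B_C:
  assumes J: "lattice_path n k J" and k: "1 \<le> k" "1 \<le> n"
  shows "list_of_path n k J \<in> B_C n k"
proof -
  let ?c = "list_of_path n k J"
  have J0: "J 0 = 0" "J 1 = 1" "J n = k" using J by (auto simp: lattice_path_def)
  note less = list_of_path_nth[OF J]
  have "?c ! 0 = 1" using less[of 0 0] less[of 0 1] J0 k by simp
  moreover have "?c ! k = n + 1" using less[of k n] list_of_path_le[of k k n J] J0 by simp
  moreover have "?c ! j < ?c ! (j + 1)" if "j < k" for j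
  proof -
    let ?m = "?c ! j"
    have m: "1 \<le> ?m" "?m \<le> n" using less[of j 0] less[of j n] J0 that by auto
    have "J (?m - 1) \<le> j" using less[of j "?m - 1"] m that by simp
    moreover have "J (?m - 1 + 1) = J (?m - 1) \<or> J (?m - 1 + 1) = J (?m - 1) + 1"
      using J m by (simp only: lattice_path_def)
    ultimately have "J ?m \<le> j + 1" using m by auto
    then show ?thesis using less[of "j + 1" ?m] m that by simp
  qed
  ultimately show ?thesis by (auto simp: B_C_def list_of_path_def)
qed

lemma path_of_list_of_path:
  assumes J: "lattice_path n k J" and k: "1 \<le> k" "1 \<le> n" and m: "m \<le> n + 1"
  shows "path_of k (list_of_path n k J) m = J m"
proof -
  let ?c = "list_of_path n k J"
  note less = path_of_less[OF list_of_path_B_C[OF J k]]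
  have J0: "J n = k" "J (n + 1) = k + 1" using J by (auto simp: lattice_path_def)
  show ?thesis
  proof (cases "m \<le> n")
    case True
    have eq: "j < path_of k ?c m \<longleftrightarrow> j < J m" if "j \<le> k" for j
      using less[OF that, of m] list_of_path_nth[OF J that True] by auto
    have "J m \<le> k" using lattice_path_mono[OF J, of m n] True J0 by simp
    then have "J m - 1 \<le> k" by simp
    then show ?thesis using eq[OF \<open>J m \<le> k\<close>] eq[of "J m - 1"] by (cases "J m = 0") auto
  next
    case False
    then have "m = n + 1" using m by simp
    then show ?thesis using lattice_path_path_of[OF list_of_path_B_C[OF J k] k(1)] J0
      by (simp add: lattice_path_def)
  qed
qed

text \<open>An index strictly between \<open>c ! (j - 1)\<close> and \<open>c ! j\<close> is an
  \<open>m + 1\<close> at which the path stays at height \<open>j\<close>. The steps at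
  \<open>m = 0\<close> and \<open>m = n\<close> are forced to rise and contribute nothing.\<close>

lemma B_Delta_path:
  assumes c: "c \<in> B_C n k" and k: "1 \<le> k"
  shows "B_Delta k b c =
    (\<Sum>m\<in>{1..<n}. if path_of k c (m + 1) = path_of k c m then b (path_of k c m) (m + 1) else 0)"
proof -
  let ?J = "path_of k c"
  have J: "lattice_path n k ?J" by (rule lattice_path_path_of[OF c k])
  have c0: "c ! 0 = 1" "c ! k = n + 1" using c by (auto simp: B_C_def)
  have inner: "(\<Sum>i\<in>{c ! (j - 1)<..<c ! j}. b j i) =
      (\<Sum>m\<in>{1..<n}. if ?J (m + 1) = j \<and> ?J m = j then b j (m + 1) else 0)" if "j \<in> {1..k}" for j
  proof -
    have lo: "1 \<le> c ! (j - 1)"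
    proof (cases "j - 1 = 0")
      case False
      then have "j - 1 \<le> k" "0 < j - 1" using that by auto
      from B_C_less[OF c this(2,1)] show ?thesis using c0(1) by simp
    qed (use c0(1) in simp)
    have hi: "c ! j \<le> n + 1"
      using that c0(2) B_C_less[OF c, of j k] by (cases "j = k") auto
    have mem: "m + 1 \<in> {c ! (j - 1)<..<c ! j} \<longleftrightarrow> ?J (m + 1) = j \<and> ?J m = j" if m: "m \<le> n" for m
    proof -
      have "c ! (j - 1) \<le> m \<longleftrightarrow> j \<le> ?J m"
      proof -
        have "j - 1 \<le> k" "j - 1 < ?J m \<longleftrightarrow> j \<le> ?J m" using \<open>j \<in> {1..k}\<close> by auto
        then show ?thesis using path_of_less[OF c, of "j - 1" m] by simp
      qed
      moreover have "c ! j \<le> m + 1 \<longleftrightarrow> j < ?J (m + 1)"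
        using path_of_less[OF c, of j "m + 1"] \<open>j \<in> {1..k}\<close> by auto
      moreover have "?J m \<le> ?J (m + 1)" using lattice_path_mono[OF J, of m "m + 1"] m by simp
      ultimately show ?thesis by auto
    qed
    have "{c ! (j - 1)<..<c ! j} = Suc ` {m\<in>{1..<n}. ?J (m + 1) = j \<and> ?J m = j}"
    proof (intro set_eqI iffI)
      fix i assume i: "i \<in> {c ! (j - 1)<..<c ! j}"
      then obtain m where m: "i = Suc m" "1 \<le> m" "m < n" using lo hi by (cases i) auto
      then show "i \<in> Suc ` {m\<in>{1..<n}. ?J (m + 1) = j \<and> ?J m = j}" using i mem[of m] by simp
    next
      fix i assume "i \<in> Suc ` {m\<in>{1..<n}. ?J (m + 1) = j \<and> ?J m = j}"
      then obtain m where "i = m + 1" "m < n" "?J (m + 1) = j \<and> ?J m = j" by auto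
      then show "i \<in> {c ! (j - 1)<..<c ! j}" using mem[of m] by simp
    qed
    then have "(\<Sum>i\<in>{c ! (j - 1)<..<c ! j}. b j i) =
        (\<Sum>m\<in>{m\<in>{1..<n}. ?J (m + 1) = j \<and> ?J m = j}. b j (m + 1))"
      by (simp add: sum.reindex)
    also have "\<dots> = (\<Sum>m\<in>{1..<n}. if ?J (m + 1) = j \<and> ?J m = j then b j (m + 1) else 0)"
      by (rule sum.inter_filter) simp
    finally show ?thesis .
  qed
  have "B_Delta k b c = (\<Sum>j = 1..k. \<Sum>m\<in>{1..<n}. if ?J (m + 1) = j \<and> ?J m = j then b j (m + 1) else 0)"
    unfolding B_Delta_def by (intro sum.cong refl inner)
  also have "\<dots> = (\<Sum>m\<in>{1..<n}. \<Sum>j = 1..k. if ?J (m + 1) = j \<and> ?J m = j then b j (m + 1) else 0)"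
    by (rule sum.swap)
  also have "\<dots> = (\<Sum>m\<in>{1..<n}. if ?J (m + 1) = ?J m then b (?J m) (m + 1) else 0)"
  proof (intro sum.cong refl)
    fix m assume m: "m \<in> {1..<n}"
    then have "?J m \<in> {1..k}" using lattice_path_S1[OF J, of m] by simp
    moreover have "(\<Sum>j = 1..k. if ?J (m + 1) = j \<and> ?J m = j then b j (m + 1) else 0) =
        (\<Sum>j = 1..k. if j = ?J m then (if ?J (m + 1) = ?J m then b (?J m) (m + 1) else 0) else 0)"
      by (intro sum.cong) auto
    ultimately show "(\<Sum>j = 1..k. if ?J (m + 1) = j \<and> ?J m = j then b j (m + 1) else 0) =
        (if ?J (m + 1) = ?J m then b (?J m) (m + 1) else 0)"
      by (simp add: sum.delta)
  qed
  finally show ?thesis .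
qed

text \<open>The encoding reverses the order: a path is higher when its entries come earlier. The
  comparison is assumed only up to \<open>m = n\<close>, so the last entry \<open>n + 1\<close> is
  treated separately.\<close>

lemma C_le_path:
  assumes c: "c \<in> B_C n k" and d: "d \<in> B_C n k" and "1 \<le> k"
    and le: "\<And>m. 1 \<le> m \<Longrightarrow> m \<le> n \<Longrightarrow> path_of k d m \<le> path_of k c m"
  shows "C_le c d"
proof -
  have "c ! j \<le> d ! j" if "j \<le> k" for j
  proof (cases "j = k")
    case True
    then show ?thesis using c d by (simp add: B_C_def)
  next
    case False
    then have j: "d ! j < d ! k" "1 \<le> d ! j"
      using that d B_C_less[OF d, of j k] B_C_less[OF d, of 0 j] by (cases "j = 0"; auto simp: B_C_def)+
    then have "d ! j \<le> n" using d by (simp add: B_C_def)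
    have "j < path_of k d (d ! j)" using path_of_less[OF d that, of "d ! j"] by simp
    also have "\<dots> \<le> path_of k c (d ! j)" using le j \<open>d ! j \<le> n\<close> by simp
    finally show ?thesis using path_of_less[OF c that] by simp
  qed
  then show ?thesis using c d by (auto simp: C_le_def B_C_def list_all2_conv_all_nth)
qed

lemma C_le_antisym: "C_le c d \<Longrightarrow> C_le d c \<Longrightarrow> c = d"
  unfolding C_le_def by (auto simp: list_all2_conv_all_nth intro!: nth_equalityI order_antisym)

text \<open>If one relation failed, one value would be strictly smaller, against the minimality of
  the other. \<open>R\<close> is arbitrary because both the order on C and its reverse are
  needed.\<close>

lemma extremal_unique:
  fixes f :: "'a \<Rightarrow> int"
  assumes "c \<in> C \<and> (\<forall>d\<in>C. (R c d \<longrightarrow> f c \<le> f d) \<and> (\<not> R c d \<longrightarrow> f c < f d))"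
    and "c' \<in> C \<and> (\<forall>d\<in>C. (R c' d \<longrightarrow> f c' \<le> f d) \<and> (\<not> R c' d \<longrightarrow> f c' < f d))"
  shows "R c c' \<and> R c' c"
proof -
  have "(R c c' \<longrightarrow> f c \<le> f c') \<and> (\<not> R c c' \<longrightarrow> f c < f c')"
    "(R c' c \<longrightarrow> f c' \<le> f c) \<and> (\<not> R c' c \<longrightarrow> f c' < f c)" using assms by blast+
  then show ?thesis by linarith
qed

text \<open>Reduced costs with respect to the potential \<open>X_trop\<close> are nonpositive, and a path is optimal
  exactly when all its steps have reduced cost 0.\<close>

context
  fixes n k :: nat and x :: "nat \<times> nat \<Rightarrow> int" and b X
  assumes nk: "2 \<le> n" "1 \<le> k" "k \<le> n" and x: "x \<in> cochars (S1 n k)"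
  defines "b \<equiv> Omega n k x" and "X \<equiv> X_trop n x"
begin

text \<open>\<open>stays\<close> and \<open>drops\<close> tell which step out of
  \<open>(l, m)\<close> attains the maximum in \<open>X\<close>; in a tie both hold. On the diagonal
  \<open>l + m = n + 1\<close> only \<open>drops\<close> can hold, with the value 0 on both
  sides.\<close>

definition stays :: "nat \<Rightarrow> nat \<Rightarrow> bool" where
  "stays l m \<longleftrightarrow> l + m \<le> n \<and> X l m = x (l, m) - x (l, m + 1) + X l (m + 1)"

definition drops :: "nat \<Rightarrow> nat \<Rightarrow> bool" where
  "drops l m \<longleftrightarrow> 2 \<le> l \<and> X l m = X (l - 1) (m + 1)"

section \<open>Reduced costs and the minimum of Delta\<close>

lemma X_diag: "n < l + m \<Longrightarrow> X l m = 0"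
  unfolding X_def by (subst X_trop.simps) simp

lemma X_one: "l + m \<le> n \<Longrightarrow> l < 2 \<Longrightarrow> X l m = x (l, m) - x (l, m + 1) + X l (m + 1)"
  unfolding X_def by (subst X_trop.simps) simp

lemma X_max:
  "l + m \<le> n \<Longrightarrow> 2 \<le> l \<Longrightarrow> X l m = max (x (l, m) - x (l, m + 1) + X l (m + 1)) (X (l - 1) (m + 1))"
  unfolding X_def by (subst X_trop.simps) simp

lemma stays_or_drops: "(l, m) \<in> S1 n k \<Longrightarrow> m < n \<Longrightarrow> stays l m \<or> drops l m"
proof -
  assume S: "(l, m) \<in> S1 n k" "m < n"
  consider "l + m \<le> n" "l < 2" | "l + m \<le> n" "2 \<le> l" | "n < l + m" "2 \<le> l"
    using S by linarith
  then show ?thesis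
  proof cases
    case 3
    then have "X l m = 0" "X (l - 1) (m + 1) = 0" by (auto intro: X_diag)
    then show ?thesis using 3 by (simp add: drops_def)
  qed (auto simp: stays_def drops_def X_one X_max max_def)
qed

text \<open>Height \<open>J m\<close> corresponds to the row \<open>l = k + 1 - J m\<close>, so a
  rise of the lattice path is a drop of \<open>l\<close>.\<close>

definition reduced_cost :: "(nat \<Rightarrow> nat) \<Rightarrow> nat \<Rightarrow> int" where
  "reduced_cost J m = (let l = k + 1 - J m in
     (if J (m + 1) = J m then x (l, m) - x (l, m + 1) + X l (m + 1) else X (l - 1) (m + 1)) - X l m)"

text \<open>Keeping \<open>l\<close> on the diagonal \<open>l + m = n + 1\<close>, or dropping from
  \<open>l = 1\<close>, would lead out of \<open>S1\<close>, which is excluded by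
  \<open>lattice_path_S1\<close> at \<open>m + 1\<close>.\<close>

lemma path_step:
  assumes J: "lattice_path n k J" and m: "1 \<le> m" "m < n"
  shows "J (m + 1) = J m \<and> k + 1 - J m + m \<le> n \<or>
    J (m + 1) = J m + 1 \<and> k + 1 - J (m + 1) = k + 1 - J m - 1 \<and> 2 \<le> k + 1 - J m"
proof -
  have "J (m + 1) = J m \<or> J (m + 1) = J m + 1" using J m by (simp add: lattice_path_def)
  then show ?thesis
    using lattice_path_S1[OF J, of m] lattice_path_S1[OF J, of "m + 1"] m by (auto simp: S1_def)
qed

lemma reduced_cost_nonpos:
  assumes J: "lattice_path n k J" and m: "1 \<le> m" "m < n"
  shows "reduced_cost J m \<le> 0"
    and "reduced_cost J m = 0 \<longleftrightarrow>
      (if J (m + 1) = J m then stays (k + 1 - J m) m else drops (k + 1 - J m) m)"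
proof -
  let ?l = "k + 1 - J m"
  have S: "(?l, m) \<in> S1 n k" using lattice_path_S1[OF J, of m] m by simp
  have *: "reduced_cost J m \<le> 0 \<and> (reduced_cost J m = 0 \<longleftrightarrow>
      (if J (m + 1) = J m then stays ?l m else drops ?l m))"
    using path_step[OF J m]
  proof (elim disjE conjE)
    assume *: "J (m + 1) = J m" "?l + m \<le> n"
    then show ?thesis
      using X_one[of ?l m] X_max[of ?l m]
      by (cases "2 \<le> ?l") (auto simp: reduced_cost_def Let_def stays_def)
  next
    assume *: "J (m + 1) = J m + 1" "2 \<le> ?l"
    then show ?thesis
      using X_max[of ?l m] X_diag[of ?l m] X_diag[of "?l - 1" "m + 1"]
      by (cases "?l + m \<le> n") (auto simp: reduced_cost_def Let_def drops_def)
  qed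
  then show "reduced_cost J m \<le> 0"
    "reduced_cost J m = 0 \<longleftrightarrow> (if J (m + 1) = J m then stays ?l m else drops ?l m)" by auto
qed

text \<open>The entries of \<open>b\<close> are the negatives of the tropical step weights, so Delta
  is minus the weight of the path. The potentials telescope from \<open>X k 1\<close> at
  \<open>(k, 1)\<close> to 0 at \<open>(1, n)\<close>.\<close>

lemma Delta_reduced_cost:
  assumes c: "c \<in> B_C n k"
  shows "B_Delta k b c = - X k 1 - (\<Sum>m\<in>{1..<n}. reduced_cost (path_of k c) m)"
proof -
  let ?J = "path_of k c"
  have J: "lattice_path n k ?J" using c nk by (intro lattice_path_path_of) auto
  let ?p = "\<lambda>m. X (k + 1 - ?J m) m"
  have "(if ?J (m + 1) = ?J m then b (?J m) (m + 1) else 0) =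
      (?p (m + 1) - ?p m) - reduced_cost ?J m" if "m \<in> {1..<n}" for m
  proof -
    have m: "1 \<le> m" "m < n" using that by auto
    have "(k + 1 - ?J m, m) \<in> S1 n k" "1 \<le> ?J m" "?J m \<le> k" using lattice_path_S1[OF J, of m] m by auto
    then have "b (?J m) (m + 1) = x (k + 1 - ?J m, m + 1) - x (k + 1 - ?J m, m)"
      unfolding b_def using Omega_cochars[OF x, of "?J m" "m + 1"] by (auto simp: S1_def)
    then show ?thesis using path_step[OF J m] by (auto simp: reduced_cost_def Let_def)
  qed
  then have "B_Delta k b c = (\<Sum>m\<in>{1..<n}. (?p (m + 1) - ?p m) - reduced_cost ?J m)"
    unfolding B_Delta_path[OF c nk(2)] by (intro sum.cong refl)
  also have "\<dots> = (\<Sum>m = 1..<n. ?p (Suc m) - ?p m) - (\<Sum>m\<in>{1..<n}. reduced_cost ?J m)"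
    by (simp add: sum_subtractf)
  also have "(\<Sum>m = 1..<n. ?p (Suc m) - ?p m) = ?p n - ?p 1"
    using nk by (intro sum_Suc_diff') simp
  also have "?p n = 0" using J nk by (intro X_diag) (auto simp: lattice_path_def)
  also have "?p 1 = X k 1" using J by (simp add: lattice_path_def)
  finally show ?thesis by simp
qed

lemma Delta_ge:
  assumes c: "c \<in> B_C n k"
  shows "- X k 1 \<le> B_Delta k b c"
    and "B_Delta k b c = - X k 1 \<longleftrightarrow> (\<forall>m\<in>{1..<n}. reduced_cost (path_of k c) m = 0)"
proof -
  have J: "lattice_path n k (path_of k c)" using c nk by (intro lattice_path_path_of) auto
  have np: "\<And>m. m \<in> {1..<n} \<Longrightarrow> reduced_cost (path_of k c) m \<le> 0"
    using reduced_cost_nonpos(1)[OF J] by simp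
  show "- X k 1 \<le> B_Delta k b c"
    unfolding Delta_reduced_cost[OF c]
    using sum_nonpos[of "{1..<n}" "reduced_cost (path_of k c)"] np by simp
  show "B_Delta k b c = - X k 1 \<longleftrightarrow> (\<forall>m\<in>{1..<n}. reduced_cost (path_of k c) m = 0)"
    unfolding Delta_reduced_cost[OF c] using np
      sum_nonneg_eq_0_iff[of "{1..<n}" "\<lambda>m. - reduced_cost (path_of k c) m"] by (simp add: sum_negf)
qed

section \<open>Greedy optimal paths and the extremal minimizers of Delta\<close>

primrec choice_path :: "(nat \<Rightarrow> nat \<Rightarrow> bool) \<Rightarrow> nat \<Rightarrow> nat" where
  "choice_path D 0 = 0"
| "choice_path D (Suc m) =
     (if m = 0 \<or> n \<le> m \<or> D (k + 1 - choice_path D m) m then Suc (choice_path D m) else choice_path D m)"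

text \<open>\<open>D l m\<close> is the decision to drop at \<open>(l, m)\<close>. It must follow a
  step that attains \<open>X\<close>, which leaves only the freedom to break ties.\<close>

definition optimal_choice :: "(nat \<Rightarrow> nat \<Rightarrow> bool) \<Rightarrow> bool" where
  "optimal_choice D \<longleftrightarrow> (\<forall>(l, m)\<in>S1 n k. m < n \<longrightarrow> (if D l m then drops l m else stays l m))"

lemma choice_path_S1:
  assumes D: "optimal_choice D" and m: "1 \<le> m" "m \<le> n"
  shows "1 \<le> choice_path D m \<and> choice_path D m \<le> k \<and> (k + 1 - choice_path D m, m) \<in> S1 n k"
  using m
proof (induction m rule: dec_induct)
  case base
  then show ?case using nk by (simp add: S1_def)
next
  case (step m)
  let ?l = "k + 1 - choice_path D m"
  have IH: "1 \<le> choice_path D m" "choice_path D m \<le> k" "(?l, m) \<in> S1 n k" and m: "1 \<le> m" "m < n"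
    using step by auto
  have d: "if D ?l m then drops ?l m else stays ?l m"
    using D IH m unfolding optimal_choice_def by blast
  show ?case
  proof (cases "D ?l m")
    case True
    then have "2 \<le> ?l" using d by (simp add: drops_def)
    then show ?thesis using True IH m by (auto simp: S1_def)
  next
    case False
    then have "?l + m \<le> n" using d by (simp add: stays_def)
    then show ?thesis using False IH m by (auto simp: S1_def)
  qed
qed

lemma choice_path_lattice:
  assumes D: "optimal_choice D"
  shows "lattice_path n k (choice_path D)"
proof -
  have "choice_path D n = k" using choice_path_S1[OF D, of n] nk by (auto simp: S1_def)
  then show ?thesis using nk by (simp add: lattice_path_def)
qed

lemma choice_path_optimal:
  assumes D: "optimal_choice D" and m: "1 \<le> m" "m < n"
  shows "reduced_cost (choice_path D) m = 0"
proof -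
  let ?l = "k + 1 - choice_path D m"
  have "(?l, m) \<in> S1 n k" using choice_path_S1[OF D, of m] m by simp
  then have "if D ?l m then drops ?l m else stays ?l m"
    using D m unfolding optimal_choice_def by blast
  then show ?thesis
    using m unfolding reduced_cost_nonpos(2)[OF choice_path_lattice[OF D] m] by auto
qed

definition choice_list :: "(nat \<Rightarrow> nat \<Rightarrow> bool) \<Rightarrow> nat list" where
  "choice_list D = list_of_path n k (choice_path D)"

lemma choice_list:
  assumes D: "optimal_choice D"
  shows "choice_list D \<in> B_C n k" "m \<le> n + 1 \<Longrightarrow> path_of k (choice_list D) m = choice_path D m"
    "B_Delta k b (choice_list D) = - X k 1"
proof -
  note J = choice_path_lattice[OF D]
  show C: "choice_list D \<in> B_C n k"
    unfolding choice_list_def using nk by (intro list_of_path_B_C[OF J]) auto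
  show P: "path_of k (choice_list D) m = choice_path D m" if "m \<le> n + 1" for m
    unfolding choice_list_def using nk that by (intro path_of_list_of_path[OF J]) auto
  show "B_Delta k b (choice_list D) = - X k 1"
    unfolding Delta_ge(2)[OF C] using choice_path_optimal[OF D] P by (auto simp: reduced_cost_def)
qed

text \<open>The two ways of breaking ties. Dropping whenever that is optimal gives the highest
  optimal path, hence the smallest minimizing list; dropping only when staying is not optimal gives
  the lowest path, hence the largest list.\<close>

definition drop_first :: "nat \<Rightarrow> nat \<Rightarrow> bool" where "drop_first = drops"
definition stay_first :: "nat \<Rightarrow> nat \<Rightarrow> bool" where "stay_first l m \<longleftrightarrow> \<not> stays l m"

lemma drop_first: "optimal_choice drop_first"
  using stays_or_drops by (auto simp: optimal_choice_def drop_first_def)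

lemma stay_first: "optimal_choice stay_first"
  using stays_or_drops by (auto simp: optimal_choice_def stay_first_def)

text \<open>Paths rise by at most 1, so \<open>J\<close> could overtake only from a common point.
  There its rise is an optimal drop, which \<open>drop_first\<close> takes as well.\<close>

lemma drop_first_greatest:
  assumes J: "lattice_path n k J" and opt: "\<forall>m\<in>{1..<n}. reduced_cost J m = 0" and m: "1 \<le> m" "m \<le> n"
  shows "J m \<le> choice_path drop_first m"
  using m
proof (induction m rule: dec_induct)
  case base
  then show ?case using J by (simp add: lattice_path_def)
next
  case (step m)
  have m: "1 \<le> m" "m < n" using step by auto
  have IH: "J m \<le> choice_path drop_first m" using step by simp
  show ?case
  proof (cases "J m < choice_path drop_first m \<or> J (m + 1) = J m")
    case True
    then show ?thesis using IH path_step[OF J m] m by auto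
  next
    case False
    then have eq: "J m = choice_path drop_first m" "J (m + 1) \<noteq> J m" "J (m + 1) = J m + 1"
      using IH path_step[OF J m] by auto
    then have "drops (k + 1 - J m) m"
      using reduced_cost_nonpos(2)[OF J m] opt m by auto
    then show ?thesis using eq by (simp add: drop_first_def)
  qed
qed

lemma stay_first_least:
  assumes J: "lattice_path n k J" and opt: "\<forall>m\<in>{1..<n}. reduced_cost J m = 0" and m: "1 \<le> m" "m \<le> n"
  shows "choice_path stay_first m \<le> J m"
  using m
proof (induction m rule: dec_induct)
  case base
  then show ?case using J by (simp add: lattice_path_def)
next
  case (step m)
  have m: "1 \<le> m" "m < n" using step by auto
  have IH: "choice_path stay_first m \<le> J m" using step by simp
  show ?case
  proof (cases "choice_path stay_first m < J m \<or> J (m + 1) = J m + 1")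
    case True
    then show ?thesis using IH path_step[OF J m] m by auto
  next
    case False
    then have eq: "J m = choice_path stay_first m" "J (m + 1) = J m"
      using IH path_step[OF J m] by auto
    then have "stays (k + 1 - J m) m"
      using reduced_cost_nonpos(2)[OF J m] opt m by auto
    then have "\<not> stay_first (k + 1 - choice_path stay_first m) m"
      by (simp add: stay_first_def eq(1))
    then show ?thesis using eq m by simp
  qed
qed

text \<open>A minimizer has only zero reduced costs, so its path lies below that of
  \<open>drop_first\<close> and its list lies above. A list that is not above \<open>?c\<close>
  therefore cannot attain the minimum.\<close>

lemma B_ce_eq: "B_ce n k b = choice_list drop_first"
  unfolding B_ce_def
proof (rule the_equality)
  let ?c = "choice_list drop_first"
  note c = choice_list[OF drop_first]
  show "?c \<in> B_C n k \<and> (\<forall>d\<in>B_C n k. (C_le ?c d \<longrightarrow> B_Delta k b ?c \<le> B_Delta k b d) \<and>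
      (\<not> C_le ?c d \<longrightarrow> B_Delta k b ?c < B_Delta k b d))"
  proof (intro conjI ballI impI c(1))
    fix d assume d: "d \<in> B_C n k"
    show le: "B_Delta k b ?c \<le> B_Delta k b d" unfolding c(3) by (rule Delta_ge(1)[OF d])
    assume not_le: "\<not> C_le ?c d"
    show "B_Delta k b ?c < B_Delta k b d"
    proof (rule ccontr)
      assume "\<not> ?thesis"
      then have "B_Delta k b d = - X k 1" using le c(3) by simp
      then have "\<forall>m\<in>{1..<n}. reduced_cost (path_of k d) m = 0" using Delta_ge(2)[OF d] by simp
      from drop_first_greatest[OF lattice_path_path_of[OF d nk(2)] this]
      have "C_le ?c d" by (intro C_le_path[OF c(1) d nk(2)]) (simp add: c(2))
      then show False using not_le by simp
    qed
  qed
  then show "c' = ?c" if "c' \<in> B_C n k \<and> (\<forall>d\<in>B_C n k. (C_le c' d \<longrightarrow> B_Delta k b c' \<le> B_Delta k b d) \<and>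
      (\<not> C_le c' d \<longrightarrow> B_Delta k b c' < B_Delta k b d))" for c'
    using extremal_unique[of c' "B_C n k" C_le "B_Delta k b" ?c] that C_le_antisym by blast
qed

lemma B_cf_eq: "B_cf n k b = choice_list stay_first"
  unfolding B_cf_def
proof (rule the_equality)
  let ?c = "choice_list stay_first"
  note c = choice_list[OF stay_first]
  show "?c \<in> B_C n k \<and> (\<forall>d\<in>B_C n k. (C_le d ?c \<longrightarrow> B_Delta k b ?c \<le> B_Delta k b d) \<and>
      (\<not> C_le d ?c \<longrightarrow> B_Delta k b ?c < B_Delta k b d))"
  proof (intro conjI ballI impI c(1))
    fix d assume d: "d \<in> B_C n k"
    show le: "B_Delta k b ?c \<le> B_Delta k b d" unfolding c(3) by (rule Delta_ge(1)[OF d])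
    assume not_le: "\<not> C_le d ?c"
    show "B_Delta k b ?c < B_Delta k b d"
    proof (rule ccontr)
      assume "\<not> ?thesis"
      then have "B_Delta k b d = - X k 1" using le c(3) by simp
      then have "\<forall>m\<in>{1..<n}. reduced_cost (path_of k d) m = 0" using Delta_ge(2)[OF d] by simp
      from stay_first_least[OF lattice_path_path_of[OF d nk(2)] this]
      have "C_le d ?c" by (intro C_le_path[OF d c(1) nk(2)]) (simp add: c(2))
      then show False using not_le by simp
    qed
  qed
  then show "c' = ?c" if "c' \<in> B_C n k \<and> (\<forall>d\<in>B_C n k. (C_le d c' \<longrightarrow> B_Delta k b c' \<le> B_Delta k b d) \<and>
      (\<not> C_le d c' \<longrightarrow> B_Delta k b c' < B_Delta k b d))" for c'
    using extremal_unique[of c' "B_C n k" "\<lambda>c d. C_le d c" "B_Delta k b" ?c] that C_le_antisym by blast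
qed

text \<open>Away from the path the values of R at \<open>l\<close> and \<open>l + 1\<close> agree,
  and the larger reduced cost is 0, so the common value persists. They differ, being 0 and
  \<open>d\<close>, only on the path itself, where the hypothesis \<open>step\<close> settles the
  outcome in accordance with \<open>D\<close>.\<close>

lemma R_trop_path:
  assumes D: "optimal_choice D"
    and step: "\<And>l m. (l, m) \<in> S1 n k \<Longrightarrow> l + m \<le> n \<Longrightarrow> 2 \<le> l \<Longrightarrow>
      max (x (l, m) - x (l, m + 1) + X l (m + 1)) (X (l - 1) (m + 1) + d) - X l m = (if D l m then d else 0)"
    and m: "1 \<le> m" "m \<le> n" and l: "1 \<le> l"
  shows "R_trop n k d x m l = (if k + 1 - choice_path D m < l then d else 0)"
  using m l
proof (induction m arbitrary: l)
  case (Suc m)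
  have S': "(k + 1 - choice_path D (Suc m), Suc m) \<in> S1 n k"
    using choice_path_S1[OF D, of "Suc m"] Suc.prems by simp
  consider "k < l \<or> n < l + m" | "\<not> (k < l \<or> n < l + m)" "l + m \<le> k" | "l \<le> k" "l + m \<le> n" "k < l + m"
    by linarith
  then show ?case
  proof cases
    case 1
    \<comment> \<open>The prescribed boundary values of \<open>R_trop\<close> are consistent with
      the claim because the path stays inside \<open>S1\<close>.\<close>
    then have "k + 1 - choice_path D (Suc m) < l" using S' by (auto simp: S1_def simp del: choice_path.simps)
    then show ?thesis using 1 by (simp del: choice_path.simps)
  next
    case 2
    then have "\<not> k + 1 - choice_path D (Suc m) < l" using S' by (auto simp: S1_def simp del: choice_path.simps)
    then show ?thesis using 2 by (simp del: choice_path.simps)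
  next
    case 3
    then have m: "1 \<le> m" "m < n" using Suc.prems by auto
    let ?L = "k + 1 - choice_path D m"
    have L: "1 \<le> choice_path D m" "choice_path D m \<le> k" "(?L, m) \<in> S1 n k"
      using choice_path_S1[OF D, of m] m by auto
    have L': "k + 1 - choice_path D (Suc m) = (if D ?L m then ?L - 1 else ?L)" using m by auto
    have L2: "2 \<le> ?L" if "D ?L m"
      using that D L m unfolding optimal_choice_def drops_def by fastforce
    have IH: "R_trop n k d x m l = (if ?L < l then d else 0)" "R_trop n k d x m (l + 1) = (if ?L < l + 1 then d else 0)"
      using Suc.IH[of l] Suc.IH[of "l + 1"] m Suc.prems by simp_all
    have S: "(l, m) \<in> S1 n k" using 3 Suc.prems by (auto simp: S1_def)
    show ?thesis
    proof (cases "2 \<le> l")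
      case False
      then have "l = 1" using Suc.prems by simp
      have "\<not> ?L < l" using \<open>l = 1\<close> L by simp
      moreover have "\<not> k + 1 - choice_path D (Suc m) < l"
        unfolding L' using \<open>l = 1\<close> L L2 by auto
      ultimately show ?thesis
        using 3 False IH X_one[of l m] unfolding X_def by (simp del: choice_path.simps add: Let_def)
    next
      case True
      have R: "R_trop n k d x (Suc m) l = max (x (l, m) - x (l, m + 1) + X l (m + 1) + (if ?L < l then d else 0))
          (X (l - 1) (m + 1) + (if ?L < l + 1 then d else 0)) - X l m"
        using 3 True by (simp add: IH[unfolded Suc_eq_plus1[symmetric]] X_def Let_def)
      consider "?L < l" | "l < ?L" | "?L = l" by linarith
      then show ?thesis
      proof cases
        case 1
        then have "k + 1 - choice_path D (Suc m) < l" unfolding L' by auto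
        then show ?thesis unfolding R using 1 X_max[OF 3(2) True] by auto
      next
        case 2
        then have "\<not> k + 1 - choice_path D (Suc m) < l" unfolding L' by auto
        then show ?thesis unfolding R using 2 X_max[OF 3(2) True] by auto
      next
        case eq: 3
        then have "k + 1 - choice_path D (Suc m) < l \<longleftrightarrow> D l m" unfolding L' using L2 by auto
        then show ?thesis unfolding R using eq step[OF S 3(2) True] by (simp del: choice_path.simps)
      qed
    qed
  qed
qed simp

text \<open>With a bonus of 1 on the drop, the maximum exceeds \<open>X\<close> exactly when
  dropping is optimal: by integrality, a suboptimal drop falls short by at least 1.\<close>

lemma R_trop_drop_first:
  assumes "1 \<le> m" "m \<le> n" "1 \<le> l"
  shows "R_trop n k 1 x m l = (if k + 1 - choice_path drop_first m < l then 1 else 0)"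
proof (rule R_trop_path[OF drop_first _ assms])
  fix l m assume "l + m \<le> n" "2 \<le> l"
  then show "max (x (l, m) - x (l, m + 1) + X l (m + 1)) (X (l - 1) (m + 1) + 1) - X l m =
      (if drop_first l m then 1 else 0)"
    using X_max[of l m] by (auto simp: drop_first_def drops_def)
qed

text \<open>With a penalty of 1 on the drop, the maximum is kept exactly when staying is optimal.
  Otherwise dropping is, and by integrality the maximum falls by exactly 1.\<close>

lemma R_trop_stay_first:
  assumes "1 \<le> m" "m \<le> n" "1 \<le> l"
  shows "R_trop n k (- 1) x m l = (if k + 1 - choice_path stay_first m < l then - 1 else 0)"
proof (rule R_trop_path[OF stay_first _ assms])
  fix l m assume "l + m \<le> n" "2 \<le> l"
  then show "max (x (l, m) - x (l, m + 1) + X l (m + 1)) (X (l - 1) (m + 1) + (- 1)) - X l m =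
      (if stay_first l m then - 1 else 0)"
    using X_max[of l m] by (auto simp: stay_first_def stays_def)
qed

text \<open>The path reaches height \<open>p\<close> at \<open>choice_list D ! (p - 1)\<close> and
  leaves it at \<open>choice_list D ! p\<close>, so the first identity is a discrete derivative of
  the indicator of height \<open>p\<close>. The second part says that both positions lie within the
  support of row \<open>p\<close>.\<close>

lemma choice_path_index:
  assumes D: "optimal_choice D" and p: "1 \<le> p" "p \<le> k"
  shows "(p \<le> q \<and> q \<le> p + (n + 1 - k) \<Longrightarrow>
      of_bool (q = choice_list D ! p) - of_bool (q = choice_list D ! (p - 1)) =
      (of_bool (choice_path D (q - 1) = p) - of_bool (choice_path D q = p) :: int))"
    and "\<not> (p \<le> q \<and> q \<le> p + (n + 1 - k)) \<Longrightarrow> q \<noteq> choice_list D ! p \<and> q \<noteq> choice_list D ! (p - 1)"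
proof -
  let ?c = "choice_list D" and ?J = "choice_path D"
  note c = choice_list(1)[OF D]
  have J: "lattice_path n k ?J" by (rule choice_path_lattice[OF D])
  have less: "?c ! j \<le> m \<longleftrightarrow> j < ?J m" if "j \<le> k" "m \<le> n + 1" for j m
    using path_of_less[OF c that(1), of m] choice_list(2)[OF D that(2)] by simp
  {
    assume q: "p \<le> q \<and> q \<le> p + (n + 1 - k)"
    have q': "1 \<le> q" "q \<le> n + 1" "q - 1 \<le> n" "q - 1 + 1 = q" using q p nk by auto
    have eq: "q = ?c ! j \<longleftrightarrow> ?J (q - 1) \<le> j \<and> j < ?J q" if "j \<le> k" for j
      using less[OF that, of q] less[OF that, of "q - 1"] q' by auto
    have "?J q = ?J (q - 1) \<or> ?J q = ?J (q - 1) + 1"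
      using J q'(3) unfolding lattice_path_def by (metis q'(4))
    then show "of_bool (q = ?c ! p) - of_bool (q = ?c ! (p - 1)) =
        (of_bool (?J (q - 1) = p) - of_bool (?J q = p) :: int)"
      using eq[of p] eq[of "p - 1"] p by auto
  next
    assume q: "\<not> (p \<le> q \<and> q \<le> p + (n + 1 - k))"
    have ge: "j + 1 \<le> ?c ! j" if "j \<le> k" for j
      using less[OF that, of j] lattice_path_add[OF J, of 0 j] that nk by simp
    have le: "?c ! j \<le> j + (n + 1 - k)" if "j \<le> k" for j
    proof -
      have "?J (n + 1) \<le> ?J (j + (n + 1 - k)) + (n + 1 - (j + (n + 1 - k)))"
        using that nk by (intro lattice_path_add[OF J]) auto
      moreover have "?J (n + 1) = k + 1" using J by (simp add: lattice_path_def)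
      ultimately have "j < ?J (j + (n + 1 - k))" using that nk by linarith
      then show ?thesis using less[OF that, of "j + (n + 1 - k)"] that nk by simp
    qed
    have "p - 1 \<le> k" using p by simp
    then have "p \<le> ?c ! (p - 1) \<and> ?c ! (p - 1) \<le> p + (n + 1 - k)"
      using ge[of "p - 1"] le[of "p - 1"] p by linarith
    moreover have "p \<le> ?c ! p \<and> ?c ! p \<le> p + (n + 1 - k)"
      using ge[OF p(2)] le[OF p(2)] by linarith
    ultimately show "q \<noteq> ?c ! p \<and> q \<noteq> ?c ! (p - 1)" using q by blast
  }
qed

text \<open>A shift of \<open>x\<close> by \<open>s\<close> along the path changes row
  \<open>p\<close> of \<open>b\<close> by \<open>s\<close> times the discrete derivative of the
  indicator of height \<open>p\<close>. This is the change made by \<open>B_e\<close> for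
  \<open>s = - 1\<close> and by \<open>B_f\<close> for \<open>s = 1\<close>.\<close>

lemma Omega_choice_path:
  assumes D: "optimal_choice D"
    and x': "\<And>l m. x' (l, m) = (if (l, m) \<in> S1 n k \<and> k + 1 - choice_path D m = l then x (l, m) + s else x (l, m))"
  shows "Omega n k x' p q = (if 1 \<le> p \<and> p \<le> k
    then b p q - s * (of_bool (q = choice_list D ! p) - of_bool (q = choice_list D ! (p - 1))) else b p q)"
proof (cases "1 \<le> p \<and> p \<le> k \<and> p \<le> q \<and> q \<le> p + (n + 1 - k)")
  case True
  have J: "lattice_path n k (choice_path D)" by (rule choice_path_lattice[OF D])
  have x'q: "x' (k + 1 - p, m) = x (k + 1 - p, m) + s * of_bool (choice_path D m = p)" if "m \<le> n + 1" for m
  proof (cases "1 \<le> m \<and> m \<le> n")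
    case m: True
    show ?thesis
      using choice_path_S1[OF D, of m] m True unfolding x' by auto
  next
    case False
    then have "m = 0 \<or> m = n + 1" using that by auto
    \<comment> \<open>The heights 0 and \<open>k + 1\<close> at the two ends are not rows of
      \<open>b\<close>.\<close>
    then have "choice_path D m \<noteq> p" "(k + 1 - p, m) \<notin> S1 n k"
      using J True by (auto simp: lattice_path_def S1_def)
    then show ?thesis unfolding x' by simp
  qed
  have q: "q \<le> n + 1" "q - 1 \<le> n + 1" using True nk by linarith+
  have "Omega n k x' p q = x' (k + 1 - p, q) - x' (k + 1 - p, q - 1)"
    "b p q = x (k + 1 - p, q) - x (k + 1 - p, q - 1)"
    using True by (simp_all add: Omega_def b_def Let_def)
  then have "Omega n k x' p q =
      b p q - s * (of_bool (choice_path D (q - 1) = p) - of_bool (choice_path D q = p))"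
    unfolding x'q[OF q(1)] x'q[OF q(2)] by (simp add: algebra_simps)
  also have "of_bool (choice_path D (q - 1) = p) - of_bool (choice_path D q = p) =
      (of_bool (q = choice_list D ! p) - of_bool (q = choice_list D ! (p - 1)) :: int)"
    using True by (intro choice_path_index(1)[OF D, symmetric]) auto
  finally show ?thesis using True by simp
next
  case False
  show ?thesis
  proof (cases "1 \<le> p \<and> p \<le> k")
    case True
    then show ?thesis
      using False choice_path_index(2)[OF D, of p q] Omega_outside[OF False] unfolding b_def by simp
  next
    case False
    then show ?thesis unfolding b_def Omega_def Let_def by auto
  qed
qed

lemma e_zero: "Omega n k (UD_action (S1 n k) (geom_e n k 0) 1 x) = B_e n k 0 b"
proof -
  \<comment> \<open>\<open>R_trop\<close> jumps from 0 to 1 between the path and the next larger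
    \<open>l\<close>, so its difference between \<open>l\<close> and \<open>l + 1\<close> is - 1 on
    the path and 0 elsewhere.\<close>
  have x': "UD_action (S1 n k) (geom_e n k 0) 1 x (l, m) =
      (if (l, m) \<in> S1 n k \<and> k + 1 - choice_path drop_first m = l then x (l, m) + (- 1) else x (l, m))" for l m
  proof (cases "(l, m) \<in> S1 n k")
    case True
    then have "1 \<le> m" "m \<le> n" "1 \<le> l" by (auto simp: S1_def)
    then show ?thesis
      using True nk R_trop_drop_first[of m l] R_trop_drop_first[of m "l + 1"]
      by (auto simp: UD_action_e0[OF nk(2,3) x])
  next
    case False
    then show ?thesis using x by (auto simp: UD_action_e0[OF nk(2,3) x] cochars_def)
  qed
  show ?thesis
    by (intro ext) (simp add: Omega_choice_path[OF drop_first x'] B_e_def B_ce_eq Let_def)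
qed

lemma f_zero: "Omega n k (UD_action (S1 n k) (geom_e n k 0) (- 1) x) = B_f n k 0 b"
proof -
  have x': "UD_action (S1 n k) (geom_e n k 0) (- 1) x (l, m) =
      (if (l, m) \<in> S1 n k \<and> k + 1 - choice_path stay_first m = l then x (l, m) + 1 else x (l, m))" for l m
  proof (cases "(l, m) \<in> S1 n k")
    case True
    then have "1 \<le> m" "m \<le> n" "1 \<le> l" by (auto simp: S1_def)
    then show ?thesis
      using True nk R_trop_stay_first[of m l] R_trop_stay_first[of m "l + 1"]
      by (auto simp: UD_action_e0[OF nk(2,3) x])
  next
    case False
    then show ?thesis using x by (auto simp: UD_action_e0[OF nk(2,3) x] cochars_def)
  qed
  show ?thesis
    by (intro ext) (simp add: Omega_choice_path[OF stay_first x'] B_f_def B_cf_eq Let_def)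
qed

lemma eps_zero: "B_eps n k 0 b = UD_fun (S1 n k) (geom_eps n k 0) x"
proof -
  have "x (1, n + 1) = 0" using x by (auto simp: cochars_def S1_def)
  then have "b k (n + 1) = - x (1, n)"
    unfolding b_def using Omega_cochars[OF x, of k "n + 1"] nk by simp
  then show ?thesis
    using choice_list(3)[OF drop_first] UD_fun_0(2)[OF nk(2,3) x]
    by (simp add: B_eps_def B_ce_eq X_def)
qed

lemma phi_zero:
  "B_phi n k 0 b = UD_fun (S1 n k) (geom_eps n k 0) x + UD_fun (S1 n k) (geom_gamma n k 0) x"
proof -
  have "x (k, 0) = 0" using x by (auto simp: cochars_def S1_def)
  then have "b 1 1 = x (k, 1)"
    unfolding b_def using Omega_cochars[OF x, of 1 1] nk by simp
  then show ?thesis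
    using choice_list(3)[OF stay_first] UD_fun_0[OF nk(2,3) x]
    by (simp add: B_phi_def B_cf_eq X_def)
qed

end

section \<open>The isomorphism\<close>

text \<open>The sum telescopes down to \<open>x (k + 1 - j, j - 1)\<close>, which is 0 because it
  lies outside \<open>S1\<close>. The empty sum at \<open>m = j - 1\<close> anchors the
  induction.\<close>

lemma sum_Omega:
  assumes x: "x \<in> cochars (S1 n k)" and j: "1 \<le> j" "j \<le> k" and k: "k \<le> n"
    and m: "j \<le> m + 1" "m \<le> j + (n + 1 - k)"
  shows "(\<Sum>i = j..m. Omega n k x j i) = x (k + 1 - j, m)"
  using m
proof (induction m)
  case 0
  then have "j = 1" using j by simp
  then show ?case using x by (simp add: cochars_def S1_def)
next
  case (Suc m)
  show ?case
  proof (cases "j = Suc m + 1")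
    case True
    then have "(k + 1 - j, Suc m) \<notin> S1 n k" by (auto simp: S1_def)
    then show ?thesis using True x by (simp add: cochars_def)
  next
    case False
    then have "j \<le> Suc m" using Suc.prems by simp
    then show ?thesis
      using Suc Omega_cochars[OF x j, of "Suc m"] by simp
  qed
qed

lemma Omega_in_B_elems:
  assumes x: "x \<in> cochars (S1 n k)" and k: "k \<le> n"
  shows "Omega n k x \<in> B_elems n k"
proof -
  have "(\<Sum>i = j..j + (n + 1 - k). Omega n k x j i) = 0" if "j \<in> {1..k}" for j
  proof -
    have "(k + 1 - j, j + (n + 1 - k)) \<notin> S1 n k" using that k by (auto simp: S1_def)
    then have "x (k + 1 - j, j + (n + 1 - k)) = 0" using x unfolding cochars_def by blast
    then show ?thesis using that k by (subst sum_Omega[OF x]) auto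
  qed
  then show ?thesis
    unfolding B_elems_def Let_def using Omega_outside by blast
qed

text \<open>The inverse takes partial row sums. That each row of \<open>b\<close> has sum 0 is what
  makes the partial sum vanish at \<open>j + (n + 1 - k)\<close>, the first position beyond
  \<open>S1\<close>.\<close>

lemma Omega_bij_betw:
  assumes k: "k \<le> n"
  shows "bij_betw (Omega n k) (cochars (S1 n k)) (B_elems n k)"
  unfolding bij_betw_def
proof (intro conjI inj_onI subset_antisym subsetI)
  fix x y
  assume x: "x \<in> cochars (S1 n k)" and y: "y \<in> cochars (S1 n k)" and eq: "Omega n k x = Omega n k y"
  show "x = y"
  proof
    fix v :: "nat \<times> nat"
    show "x v = y v"
    proof (cases "v \<in> S1 n k")
      case True
      then obtain l m where v: "v = (l, m)" "1 \<le> l" "l \<le> k" "k < l + m" "l + m \<le> n + 1"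
        by (cases v) (auto simp: S1_def)
      define j where "j = k + 1 - l"
      have j: "1 \<le> j" "j \<le> k" "j \<le> m + 1" "m \<le> j + (n + 1 - k)" "k + 1 - j = l"
        using v k by (auto simp: j_def)
      show ?thesis
        using sum_Omega[OF x j(1,2) k j(3,4)] sum_Omega[OF y j(1,2) k j(3,4)] unfolding v(1) j(5) eq by simp
    next
      case False
      then show ?thesis
        using fun_cong[OF coord_cochars[OF x], of v] fun_cong[OF coord_cochars[OF y], of v] by simp
    qed
  qed
next
  fix b assume "b \<in> Omega n k ` cochars (S1 n k)"
  then show "b \<in> B_elems n k" using Omega_in_B_elems[OF _ k] by blast
next
  fix b assume "b \<in> B_elems n k"
  then have out: "\<And>j i. \<not> (1 \<le> j \<and> j \<le> k \<and> j \<le> i \<and> i \<le> j + (n + 1 - k)) \<Longrightarrow> b j i = 0"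
    and sum0: "\<And>j. j \<in> {1..k} \<Longrightarrow> (\<Sum>i = j..j + (n + 1 - k). b j i) = 0"
    unfolding B_elems_def Let_def by auto
  define x where "x = (\<lambda>(l, m). if (l, m) \<in> S1 n k then \<Sum>i = k + 1 - l..m. b (k + 1 - l) i else 0)"
  have x: "x \<in> cochars (S1 n k)" by (auto simp: cochars_def x_def)
  have xs: "x (k + 1 - j, m) = (\<Sum>i = j..m. b j i)"
    if jm: "1 \<le> j" "j \<le> k" "j \<le> m + 1" "m \<le> j + (n + 1 - k)" for j m
  proof -
    have j: "k + 1 - (k + 1 - j) = j" using that by simp
    consider "m + 1 = j" | "m = j + (n + 1 - k)" | "j \<le> m" "m < j + (n + 1 - k)" using jm by linarith
    then show ?thesis
    proof cases
      case 1
      then show ?thesis using that by (simp add: x_def S1_def)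
    next
      case 2
      then have "(k + 1 - j, m) \<notin> S1 n k" using that k by (auto simp: S1_def)
      then show ?thesis using 2 sum0[of j] that by (simp add: x_def)
    next
      case 3
      then have "(k + 1 - j, m) \<in> S1 n k" using that k by (auto simp: S1_def)
      then show ?thesis unfolding x_def by (simp add: j[simplified])
    qed
  qed
  have "Omega n k x j i = b j i" for j i
  proof (cases "1 \<le> j \<and> j \<le> k \<and> j \<le> i \<and> i \<le> j + (n + 1 - k)")
    case True
    then have "{j..i} = insert i {j..i - 1}" "i \<notin> {j..i - 1}" by auto
    then have "(\<Sum>i = j..i. b j i) = b j i + (\<Sum>i = j..i - 1. b j i)" by simp
    moreover have "Omega n k x j i = x (k + 1 - j, i) - x (k + 1 - j, i - 1)"
      using True by (intro Omega_cochars[OF x]) auto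
    moreover have "i - 1 \<le> j + (n + 1 - k)" "j \<le> i - 1 + 1" using True by auto
    ultimately show ?thesis using True xs[of j i] xs[of j "i - 1"] by simp
  next
    case False
    then show ?thesis using Omega_outside[OF False] out[OF False] by simp
  qed
  then have "b = Omega n k x" by (intro ext) simp
  then show "b \<in> Omega n k ` cochars (S1 n k)" using x by blast
qed

theorem theorem7p3:
  fixes n k :: nat
  assumes "n \<ge> 2" and "1 \<le> k" and "k \<le> n"
  shows "crystal_iso {0..n} (UD_V n k) (B_inf n k) (Omega n k)"
  unfolding crystal_iso_def
proof (intro conjI ballI)
  show "bij_betw (Omega n k) (elems (UD_V n k)) (elems (B_inf n k))"
    using Omega_bij_betw[OF assms(3)] by (simp add: UD_V_def B_inf_def)
next
  fix i x assume "i \<in> {0..n}" and "x \<in> elems (UD_V n k)"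
  then have x: "x \<in> cochars (S1 n k)" and i: "i = 0 \<or> 1 \<le> i \<and> i \<le> n" by (auto simp: UD_V_def)
  let ?b = "Omega n k x"
  have e: "Omega n k (UD_action (S1 n k) (geom_e n k i) 1 x) = B_e n k i ?b"
    and f: "Omega n k (UD_action (S1 n k) (geom_e n k i) (- 1) x) = B_f n k i ?b"
    and eps: "B_eps n k i ?b = UD_fun (S1 n k) (geom_eps n k i) x"
    and phi: "B_phi n k i ?b = UD_fun (S1 n k) (geom_eps n k i) x + UD_fun (S1 n k) (geom_gamma n k i) x"
    using i e_zero[OF assms x] e_pos[OF _ _ assms(2,3) x] f_zero[OF assms x] f_pos[OF _ _ assms(2,3) x]
      eps_zero[OF assms x] eps_pos[OF _ _ assms(2,3) x] phi_zero[OF assms x] phi_pos[OF _ _ assms(2,3) x]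
    by auto
  show "Omega n k (e_op (UD_V n k) i x) = e_op (B_inf n k) i ?b"
    "Omega n k (f_op (UD_V n k) i x) = f_op (B_inf n k) i ?b"
    "wt (B_inf n k) i ?b = wt (UD_V n k) i x"
    "eps (B_inf n k) i ?b = eps (UD_V n k) i x"
    "phi (B_inf n k) i ?b = phi (UD_V n k) i x"
    by (simp_all add: UD_V_def B_inf_def e f eps phi)
qed

end
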